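(* Every measurable relation algebra $\mathfrak B$ with a scaffold is essentially isomorphic to a group relation algebra; that is, there is a frame $\mathcal F$ such that the completion of $\mathfrak B$ is isomorphic to the group relation algebra $\mathfrak G[\mathcal F]$.
   Context: **Relation algebras.** A relation algebra is an algebra $\mathfrak A=(A,+,-,;,{}^{\smile},1')$ such that $(A,+,-)$ is a Boolean algebra and for all $r,s,t$: $r;(s;t)=(r;s);t$, $r;1'=r$, $r^{\smile\smile}=r$, $(r;s)^\smile=s^\smile;r^\smile$, $(r+s);t=r;t+s;t$, $(r+s)^\smile=r^\smile+s^\smile$, $r^\smile;-(r;s)+-s=-s$. Order, $0$, $1$, suprema, atoms, completeness refer to the Boolean part. A function is an element $f$ with $f^\smile;f\le 1'$. A subidentity atom is an atom $x\le 1'$; it is measurable if $x;1;x$ is the sum (supremum) of a set of functions. A relation algebra is measurable if $1'$ is the sum of a set of measurable atoms. The completion of $\mathfrak B$ is its minimal complete extension: the (unique up to isomorphism over $\mathfrak B$) complete relation algebra having $\mathfrak B$ as a subalgebra and whose Boolean part is the Boolean completion of that of $\mathfrak B$. **Scaffolds.** In a measurable relation algebra let $I$ be the set of measurable atoms and $\mathcal E=\{(x,y)\in I\times I: x;1;y\neq0\}$ (an equivalence relation on $I$). A scaffold is a system $\langle a_{xy}:(x,y)\in\mathcal E\rangle$ of atoms with $a_{xy}\le x;1;y$, $a_{xx}=x$, $a_{yx}=a_{xy}^\smile$ for all $x\in I$, $(x,y)\in\mathcal E$, and $a_{xz}\le a_{xy};a_{yz}$ for all $(x,y),(y,z)\in\mathcal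 E$. **Frames.** A group pair $\mathcal F=(G,\varphi)$ consists of a system $G=\langle G_x:x\in I\rangle$ of pairwise disjoint groups and a system $\varphi=\langle\varphi_{xy}:(x,y)\in\mathcal E\rangle$, where $\mathcal E$ is an equivalence relation on $I$ and $\varphi_{xy}$ is an isomorphism from $G_x/H_{xy}$ to $G_y/K_{xy}$ ($H_{xy},K_{xy}$ normal subgroups of $G_x,G_y$). For a union $N$ of cosets of $H_{xy}$, $\varphi_{xy}[N]$ is the union of the images of the cosets of $H_{xy}$ included in $N$. The pair is a frame if: (i) $\varphi_{xx}$ is the identity automorphism of $G_x/\{e_x\}$ ($e_x$ the identity of $G_x$) for all $x\in I$; (ii) $\varphi_{yx}=\varphi_{xy}^{-1}$ for $(x,y)\in\mathcal E$; and whenever $(x,y),(y,z)\in\mathcal E$: (iii) $\varphi_{xy}[H_{xy}H_{xz}]=K_{xy}H_{yz}$; (iv) $\hat\varphi_{xy}|\hat\varphi_{yz}=\hat\varphi_{xz}$, where $|$ is composition applying the left map first and $\hat\varphi_{xy}:G_x/(H_{xy}H_{xz})\to G_y/(K_{xy}H_{yz})$, $\hat\varphi_{yz}:G_y/(K_{xy}H_{yz})\to G_z/(K_{xz}K_{yz})$, $\hat\varphi_{xz}:G_x/(H_{xy}H_{xz})\to G_z/(K_{xz}K_{yz})$ are the induced isomorphisms. **Group relation algebras.** For a frame $\mathcal F$ put $U=\bigcup_{x\in I}G_x$, $E=\bigcup\{G_x\times G_y:(x,y)\in\mathcal E\}$, and for $(x,y)\in\mathcal E$ and $\alpha\in G_x/H_{xy}$,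 $$R_{xy,\alpha}=\bigcup\{\xi\times(\varphi_{xy}(\xi)\varphi_{xy}(\alpha)):\xi\in G_x/H_{xy}\}.$$ The group relation algebra $\mathfrak G[\mathcal F]$ on $\mathcal F$ is the algebra whose universe is the set of all unions of sets of relations $R_{xy,\alpha}$, with operations set-theoretic union, complement relative to the unit $E$, relational composition, relational converse, and $id_U$ as identity element. (It is a complete set relation algebra.) *)

theory Defs
  imports "HOL-Algebra.Coset" "HOL-Library.Disjoint_Sets"
begin

section \<open>Relation algebras\<close>

record 'a relalg = "'a partial_object" +
  ra_add :: "'a \<Rightarrow> 'a \<Rightarrow> 'a"  (infixl "\<oplus>\<index>" 65)
  ra_neg :: "'a \<Rightarrow> 'a"  ("\<ominus>\<index> _" [81] 80)
  ra_comp :: "'a \<Rightarrow> 'a \<Rightarrow> 'a"  (infixl "\<Zsemi>\<index>" 70)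
  ra_conv :: "'a \<Rightarrow> 'a"  ("_\<^sup>\<smile>\<index>" [1000] 999)
  ra_ident :: "'a"  ("1''\<index>")

definition ra_meet :: "'a relalg \<Rightarrow> 'a \<Rightarrow> 'a \<Rightarrow> 'a"  (infixl "\<odot>\<index>" 70) where
  "r \<odot>\<^bsub>A\<^esub> s = \<ominus>\<^bsub>A\<^esub> (\<ominus>\<^bsub>A\<^esub> r \<oplus>\<^bsub>A\<^esub> \<ominus>\<^bsub>A\<^esub> s)"

definition ra_unit :: "'a relalg \<Rightarrow> 'a" where
  "ra_unit A = 1'\<^bsub>A\<^esub> \<oplus>\<^bsub>A\<^esub> \<ominus>\<^bsub>A\<^esub> 1'\<^bsub>A\<^esub>"

definition ra_zero :: "'a relalg \<Rightarrow> 'a" where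
  "ra_zero A = \<ominus>\<^bsub>A\<^esub> ra_unit A"

definition ra_le :: "'a relalg \<Rightarrow> 'a \<Rightarrow> 'a \<Rightarrow> bool"  (infix "\<preceq>\<index>" 50) where
  "r \<preceq>\<^bsub>A\<^esub> s \<longleftrightarrow> r \<oplus>\<^bsub>A\<^esub> s = s"

definition ra_order :: "'a relalg \<Rightarrow> 'a gorder" where
  "ra_order A = \<lparr>carrier = carrier A, eq = (=), le = (\<lambda>r s. r \<preceq>\<^bsub>A\<^esub> s)\<rparr>"

abbreviation ra_is_sum :: "'a relalg \<Rightarrow> 'a set \<Rightarrow> 'a \<Rightarrow> bool" where
  "ra_is_sum A X s \<equiv> is_lub (ra_order A) s X"

text \<open>
  The assumptions from \<open>add_closed\<close> to \<open>compl_meet\<close> make the reduct \<open>(A, +, -)\<close> a Boolean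
  algebra: they are Huntington's 1904 postulates, where the meet is the De Morgan dual of \<open>+\<close> and
  the two bounds are given by terms in \<open>+\<close> and \<open>-\<close> (commutativity of the meet is then immediate).
  One-element algebras are allowed.
\<close>

locale relation_algebra =
  fixes A :: "'a relalg" (structure)
  assumes add_closed: "\<lbrakk>r \<in> carrier A; s \<in> carrier A\<rbrakk> \<Longrightarrow> r \<oplus> s \<in> carrier A"
    and neg_closed: "r \<in> carrier A \<Longrightarrow> \<ominus> r \<in> carrier A"
    and comp_closed: "\<lbrakk>r \<in> carrier A; s \<in> carrier A\<rbrakk> \<Longrightarrow> r \<Zsemi> s \<in> carrier A"
    and conv_closed: "r \<in> carrier A \<Longrightarrow> r\<^sup>\<smile> \<in> carrier A"
    and ident_closed: "1' \<in> carrier A"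
    and add_commute: "\<lbrakk>r \<in> carrier A; s \<in> carrier A\<rbrakk> \<Longrightarrow> r \<oplus> s = s \<oplus> r"
    and add_zero: "r \<in> carrier A \<Longrightarrow> r \<oplus> ra_zero A = r"
    and meet_unit: "r \<in> carrier A \<Longrightarrow> r \<odot> ra_unit A = r"
    and add_meet_distrib: "\<lbrakk>r \<in> carrier A; s \<in> carrier A; t \<in> carrier A\<rbrakk>
      \<Longrightarrow> r \<oplus> (s \<odot> t) = (r \<oplus> s) \<odot> (r \<oplus> t)"
    and meet_add_distrib: "\<lbrakk>r \<in> carrier A; s \<in> carrier A; t \<in> carrier A\<rbrakk>
      \<Longrightarrow> r \<odot> (s \<oplus> t) = (r \<odot> s) \<oplus> (r \<odot> t)"
    and compl_add: "r \<in> carrier A \<Longrightarrow> r \<oplus> \<ominus> r = ra_unit A"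
    and compl_meet: "r \<in> carrier A \<Longrightarrow> r \<odot> \<ominus> r = ra_zero A"
    and comp_assoc: "\<lbrakk>r \<in> carrier A; s \<in> carrier A; t \<in> carrier A\<rbrakk>
      \<Longrightarrow> r \<Zsemi> (s \<Zsemi> t) = (r \<Zsemi> s) \<Zsemi> t"
    and comp_ident: "r \<in> carrier A \<Longrightarrow> r \<Zsemi> 1' = r"
    and conv_conv: "r \<in> carrier A \<Longrightarrow> (r\<^sup>\<smile>)\<^sup>\<smile> = r"
    and conv_comp: "\<lbrakk>r \<in> carrier A; s \<in> carrier A\<rbrakk> \<Longrightarrow> (r \<Zsemi> s)\<^sup>\<smile> = s\<^sup>\<smile> \<Zsemi> r\<^sup>\<smile>"
    and comp_distrib: "\<lbrakk>r \<in> carrier A; s \<in> carrier A; t \<in> carrier A\<rbrakk>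
      \<Longrightarrow> (r \<oplus> s) \<Zsemi> t = (r \<Zsemi> t) \<oplus> (s \<Zsemi> t)"
    and conv_add: "\<lbrakk>r \<in> carrier A; s \<in> carrier A\<rbrakk> \<Longrightarrow> (r \<oplus> s)\<^sup>\<smile> = r\<^sup>\<smile> \<oplus> s\<^sup>\<smile>"
    and tarski: "\<lbrakk>r \<in> carrier A; s \<in> carrier A\<rbrakk>
      \<Longrightarrow> (r\<^sup>\<smile> \<Zsemi> (\<ominus> (r \<Zsemi> s))) \<oplus> \<ominus> s = \<ominus> s"

definition ra_complete :: "'a relalg \<Rightarrow> bool" where
  "ra_complete A \<longleftrightarrow> complete_lattice (ra_order A)"

definition ra_atom :: "'a relalg \<Rightarrow> 'a \<Rightarrow> bool" where
  "ra_atom A x \<longleftrightarrow> x \<in> carrier A \<and> x \<noteq> ra_zero A \<and>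
    (\<forall>s\<in>carrier A. s \<preceq>\<^bsub>A\<^esub> x \<longrightarrow> s = ra_zero A \<or> s = x)"

definition ra_function :: "'a relalg \<Rightarrow> 'a \<Rightarrow> bool" where
  "ra_function A f \<longleftrightarrow> f \<in> carrier A \<and> (f\<^sup>\<smile>\<^bsub>A\<^esub> \<Zsemi>\<^bsub>A\<^esub> f) \<preceq>\<^bsub>A\<^esub> 1'\<^bsub>A\<^esub>"

definition ra_rect :: "'a relalg \<Rightarrow> 'a \<Rightarrow> 'a \<Rightarrow> 'a" where
  "ra_rect A x y = x \<Zsemi>\<^bsub>A\<^esub> ra_unit A \<Zsemi>\<^bsub>A\<^esub> y"

definition measurable_atom :: "'a relalg \<Rightarrow> 'a \<Rightarrow> bool" where
  "measurable_atom A x \<longleftrightarrow> ra_atom A x \<and> x \<preceq>\<^bsub>A\<^esub> 1'\<^bsub>A\<^esub> \<and>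
    (\<exists>X. (\<forall>f\<in>X. ra_function A f) \<and> ra_is_sum A X (ra_rect A x x))"

definition measurable_relation_algebra :: "'a relalg \<Rightarrow> bool" where
  "measurable_relation_algebra A \<longleftrightarrow> relation_algebra A \<and>
    (\<exists>X. (\<forall>x\<in>X. measurable_atom A x) \<and> ra_is_sum A X 1'\<^bsub>A\<^esub>)"

definition measurable_atoms :: "'a relalg \<Rightarrow> 'a set" where
  "measurable_atoms A = {x. measurable_atom A x}"

definition scaffold_index :: "'a relalg \<Rightarrow> ('a \<times> 'a) set" where
  "scaffold_index A = {(x, y). x \<in> measurable_atoms A \<and> y \<in> measurable_atoms A \<and>
    ra_rect A x y \<noteq> ra_zero A}"

definition scaffold :: "'a relalg \<Rightarrow> ('a \<Rightarrow> 'a \<Rightarrow> 'a) \<Rightarrow> bool" where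
  "scaffold A a \<longleftrightarrow>
    (\<forall>(x, y)\<in>scaffold_index A. ra_atom A (a x y) \<and> a x y \<preceq>\<^bsub>A\<^esub> ra_rect A x y) \<and>
    (\<forall>x\<in>measurable_atoms A. a x x = x) \<and>
    (\<forall>(x, y)\<in>scaffold_index A. a y x = (a x y)\<^sup>\<smile>\<^bsub>A\<^esub>) \<and>
    (\<forall>x y z. (x, y) \<in> scaffold_index A \<and> (y, z) \<in> scaffold_index A \<longrightarrow>
      a x z \<preceq>\<^bsub>A\<^esub> (a x y \<Zsemi>\<^bsub>A\<^esub> a y z))"

definition ra_hom :: "'a relalg \<Rightarrow> 'b relalg \<Rightarrow> ('a \<Rightarrow> 'b) set" where
  "ra_hom A B = {h. h \<in> carrier A \<rightarrow> carrier B \<and>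
    (\<forall>r\<in>carrier A. \<forall>s\<in>carrier A. h (r \<oplus>\<^bsub>A\<^esub> s) = h r \<oplus>\<^bsub>B\<^esub> h s) \<and>
    (\<forall>r\<in>carrier A. h (\<ominus>\<^bsub>A\<^esub> r) = \<ominus>\<^bsub>B\<^esub> h r) \<and>
    (\<forall>r\<in>carrier A. \<forall>s\<in>carrier A. h (r \<Zsemi>\<^bsub>A\<^esub> s) = h r \<Zsemi>\<^bsub>B\<^esub> h s) \<and>
    (\<forall>r\<in>carrier A. h (r\<^sup>\<smile>\<^bsub>A\<^esub>) = (h r)\<^sup>\<smile>\<^bsub>B\<^esub>) \<and>
    h 1'\<^bsub>A\<^esub> = 1'\<^bsub>B\<^esub>}"

definition ra_isomorphic :: "'a relalg \<Rightarrow> 'b relalg \<Rightarrow> bool"  (infix "\<cong>\<^sub>r" 50) where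
  "A \<cong>\<^sub>r B \<longleftrightarrow> (\<exists>h\<in>ra_hom A B. bij_betw h (carrier A) (carrier B))"

text \<open>
  A completion of \<open>B\<close> generally needs a larger carrier type than \<open>B\<close>, so the inclusion of the
  subalgebra \<open>B\<close> is an embedding \<open>e\<close>.  The last conjunct, density of the image of \<open>B\<close>, says that
  the complete Boolean part of \<open>C\<close> is the Boolean completion of the Boolean part of \<open>B\<close>.
\<close>

definition ra_completion :: "'a relalg \<Rightarrow> ('a \<Rightarrow> 'b) \<Rightarrow> 'b relalg \<Rightarrow> bool" where
  "ra_completion B e C \<longleftrightarrow> relation_algebra C \<and> ra_complete C \<and>
    e \<in> ra_hom B C \<and> inj_on e (carrier B) \<and>
    (\<forall>c\<in>carrier C. c \<noteq> ra_zero C \<longrightarrow>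
      (\<exists>b\<in>carrier B. b \<noteq> ra_zero B \<and> e b \<preceq>\<^bsub>C\<^esub> c))"

section \<open>Frames and group relation algebras\<close>

record ('i, 'g) grp_pair =
  idx :: "'i set"
  eqv :: "('i \<times> 'i) set"
  grp :: "'i \<Rightarrow> 'g monoid"
  HH :: "'i \<Rightarrow> 'i \<Rightarrow> 'g set"
  KK :: "'i \<Rightarrow> 'i \<Rightarrow> 'g set"
  phi :: "'i \<Rightarrow> 'i \<Rightarrow> 'g set \<Rightarrow> 'g set"

definition group_pair :: "('i, 'g) grp_pair \<Rightarrow> bool" where
  "group_pair F \<longleftrightarrow>
    equiv (idx F) (eqv F) \<and>
    (\<forall>x\<in>idx F. group (grp F x)) \<and>
    disjoint_family_on (\<lambda>x. carrier (grp F x)) (idx F) \<and>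
    (\<forall>(x, y)\<in>eqv F. HH F x y \<lhd> grp F x \<and> KK F x y \<lhd> grp F y \<and>
      phi F x y \<in> iso (grp F x Mod HH F x y) (grp F y Mod KK F x y))"

definition phi_image :: "('i, 'g) grp_pair \<Rightarrow> 'i \<Rightarrow> 'i \<Rightarrow> 'g set \<Rightarrow> 'g set" where
  "phi_image F x y N = \<Union> (phi F x y ` {\<xi> \<in> rcosets\<^bsub>grp F x\<^esub> (HH F x y). \<xi> \<subseteq> N})"

text \<open>
  Equality of isomorphisms between quotients includes equality of the quotients: the first two
  clauses of the identity condition and of the inverse condition concern the normal subgroups.
  A coset \<open>N\<close> of a normal subgroup including \<open>H\<^sub>x\<^sub>y\<close> is a union of cosets of \<open>H\<^sub>x\<^sub>y\<close>, and the
  isomorphism induced by \<open>\<phi>\<^sub>x\<^sub>y\<close> on the coarser quotient sends \<open>N\<close> to \<open>\<phi>\<^sub>x\<^sub>y[N]\<close>, i.e. it is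
  \<^const>\<open>phi_image\<close> restricted to such cosets.
\<close>

definition frame :: "('i, 'g) grp_pair \<Rightarrow> bool" where
  "frame F \<longleftrightarrow> group_pair F \<and>
    (\<forall>x\<in>idx F. HH F x x = {\<one>\<^bsub>grp F x\<^esub>} \<and> KK F x x = {\<one>\<^bsub>grp F x\<^esub>} \<and>
      (\<forall>\<xi>\<in>carrier (grp F x Mod {\<one>\<^bsub>grp F x\<^esub>}). phi F x x \<xi> = \<xi>)) \<and>
    (\<forall>(x, y)\<in>eqv F. HH F y x = KK F x y \<and> KK F y x = HH F x y \<and>
      (\<forall>\<xi>\<in>carrier (grp F x Mod HH F x y). phi F y x (phi F x y \<xi>) = \<xi>) \<and>
      (\<forall>\<eta>\<in>carrier (grp F y Mod KK F x y). phi F x y (phi F y x \<eta>) = \<eta>)) \<and>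
    (\<forall>x y z. (x, y) \<in> eqv F \<and> (y, z) \<in> eqv F \<longrightarrow>
      phi_image F x y (HH F x y <#>\<^bsub>grp F x\<^esub> HH F x z) = KK F x y <#>\<^bsub>grp F y\<^esub> HH F y z \<and>
      (\<forall>N\<in>carrier (grp F x Mod (HH F x y <#>\<^bsub>grp F x\<^esub> HH F x z)).
        phi_image F y z (phi_image F x y N) = phi_image F x z N))"

definition frame_base :: "('i, 'g) grp_pair \<Rightarrow> 'g set" where
  "frame_base F = (\<Union>x\<in>idx F. carrier (grp F x))"

definition frame_unit :: "('i, 'g) grp_pair \<Rightarrow> ('g \<times> 'g) set" where
  "frame_unit F = (\<Union>(x, y)\<in>eqv F. carrier (grp F x) \<times> carrier (grp F y))"

definition frame_rel :: "('i, 'g) grp_pair \<Rightarrow> 'i \<Rightarrow> 'i \<Rightarrow> 'g set \<Rightarrow> ('g \<times> 'g) set" where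
  "frame_rel F x y \<alpha> = (\<Union>\<xi>\<in>carrier (grp F x Mod HH F x y).
    \<xi> \<times> (phi F x y \<xi> \<otimes>\<^bsub>grp F y Mod KK F x y\<^esub> phi F x y \<alpha>))"

definition frame_rels :: "('i, 'g) grp_pair \<Rightarrow> ('g \<times> 'g) set set" where
  "frame_rels F =
    {frame_rel F x y \<alpha> | x y \<alpha>. (x, y) \<in> eqv F \<and> \<alpha> \<in> carrier (grp F x Mod HH F x y)}"

definition group_relation_algebra :: "('i, 'g) grp_pair \<Rightarrow> ('g \<times> 'g) set relalg"  ("\<GG>[_]") where
  "\<GG>[F] =
    \<lparr>carrier = {\<Union> X | X. X \<subseteq> frame_rels F},
     ra_add = (\<union>),
     ra_neg = (\<lambda>r. frame_unit F - r),
     ra_comp = (O),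
     ra_conv = converse,
     ra_ident = Id_on (frame_base F)\<rparr>"

end

theory Submission
  imports Defs "HOL-Algebra.Zassenhaus"
begin

text \<open>
  For a measurable atom \<open>x\<close>, the nonzero functions below \<open>x;1;x\<close> are atoms and form a group
  \<open>G\<^sub>x\<close> under relative multiplication.  Translating a scaffold atom \<open>a\<^sub>x\<^sub>y\<close> by \<open>G\<^sub>x\<close> on the left
  or by \<open>G\<^sub>y\<close> on the right gives all atoms below \<open>x;1;y\<close>, so the equation
  \<open>f;a\<^sub>x\<^sub>y = a\<^sub>x\<^sub>y;g\<close> defines an isomorphism between the quotients of \<open>G\<^sub>x\<close> and \<open>G\<^sub>y\<close> by the
  stabilizers of \<open>a\<^sub>x\<^sub>y\<close>.  The frame conditions come from the fact that
  \<open>a\<^sub>x\<^sub>z \<le> a\<^sub>x\<^sub>y;k;a\<^sub>y\<^sub>z\<close> holds exactly when \<open>k\<close> lies in the product of the stabilizers of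
  \<open>a\<^sub>y\<^sub>x\<close> and \<open>a\<^sub>y\<^sub>z\<close> in \<open>G\<^sub>y\<close>.

  If \<open>e\<close> embeds the algebra densely in a relation algebra \<open>C\<close>, then sending \<open>c\<close> to the set of pairs
  \<open>(f, g)\<close> with \<open>e (f\<^sup>\<smile>;a\<^sub>x\<^sub>y;g) \<le> c\<close> embeds \<open>C\<close> in the group relation algebra of this frame, and
  the embedding is onto if \<open>C\<close> is complete.  For \<open>e\<close> the identity this exhibits the group relation
  algebra as a completion; for an arbitrary completion it gives the isomorphism.
\<close>

section \<open>Arithmetic of relation algebras\<close>

text \<open>The algebra need not be complete, so stabilizers and composites cannot be handled as
  sums of the atoms below them. Density takes the place of such sums: every nonzero element has a
  suitable atom below it, and the cycle laws turn an inequality \<open>p \<preceq> r;s\<close>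
  between atoms into one about either factor.

  The points of the representation are the group elements, and
  \<open>f\<^sup>\<smile>;a x y;g\<close> is the atom that holds between the points \<open>f\<close>
  and \<open>g\<close>. For composition, the scaffold inequality gives one inclusion at once. The
  obstacle is the other one: an atom below \<open>p;q\<close> has to produce a single middle point
  that serves both \<open>p\<close> and \<open>q\<close>. Each factor alone determines a candidate
  in \<open>G y\<close>. The two candidates differ by some \<open>k\<close> with
  \<open>a x z \<preceq> a x y;k;a y z\<close>, and factoring \<open>k\<close> into stabilizing
  elements is what merges them.\<close>

context relation_algebra
begin

abbreviation zero_elem ("\<zero>") where "\<zero> \<equiv> ra_zero A"
abbreviation unit_elem ("\<U>") where "\<U> \<equiv> ra_unit A"

lemmas closed [simp, intro] = add_closed neg_closed comp_closed conv_closed ident_closed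

section \<open>Boolean algebra from Huntington's postulates\<close>

lemma unit_closed [simp, intro]: "\<U> \<in> carrier A"
  by (simp add: ra_unit_def)

lemma zero_closed [simp, intro]: "\<zero> \<in> carrier A"
  by (simp add: ra_zero_def)

lemma meet_closed [simp, intro]: "r \<in> carrier A \<Longrightarrow> s \<in> carrier A \<Longrightarrow> r \<odot> s \<in> carrier A"
  by (simp add: ra_meet_def)

lemma meet_commute: "r \<in> carrier A \<Longrightarrow> s \<in> carrier A \<Longrightarrow> r \<odot> s = s \<odot> r"
  by (simp add: ra_meet_def add_commute)

lemma add_idem: assumes "r \<in> carrier A" shows "r \<oplus> r = r"
proof -
  have "r = r \<oplus> (r \<odot> \<ominus> r)" using assms by (simp add: compl_meet add_zero)
  also have "\<dots> = (r \<oplus> r) \<odot> \<U>" using assms by (simp add: add_meet_distrib compl_add)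
  finally show ?thesis using assms by (simp add: meet_unit)
qed

lemma meet_idem: assumes "r \<in> carrier A" shows "r \<odot> r = r"
proof -
  have "r = r \<odot> (r \<oplus> \<ominus> r)" using assms by (simp add: compl_add meet_unit)
  also have "\<dots> = (r \<odot> r) \<oplus> \<zero>" using assms by (simp add: meet_add_distrib compl_meet)
  finally show ?thesis using assms by (simp add: add_zero)
qed

lemma zero_add: "r \<in> carrier A \<Longrightarrow> \<zero> \<oplus> r = r"
  using add_commute add_zero by auto

lemma unit_meet: "r \<in> carrier A \<Longrightarrow> \<U> \<odot> r = r"
  using meet_commute meet_unit by auto

lemma add_unit: assumes "r \<in> carrier A" shows "r \<oplus> \<U> = \<U>"
proof -
  have "r \<oplus> \<U> = (r \<oplus> \<ominus> r) \<odot> (r \<oplus> \<U>)" using assms by (simp add: compl_add unit_meet)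
  also have "\<dots> = r \<oplus> (\<ominus> r \<odot> \<U>)" using assms by (simp add: add_meet_distrib)
  finally show ?thesis using assms by (simp add: meet_unit compl_add)
qed

lemma meet_zero: assumes "r \<in> carrier A" shows "r \<odot> \<zero> = \<zero>"
proof -
  have "r \<odot> \<zero> = (r \<odot> \<ominus> r) \<oplus> (r \<odot> \<zero>)" using assms by (simp add: compl_meet zero_add)
  also have "\<dots> = r \<odot> (\<ominus> r \<oplus> \<zero>)" using assms by (simp add: meet_add_distrib)
  finally show ?thesis using assms by (simp add: add_zero compl_meet)
qed

lemma add_meet_absorb: assumes "r \<in> carrier A" "s \<in> carrier A" shows "r \<oplus> (r \<odot> s) = r"
proof -
  have "r \<oplus> (r \<odot> s) = (r \<odot> \<U>) \<oplus> (r \<odot> s)" using assms by (simp add: meet_unit)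
  also have "\<dots> = r \<odot> (s \<oplus> \<U>)" using assms by (simp add: meet_add_distrib add_commute)
  finally show ?thesis using assms by (simp add: add_unit meet_unit)
qed

lemma meet_add_absorb: assumes "r \<in> carrier A" "s \<in> carrier A" shows "r \<odot> (r \<oplus> s) = r"
  using assms by (simp add: meet_add_distrib meet_idem add_meet_absorb)

text \<open>Huntington's argument: both sides have the same meet with \<open>r\<close> and with \<open>\<ominus> r\<close>.\<close>

lemma add_assoc:
  assumes [simp]: "r \<in> carrier A" "s \<in> carrier A" "t \<in> carrier A"
  shows "(r \<oplus> s) \<oplus> t = r \<oplus> (s \<oplus> t)"
proof -
  let ?l = "(r \<oplus> s) \<oplus> t" and ?u = "r \<oplus> (s \<oplus> t)"
  have split: "u = (r \<odot> u) \<oplus> (\<ominus> r \<odot> u)" if "u \<in> carrier A" for u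
  proof -
    have "u = u \<odot> (r \<oplus> \<ominus> r)" using that by (simp add: compl_add meet_unit)
    also have "\<dots> = (u \<odot> r) \<oplus> (u \<odot> \<ominus> r)" using that by (simp add: meet_add_distrib)
    finally show ?thesis using that by (simp add: meet_commute)
  qed
  have "r \<odot> ?l = r \<odot> ?u"
    by (simp add: meet_add_distrib[of r "r \<oplus> s"] meet_add_absorb add_meet_absorb)
  moreover have "\<ominus> r \<odot> ?l = \<ominus> r \<odot> ?u"
    by (simp add: meet_add_distrib meet_commute[of "\<ominus> r" r] compl_meet zero_add)
  ultimately show ?thesis
    by (subst (1 2) split) simp_all
qed

lemma compl_unique:
  assumes [simp]: "r \<in> carrier A" "s \<in> carrier A" and "r \<oplus> s = \<U>" "r \<odot> s = \<zero>"
  shows "s = \<ominus> r"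
proof -
  have "s = s \<odot> (r \<oplus> \<ominus> r)" by (simp add: compl_add meet_unit)
  also have "\<dots> = (r \<odot> \<ominus> r) \<oplus> (s \<odot> \<ominus> r)"
    using assms by (simp add: meet_add_distrib compl_meet meet_commute[of s r])
  also have "\<dots> = \<ominus> r \<odot> (r \<oplus> s)"
    by (simp add: meet_add_distrib meet_commute)
  finally show ?thesis using assms by (simp add: meet_unit)
qed

lemma neg_neg [simp]: "r \<in> carrier A \<Longrightarrow> \<ominus> (\<ominus> r) = r"
  by (rule compl_unique[symmetric])
    (simp_all add: add_commute[of "\<ominus> r"] meet_commute[of "\<ominus> r"] compl_add compl_meet)

lemma le_refl [simp]: "r \<in> carrier A \<Longrightarrow> r \<preceq> r"
  by (simp add: ra_le_def add_idem)

lemma le_trans: "r \<preceq> s \<Longrightarrow> s \<preceq> t \<Longrightarrow> r \<in> carrier A \<Longrightarrow> s \<in> carrier A \<Longrightarrow> t \<in> carrier A \<Longrightarrow> r \<preceq> t"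
  unfolding ra_le_def by (metis add_assoc)

lemma le_antisym: "r \<preceq> s \<Longrightarrow> s \<preceq> r \<Longrightarrow> r \<in> carrier A \<Longrightarrow> s \<in> carrier A \<Longrightarrow> r = s"
  unfolding ra_le_def by (metis add_commute)

lemma le_add1 [simp]: "r \<in> carrier A \<Longrightarrow> s \<in> carrier A \<Longrightarrow> r \<preceq> r \<oplus> s"
  by (simp add: ra_le_def add_assoc[symmetric] add_idem)

lemma le_add2 [simp]: "r \<in> carrier A \<Longrightarrow> s \<in> carrier A \<Longrightarrow> s \<preceq> r \<oplus> s"
  using le_add1[of s r] by (simp add: add_commute)

lemma zero_le [simp]: "r \<in> carrier A \<Longrightarrow> \<zero> \<preceq> r"
  by (simp add: ra_le_def zero_add)

lemma le_unit [simp]: "r \<in> carrier A \<Longrightarrow> r \<preceq> \<U>"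
  by (simp add: ra_le_def add_unit)

lemma le_zero_iff: "r \<in> carrier A \<Longrightarrow> r \<preceq> \<zero> \<longleftrightarrow> r = \<zero>"
  using add_zero by (auto simp: ra_le_def)

lemma add_eq_zero_iff:
  assumes "r \<in> carrier A" "s \<in> carrier A"
  shows "r \<oplus> s = \<zero> \<longleftrightarrow> r = \<zero> \<and> s = \<zero>"
proof
  assume "r \<oplus> s = \<zero>"
  thus "r = \<zero> \<and> s = \<zero>" using le_add1[OF assms] le_add2[OF assms] assms by (metis le_zero_iff)
qed (simp add: add_idem)

lemma meet_le1 [simp]: "r \<in> carrier A \<Longrightarrow> s \<in> carrier A \<Longrightarrow> r \<odot> s \<preceq> r"
  by (simp add: ra_le_def add_commute[of "r \<odot> s"] add_meet_absorb)

lemma meet_le2 [simp]: "r \<in> carrier A \<Longrightarrow> s \<in> carrier A \<Longrightarrow> r \<odot> s \<preceq> s"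
  using meet_le1[of s r] by (simp add: meet_commute)

lemma meet_greatest:
  "t \<preceq> r \<Longrightarrow> t \<preceq> s \<Longrightarrow> r \<in> carrier A \<Longrightarrow> s \<in> carrier A \<Longrightarrow> t \<in> carrier A \<Longrightarrow> t \<preceq> r \<odot> s"
  by (simp add: ra_le_def add_meet_distrib)

lemma disjoint_iff_le_neg:
  assumes [simp]: "r \<in> carrier A" "s \<in> carrier A"
  shows "r \<odot> s = \<zero> \<longleftrightarrow> r \<preceq> \<ominus> s"
proof
  assume "r \<odot> s = \<zero>"
  moreover have "r = (r \<odot> s) \<oplus> (r \<odot> \<ominus> s)"
    by (simp add: meet_add_distrib[symmetric] compl_add meet_unit)
  ultimately have "r = r \<odot> \<ominus> s" by (simp add: zero_add)
  thus "r \<preceq> \<ominus> s" by (metis assms meet_le2 neg_closed)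
next
  assume "r \<preceq> \<ominus> s"
  hence "r \<odot> s \<preceq> \<ominus> s" by (rule le_trans[rotated]) simp_all
  hence "r \<odot> s \<preceq> s \<odot> \<ominus> s" by (intro meet_greatest) simp_all
  thus "r \<odot> s = \<zero>" by (simp add: compl_meet le_zero_iff)
qed

lemma le_iff_meet_neg: "r \<in> carrier A \<Longrightarrow> s \<in> carrier A \<Longrightarrow> r \<preceq> s \<longleftrightarrow> r \<odot> \<ominus> s = \<zero>"
  by (simp add: disjoint_iff_le_neg)

section \<open>Monotonicity of converse and composition, and the cycle laws\<close>

lemma conv_mono: "r \<preceq> s \<Longrightarrow> r \<in> carrier A \<Longrightarrow> s \<in> carrier A \<Longrightarrow> r\<^sup>\<smile> \<preceq> s\<^sup>\<smile>"
  unfolding ra_le_def by (metis conv_add)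

lemma conv_le_iff: "r \<in> carrier A \<Longrightarrow> s \<in> carrier A \<Longrightarrow> r\<^sup>\<smile> \<preceq> s\<^sup>\<smile> \<longleftrightarrow> r \<preceq> s"
  using conv_mono[of "r\<^sup>\<smile>" "s\<^sup>\<smile>"] conv_mono[of r s] by (auto simp: conv_conv)

lemma conv_eq_iff: "r \<in> carrier A \<Longrightarrow> s \<in> carrier A \<Longrightarrow> r\<^sup>\<smile> = s\<^sup>\<smile> \<longleftrightarrow> r = s"
  using conv_conv by metis

lemma conv_zero [simp]: "\<zero>\<^sup>\<smile> = \<zero>"
  using conv_mono[of \<zero> "\<zero>\<^sup>\<smile>"] by (simp add: conv_conv le_zero_iff)

lemma conv_zero_iff: "r \<in> carrier A \<Longrightarrow> r\<^sup>\<smile> = \<zero> \<longleftrightarrow> r = \<zero>"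
  using conv_eq_iff[of r \<zero>] by simp

lemma conv_ident [simp]: "1'\<^sup>\<smile> = 1'"
proof -
  have "1' = (1'\<^sup>\<smile> \<Zsemi> 1')\<^sup>\<smile>" by (simp add: comp_ident conv_conv)
  also have "\<dots> = 1'\<^sup>\<smile> \<Zsemi> 1'" by (simp add: conv_comp conv_conv)
  finally show ?thesis by (simp add: comp_ident)
qed

lemma ident_comp: "r \<in> carrier A \<Longrightarrow> 1' \<Zsemi> r = r"
  using conv_eq_iff[of "1' \<Zsemi> r" r] by (simp add: conv_comp comp_ident)

lemma comp_distrib_left:
  assumes "r \<in> carrier A" "s \<in> carrier A" "t \<in> carrier A"
  shows "r \<Zsemi> (s \<oplus> t) = (r \<Zsemi> s) \<oplus> (r \<Zsemi> t)"
proof -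
  have "(r \<Zsemi> (s \<oplus> t))\<^sup>\<smile> = ((r \<Zsemi> s) \<oplus> (r \<Zsemi> t))\<^sup>\<smile>"
    using assms by (simp add: conv_comp conv_add comp_distrib)
  thus ?thesis using assms by (simp add: conv_eq_iff)
qed

lemma comp_mono:
  assumes "r \<preceq> r'" "s \<preceq> s'"
    and [simp]: "r \<in> carrier A" "r' \<in> carrier A" "s \<in> carrier A" "s' \<in> carrier A"
  shows "r \<Zsemi> s \<preceq> r' \<Zsemi> s'"
proof -
  have "r \<Zsemi> s \<preceq> r' \<Zsemi> s" using assms(1) by (simp add: ra_le_def comp_distrib[symmetric])
  moreover have "r' \<Zsemi> s \<preceq> r' \<Zsemi> s'"
    using assms(2) by (simp add: ra_le_def comp_distrib_left[symmetric])
  ultimately show ?thesis by (rule le_trans) simp_all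
qed

lemma comp_mono_right:
  "s \<preceq> s' \<Longrightarrow> r \<in> carrier A \<Longrightarrow> s \<in> carrier A \<Longrightarrow> s' \<in> carrier A \<Longrightarrow> r \<Zsemi> s \<preceq> r \<Zsemi> s'"
  by (simp add: comp_mono)

lemma conv_disjoint:
  assumes [simp]: "r \<in> carrier A" "s \<in> carrier A"
  shows "r\<^sup>\<smile> \<odot> s\<^sup>\<smile> = \<zero> \<longleftrightarrow> r \<odot> s = \<zero>"
proof -
  have *: "u\<^sup>\<smile> \<odot> v\<^sup>\<smile> = \<zero>" if "u \<odot> v = \<zero>" and [simp]: "u \<in> carrier A" "v \<in> carrier A" for u v
  proof -
    let ?w = "u\<^sup>\<smile> \<odot> v\<^sup>\<smile>"
    have "?w\<^sup>\<smile> \<preceq> u" using conv_mono[of ?w "u\<^sup>\<smile>"] by (simp add: conv_conv)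
    moreover have "?w\<^sup>\<smile> \<preceq> v" using conv_mono[of ?w "v\<^sup>\<smile>"] by (simp add: conv_conv)
    ultimately have "?w\<^sup>\<smile> \<preceq> u \<odot> v" by (rule meet_greatest) simp_all
    thus ?thesis using that by (simp add: le_zero_iff conv_zero_iff)
  qed
  show ?thesis using *[of r s] *[of "r\<^sup>\<smile>" "s\<^sup>\<smile>"] by (auto simp: conv_conv)
qed

text \<open>The left Schroeder law. By Tarski's axiom \<open>r\<^sup>\<smile>\<close> composed with
  the complement of \<open>r;s\<close> avoids \<open>s\<close>, so anything disjoint from
  \<open>r;s\<close> is carried off \<open>s\<close> by \<open>r\<^sup>\<smile>\<close>; replacing
  \<open>r\<close> by its converse gives the other direction.\<close>

lemma cycle_left:
  assumes [simp]: "r \<in> carrier A" "s \<in> carrier A" "t \<in> carrier A"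
  shows "(r \<Zsemi> s) \<odot> t = \<zero> \<longleftrightarrow> (r\<^sup>\<smile> \<Zsemi> t) \<odot> s = \<zero>"
proof -
  have *: "(u\<^sup>\<smile> \<Zsemi> w) \<odot> v = \<zero>" if "(u \<Zsemi> v) \<odot> w = \<zero>"
    and [simp]: "u \<in> carrier A" "v \<in> carrier A" "w \<in> carrier A" for u v w
  proof -
    have "w \<preceq> \<ominus> (u \<Zsemi> v)" using that by (simp add: disjoint_iff_le_neg[symmetric] meet_commute)
    hence "u\<^sup>\<smile> \<Zsemi> w \<preceq> u\<^sup>\<smile> \<Zsemi> \<ominus> (u \<Zsemi> v)" by (intro comp_mono) simp_all
    moreover have "u\<^sup>\<smile> \<Zsemi> \<ominus> (u \<Zsemi> v) \<preceq> \<ominus> v" using tarski[of u v] by (simp add: ra_le_def)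
    ultimately have "u\<^sup>\<smile> \<Zsemi> w \<preceq> \<ominus> v" by (rule le_trans) simp_all
    thus ?thesis by (simp add: disjoint_iff_le_neg)
  qed
  show ?thesis using *[of r s t] *[of "r\<^sup>\<smile>" t s] by (auto simp: conv_conv)
qed

lemma cycle_right:
  assumes [simp]: "r \<in> carrier A" "s \<in> carrier A" "t \<in> carrier A"
  shows "(r \<Zsemi> s) \<odot> t = \<zero> \<longleftrightarrow> (t \<Zsemi> s\<^sup>\<smile>) \<odot> r = \<zero>"
proof -
  have "(r \<Zsemi> s) \<odot> t = \<zero> \<longleftrightarrow> (s\<^sup>\<smile> \<Zsemi> r\<^sup>\<smile>) \<odot> t\<^sup>\<smile> = \<zero>"
    using conv_disjoint[of "r \<Zsemi> s" t] by (simp add: conv_comp)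
  also have "\<dots> \<longleftrightarrow> (s \<Zsemi> t\<^sup>\<smile>) \<odot> r\<^sup>\<smile> = \<zero>" 
    using cycle_left[of "s\<^sup>\<smile>" "r\<^sup>\<smile>" "t\<^sup>\<smile>"] by (simp add: conv_conv)
  also have "\<dots> \<longleftrightarrow> (t \<Zsemi> s\<^sup>\<smile>) \<odot> r = \<zero>"
    using conv_disjoint[of "t \<Zsemi> s\<^sup>\<smile>" r] by (simp add: conv_comp conv_conv)
  finally show ?thesis .
qed

lemma zero_comp [simp]: "r \<in> carrier A \<Longrightarrow> \<zero> \<Zsemi> r = \<zero>"
  using cycle_right[of \<zero> r \<U>] by (simp add: meet_zero meet_unit)

lemma comp_zero [simp]: "r \<in> carrier A \<Longrightarrow> r \<Zsemi> \<zero> = \<zero>"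
  using cycle_left[of r \<zero> \<U>] by (simp add: meet_zero meet_unit)

section \<open>Atoms\<close>

lemma atom_closed [simp]: "ra_atom A p \<Longrightarrow> p \<in> carrier A"
  by (simp add: ra_atom_def)

lemma atom_nonzero: "ra_atom A p \<Longrightarrow> p \<noteq> \<zero>"
  unfolding ra_atom_def by blast

text \<open>This lets the cycle laws, which speak of zero meets, be used as equivalences between
  inequalities of atoms.\<close>

lemma atom_le_iff_meets:
  assumes "ra_atom A p" "r \<in> carrier A"
  shows "p \<preceq> r \<longleftrightarrow> p \<odot> r \<noteq> \<zero>"
proof
  note [simp] = assms(2) atom_closed[OF assms(1)]
  assume "p \<preceq> r"
  hence "p \<preceq> p \<odot> r" by (intro meet_greatest) simp_all
  thus "p \<odot> r \<noteq> \<zero>" using atom_nonzero[OF assms(1)] le_zero_iff by auto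
next
  note [simp] = assms(2) atom_closed[OF assms(1)]
  assume "p \<odot> r \<noteq> \<zero>"
  hence "p \<odot> r = p" using assms unfolding ra_atom_def by (metis meet_closed meet_le1)
  thus "p \<preceq> r" using meet_le2[of p r] by simp
qed

lemma atom_le_eq: "ra_atom A p \<Longrightarrow> r \<preceq> p \<Longrightarrow> r \<in> carrier A \<Longrightarrow> r \<noteq> \<zero> \<Longrightarrow> r = p"
  unfolding ra_atom_def by blast

lemma atom_le_add_iff:
  assumes "ra_atom A p" and [simp]: "r \<in> carrier A" "s \<in> carrier A"
  shows "p \<preceq> r \<oplus> s \<longleftrightarrow> p \<preceq> r \<or> p \<preceq> s"
  using assms by (simp add: atom_le_iff_meets meet_add_distrib add_eq_zero_iff)

lemma atom_le_neg_iff: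
  "ra_atom A p \<Longrightarrow> r \<in> carrier A \<Longrightarrow> p \<preceq> \<ominus> r \<longleftrightarrow> \<not> p \<preceq> r"
  using disjoint_iff_le_neg[of p r] atom_le_iff_meets[of p r] by simp

lemma atom_conv:
  assumes "ra_atom A p" shows "ra_atom A (p\<^sup>\<smile>)"
  unfolding ra_atom_def
proof (intro conjI ballI impI)
  note [simp] = atom_closed[OF assms]
  show "p\<^sup>\<smile> \<in> carrier A" by simp
  show "p\<^sup>\<smile> \<noteq> \<zero>" using atom_nonzero[OF assms] by (simp add: conv_zero_iff)
  fix s assume [simp]: "s \<in> carrier A" and "s \<preceq> p\<^sup>\<smile>"
  hence "s\<^sup>\<smile> \<preceq> p" using conv_mono[of s "p\<^sup>\<smile>"] by (simp add: conv_conv)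
  hence "s\<^sup>\<smile> = \<zero> \<or> s\<^sup>\<smile> = p" using atom_le_eq[OF assms, of "s\<^sup>\<smile>"] by auto
  thus "s = \<zero> \<or> s = p\<^sup>\<smile>" by (auto simp: conv_zero_iff conv_conv)
qed

lemma atom_le_comp_left:
  assumes "ra_atom A p" "ra_atom A q" and [simp]: "r \<in> carrier A"
  shows "p \<preceq> r \<Zsemi> q \<longleftrightarrow> q \<preceq> r\<^sup>\<smile> \<Zsemi> p"
  using assms cycle_left[of r q p] by (simp add: atom_le_iff_meets meet_commute)

lemma atom_le_comp_right:
  assumes "ra_atom A p" "ra_atom A q" and [simp]: "s \<in> carrier A"
  shows "p \<preceq> q \<Zsemi> s \<longleftrightarrow> q \<preceq> p \<Zsemi> s\<^sup>\<smile>"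
  using assms cycle_right[of q s p] by (simp add: atom_le_iff_meets meet_commute)

text \<open>By the cycle law \<open>r\<close> meets \<open>p;s\<^sup>\<smile>\<close>, and an atom
  \<open>q\<close> of \<open>D\<close> fits into that meet; with \<open>q\<close> in place of
  \<open>r\<close>, the same move on the other side finds \<open>q'\<close>. Later \<open>D\<close>
  consists of the images of cells in an extension.\<close>

lemma atom_le_comp_split:
  assumes D: "\<And>q. q \<in> D \<Longrightarrow> ra_atom A q"
    and dense: "\<And>c. c \<in> carrier A \<Longrightarrow> c \<noteq> \<zero> \<Longrightarrow> \<exists>q\<in>D. q \<preceq> c"
    and p: "ra_atom A p" "p \<preceq> r \<Zsemi> s" and [simp]: "r \<in> carrier A" "s \<in> carrier A"
  shows "\<exists>q\<in>D. \<exists>q'\<in>D. q \<preceq> r \<and> q' \<preceq> s \<and> p \<preceq> q \<Zsemi> q'"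
proof -
  note [simp] = atom_closed[OF p(1)]
  let ?m = "r \<odot> (p \<Zsemi> s\<^sup>\<smile>)"
  have "(r \<Zsemi> s) \<odot> p \<noteq> \<zero>" using p by (simp add: atom_le_iff_meets meet_commute)
  hence "?m \<noteq> \<zero>" using cycle_right[of r s p] by (simp add: meet_commute)
  then obtain q where q: "q \<in> D" "q \<preceq> ?m" using dense[of ?m] by auto
  note [simp] = atom_closed[OF D[OF q(1)]]
  have qr: "q \<preceq> r" by (rule le_trans[OF q(2)]) simp_all
  have "q \<preceq> p \<Zsemi> s\<^sup>\<smile>" by (rule le_trans[OF q(2)]) simp_all
  hence "p \<preceq> q \<Zsemi> s" using atom_le_comp_right[OF p(1) D[OF q(1)], of s] by simp
  hence "(q \<Zsemi> s) \<odot> p \<noteq> \<zero>" using p by (simp add: atom_le_iff_meets meet_commute)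
  let ?n = "s \<odot> (q\<^sup>\<smile> \<Zsemi> p)"
  have "?n \<noteq> \<zero>" using \<open>(q \<Zsemi> s) \<odot> p \<noteq> \<zero>\<close> cycle_left[of q s p] by (simp add: meet_commute)
  then obtain q' where q': "q' \<in> D" "q' \<preceq> ?n" using dense[of ?n] by auto
  note [simp] = atom_closed[OF D[OF q'(1)]]
  have qs: "q' \<preceq> s" by (rule le_trans[OF q'(2)]) simp_all
  have "q' \<preceq> q\<^sup>\<smile> \<Zsemi> p" by (rule le_trans[OF q'(2)]) simp_all
  hence "p \<preceq> q \<Zsemi> q'" using atom_le_comp_left[OF p(1) D[OF q'(1)], of q] by simp
  thus ?thesis using q q' qr qs by blast
qed

end

section \<open>The group of a measurable atom\<close>

text \<open>Zero, itself a function below \<open>x;1;x\<close>, must be left out for inverses to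
  exist.\<close>

definition atom_group :: "'a relalg \<Rightarrow> 'a \<Rightarrow> 'a monoid" where
  "atom_group A x = \<lparr>carrier = {f. ra_function A f \<and> f \<noteq> ra_zero A \<and> f \<preceq>\<^bsub>A\<^esub> ra_rect A x x},
    mult = ra_comp A, one = x\<rparr>"

context relation_algebra
begin

abbreviation G where "G x \<equiv> carrier (atom_group A x)"

text \<open>The equational form of lying below \<open>x;1;y\<close> when \<open>x\<close> and
  \<open>y\<close> are subidentity atoms (\<open>arrow_iff\<close>). Source and target behave as for
  morphisms, which makes composites and cancellations formal.\<close>

definition arrow where "arrow x y c \<longleftrightarrow> c \<in> carrier A \<and> x \<Zsemi> c = c \<and> c \<Zsemi> y = c"

lemma rect_closed [simp, intro]: "x \<in> carrier A \<Longrightarrow> y \<in> carrier A \<Longrightarrow> ra_rect A x y \<in> carrier A"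
  by (simp add: ra_rect_def)

lemma arrow_closed [simp]: "arrow x y c \<Longrightarrow> c \<in> carrier A"
  by (simp add: arrow_def)

lemma arrow_left: "arrow x y c \<Longrightarrow> x \<Zsemi> c = c"
  and arrow_right: "arrow x y c \<Longrightarrow> c \<Zsemi> y = c"
  by (simp_all add: arrow_def)

lemma arrow_comp:
  assumes "arrow x y c" "arrow y z d" "x \<in> carrier A" "z \<in> carrier A"
  shows "arrow x z (c \<Zsemi> d)"
  using assms comp_assoc[of x c d] comp_assoc[of c d z] by (simp add: arrow_def)

section \<open>Subidentities as one-sided units; domain and range of an arrow\<close>

lemma subid_comp_disjoint:
  assumes "x \<preceq> 1'" "y \<preceq> 1'" "x \<odot> y = \<zero>" and [simp]: "x \<in> carrier A" "y \<in> carrier A"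
  shows "x \<Zsemi> y = \<zero>"
proof -
  have "x \<Zsemi> y \<preceq> x" using comp_mono[OF le_refl assms(2), of x] by (simp add: comp_ident)
  moreover have "x \<Zsemi> y \<preceq> y" using comp_mono[OF assms(1) le_refl, of y] by (simp add: ident_comp)
  ultimately have "x \<Zsemi> y \<preceq> x \<odot> y" by (intro meet_greatest) simp_all
  thus ?thesis using assms by (simp add: le_zero_iff)
qed

text \<open>The rest of the identity, \<open>1' \<odot> \<ominus> x\<close>, annihilates
  \<open>x\<close> and hence everything below \<open>x;r\<close>. Splitting \<open>1'\<close> into
  \<open>x\<close> and this rest therefore leaves only \<open>x;c\<close> of
  \<open>1';c\<close>.\<close>

lemma subid_left:
  assumes x: "x \<preceq> 1'" and c: "c \<preceq> x \<Zsemi> r"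
    and [simp]: "x \<in> carrier A" "c \<in> carrier A" "r \<in> carrier A"
  shows "x \<Zsemi> c = c"
proof -
  let ?z = "1' \<odot> \<ominus> x"
  have "?z \<odot> x = \<zero>" by (simp add: disjoint_iff_le_neg)
  hence zx: "?z \<Zsemi> x = \<zero>" using x by (intro subid_comp_disjoint) simp_all
  have "?z \<Zsemi> c \<preceq> ?z \<Zsemi> (x \<Zsemi> r)" using c by (intro comp_mono) simp_all
  hence zc: "?z \<Zsemi> c = \<zero>" using zx by (simp add: comp_assoc le_zero_iff)
  have "1' \<odot> x = x" using x by (intro le_antisym meet_greatest) simp_all
  hence "1' = x \<oplus> ?z" by (metis assms(3) compl_add ident_closed meet_add_distrib meet_unit neg_closed)
  hence "c = (x \<oplus> ?z) \<Zsemi> c" using ident_comp[of c] by simp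
  thus ?thesis using zc by (simp add: comp_distrib add_zero)
qed

text \<open>By the cycle law \<open>x\<^sup>\<smile>;x\<close> is nonzero, and as a product of
  subidentities it lies below both factors; since these are atoms, all three coincide.\<close>

lemma subid_atom_conv:
  assumes x: "ra_atom A x" "x \<preceq> 1'"
  shows "x\<^sup>\<smile> = x"
proof -
  note [simp] = atom_closed[OF x(1)]
  have x': "x\<^sup>\<smile> \<preceq> 1'" using conv_mono[OF x(2)] by simp
  have "(x \<Zsemi> 1') \<odot> x \<noteq> \<zero>" using atom_nonzero[OF x(1)] by (simp add: comp_ident meet_idem)
  hence *: "(x\<^sup>\<smile> \<Zsemi> x) \<odot> 1' \<noteq> \<zero>" by (simp add: cycle_left)
  have "x\<^sup>\<smile> \<Zsemi> x \<noteq> \<zero>" using * by (auto simp: meet_commute[of \<zero>] meet_zero)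
  moreover have "x\<^sup>\<smile> \<Zsemi> x \<preceq> x" using comp_mono[OF x' le_refl, of x] by (simp add: ident_comp)
  ultimately have "x\<^sup>\<smile> \<Zsemi> x = x" by (intro atom_le_eq[OF x(1)]) simp_all
  moreover have "x\<^sup>\<smile> \<Zsemi> x \<preceq> x\<^sup>\<smile>" using comp_mono[OF le_refl x(2), of "x\<^sup>\<smile>"] by (simp add: comp_ident)
  ultimately have "x \<preceq> x\<^sup>\<smile>" by simp
  thus ?thesis using atom_le_eq[OF atom_conv[OF x(1)], of x] atom_nonzero[OF x(1)] by simp
qed

lemma subid_right:
  assumes y: "ra_atom A y" "y \<preceq> 1'" and c: "c \<preceq> r \<Zsemi> y"
    and [simp]: "c \<in> carrier A" "r \<in> carrier A"
  shows "c \<Zsemi> y = c"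
proof -
  note [simp] = atom_closed[OF y(1)]
  have "c\<^sup>\<smile> \<preceq> y \<Zsemi> r\<^sup>\<smile>" using conv_mono[OF c] by (simp add: conv_comp subid_atom_conv[OF y])
  hence "y \<Zsemi> c\<^sup>\<smile> = c\<^sup>\<smile>" by (intro subid_left[OF y(2), of "c\<^sup>\<smile>" "r\<^sup>\<smile>"]) simp_all
  hence "(c \<Zsemi> y)\<^sup>\<smile> = c\<^sup>\<smile>" by (simp add: conv_comp subid_atom_conv[OF y])
  thus ?thesis by (simp add: conv_eq_iff)
qed

lemma arrow_iff:
  assumes x: "ra_atom A x" "x \<preceq> 1'" and y: "ra_atom A y" "y \<preceq> 1'"
  shows "arrow x y c \<longleftrightarrow> c \<in> carrier A \<and> c \<preceq> ra_rect A x y"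
proof (intro iffI conjI)
  note [simp] = atom_closed[OF x(1)] atom_closed[OF y(1)]
  {
    assume c: "arrow x y c"
    hence [simp]: "c \<in> carrier A" by simp
    have "x \<Zsemi> c \<Zsemi> y \<preceq> x \<Zsemi> \<U> \<Zsemi> y" by (intro comp_mono le_refl le_unit) simp_all
    thus "c \<in> carrier A" "c \<preceq> ra_rect A x y"
      using c by (simp_all add: ra_rect_def arrow_def)
  }
  assume c: "c \<in> carrier A \<and> c \<preceq> ra_rect A x y"
  hence [simp]: "c \<in> carrier A" by simp
  have "x \<Zsemi> c = c" using c by (intro subid_left[OF x(2), where r = "\<U> \<Zsemi> y"])
    (simp_all add: ra_rect_def comp_assoc)
  moreover have "c \<Zsemi> y = c"
    using c by (intro subid_right[OF y, where r = "x \<Zsemi> \<U>"]) (simp_all add: ra_rect_def)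
  ultimately show "arrow x y c" by (simp add: arrow_def)
qed

lemma arrow_conv:
  assumes "ra_atom A x" "x \<preceq> 1'" "ra_atom A y" "y \<preceq> 1'" "arrow x y c"
  shows "arrow y x (c\<^sup>\<smile>)"
proof -
  have "y \<Zsemi> c\<^sup>\<smile> = (c \<Zsemi> y)\<^sup>\<smile>" "c\<^sup>\<smile> \<Zsemi> x = (x \<Zsemi> c)\<^sup>\<smile>"
    using assms by (simp_all add: conv_comp subid_atom_conv)
  thus ?thesis using assms by (simp add: arrow_def)
qed

lemma arrow_mono:
  assumes x: "ra_atom A x" "x \<preceq> 1'" "ra_atom A y" "y \<preceq> 1'"
    and "arrow x y c" "d \<preceq> c" "d \<in> carrier A"
  shows "arrow x y d"
  using assms by (auto simp: arrow_iff intro: le_trans)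

text \<open>The atom \<open>x\<close> cannot be cut, so a nonzero arrow from \<open>x\<close> has
  all of \<open>x\<close> as its domain: \<open>x;c\<close> meets \<open>c\<close>, and the cycle
  law shows that \<open>c;c\<^sup>\<smile>\<close> meets \<open>x\<close>.\<close>

lemma arrow_dom:
  assumes x: "ra_atom A x" "x \<preceq> 1'" and c: "arrow x y c" "c \<noteq> \<zero>"
  shows "x \<preceq> c \<Zsemi> c\<^sup>\<smile>"
proof -
  note [simp] = atom_closed[OF x(1)] arrow_closed[OF c(1)]
  have "(x \<Zsemi> c) \<odot> c \<noteq> \<zero>" using c by (simp add: arrow_left meet_idem)
  hence "(c \<Zsemi> c\<^sup>\<smile>) \<odot> x \<noteq> \<zero>" by (simp add: cycle_right)
  thus ?thesis using x by (simp add: atom_le_iff_meets meet_commute)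
qed

lemma arrow_ran:
  assumes y: "ra_atom A y" "y \<preceq> 1'" and c: "arrow x y c" "c \<noteq> \<zero>"
  shows "y \<preceq> c\<^sup>\<smile> \<Zsemi> c"
proof -
  note [simp] = atom_closed[OF y(1)] arrow_closed[OF c(1)]
  have "(c \<Zsemi> y) \<odot> c \<noteq> \<zero>" using c by (simp add: arrow_right meet_idem)
  hence "(c\<^sup>\<smile> \<Zsemi> c) \<odot> y \<noteq> \<zero>" by (simp add: cycle_left)
  thus ?thesis using y by (simp add: atom_le_iff_meets meet_commute)
qed

lemma measurable_atomD:
  assumes "measurable_atom A x"
  shows "ra_atom A x" "x \<preceq> 1'" "x \<in> carrier A" "x\<^sup>\<smile> = x" "x \<Zsemi> x = x"
proof -
  show x: "ra_atom A x" "x \<preceq> 1'" using assms by (simp_all add: measurable_atom_def)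
  show c: "x \<in> carrier A" "x\<^sup>\<smile> = x" using x by (simp_all add: subid_atom_conv)
  show "x \<Zsemi> x = x" using c by (intro subid_left[OF x(2), of x "1'"]) (simp_all add: comp_ident)
qed

lemma measurable_arrow_ident: "measurable_atom A x \<Longrightarrow> arrow x x x"
  by (simp add: arrow_def measurable_atomD)

section \<open>The nonzero functions below \<open>x;1;x\<close> as a group of atoms\<close>

lemma G_iff:
  "measurable_atom A x \<Longrightarrow> f \<in> G x \<longleftrightarrow> arrow x x f \<and> f \<noteq> \<zero> \<and> f\<^sup>\<smile> \<Zsemi> f \<preceq> 1'"
  by (auto simp: atom_group_def ra_function_def arrow_iff measurable_atomD)

lemma G_closed [simp]: "f \<in> G x \<Longrightarrow> f \<in> carrier A"
  by (simp add: atom_group_def ra_function_def)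

lemma G_conv_comp:
  assumes x: "measurable_atom A x" and f: "f \<in> G x"
  shows "f\<^sup>\<smile> \<Zsemi> f = x"
proof (rule le_antisym)
  note [simp] = measurable_atomD[OF x] G_closed[OF f]
  have a: "arrow x x f" "f \<noteq> \<zero>" "f\<^sup>\<smile> \<Zsemi> f \<preceq> 1'" using f x by (auto simp: G_iff)
  show "x \<preceq> f\<^sup>\<smile> \<Zsemi> f" using a by (intro arrow_ran) simp_all
  have "arrow x x (f\<^sup>\<smile> \<Zsemi> f)" using a by (intro arrow_comp arrow_conv) simp_all
  moreover have "x \<Zsemi> (f\<^sup>\<smile> \<Zsemi> f) \<preceq> x \<Zsemi> 1'" using a by (intro comp_mono) simp_all
  ultimately show "f\<^sup>\<smile> \<Zsemi> f \<preceq> x" by (simp add: arrow_left comp_ident)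
qed (use assms measurable_atomD in auto)

text \<open>A nonzero \<open>g\<close> below \<open>f\<close> still has full domain
  \<open>x\<close>, so \<open>f = x;f\<close> lies below \<open>g;(g\<^sup>\<smile>;f)\<close>,
  which is bounded by \<open>g;(f\<^sup>\<smile>;f) = g;x = g\<close>.\<close>

lemma G_atom:
  assumes x: "measurable_atom A x" and f: "f \<in> G x"
  shows "ra_atom A f"
  unfolding ra_atom_def
proof (intro conjI ballI impI)
  note [simp] = measurable_atomD[OF x] G_closed[OF f]
  have a: "arrow x x f" "f \<noteq> \<zero>" using f x by (auto simp: G_iff)
  show "f \<in> carrier A" "f \<noteq> \<zero>" using a by simp_all
  fix g assume [simp]: "g \<in> carrier A" and g: "g \<preceq> f"
  show "g = \<zero> \<or> g = f"
  proof (cases "g = \<zero>")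
    case False
    have ga: "arrow x x g" by (rule arrow_mono[of x x f]) (use a g in simp_all)
    have "x \<Zsemi> f \<preceq> (g \<Zsemi> g\<^sup>\<smile>) \<Zsemi> f" using False ga by (intro comp_mono arrow_dom) simp_all
    also have "(g \<Zsemi> g\<^sup>\<smile>) \<Zsemi> f = g \<Zsemi> (g\<^sup>\<smile> \<Zsemi> f)" by (simp add: comp_assoc)
    finally have "f \<preceq> g \<Zsemi> (g\<^sup>\<smile> \<Zsemi> f)" using a by (simp add: arrow_left)
    moreover have "g \<Zsemi> (g\<^sup>\<smile> \<Zsemi> f) \<preceq> g \<Zsemi> (f\<^sup>\<smile> \<Zsemi> f)" using g by (intro comp_mono conv_mono) simp_all
    ultimately have "f \<preceq> g" using ga by (auto simp: G_conv_comp[OF x f] arrow_right intro: le_trans)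
    thus ?thesis using g by (auto intro: le_antisym)
  qed simp
qed

text \<open>Here the sum of functions in the definition of a measurable atom enters: some member
  meets \<open>c\<close>, since otherwise the complement of \<open>c\<close> would be an upper
  bound, and cutting a function down to \<open>c\<close> leaves a function.\<close>

lemma G_below:
  assumes x: "measurable_atom A x" and c: "arrow x x c" "c \<noteq> \<zero>"
  shows "\<exists>f\<in>G x. f \<preceq> c"
proof -
  note [simp] = measurable_atomD[OF x] arrow_closed[OF c(1)]
  obtain X where X: "\<And>f. f \<in> X \<Longrightarrow> ra_function A f" "ra_is_sum A X (ra_rect A x x)"
    using x unfolding measurable_atom_def by blast
  have Xc: "f \<in> carrier A" "f \<preceq> ra_rect A x x" if "f \<in> X" for f
    using X that by (auto simp: least_def Upper_def ra_order_def ra_function_def)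
  have lub: "ra_rect A x x \<preceq> u" if "u \<in> carrier A" "\<And>f. f \<in> X \<Longrightarrow> f \<preceq> u" for u
    using X(2) that by (auto simp: least_def Upper_def ra_order_def)
  have "\<exists>f\<in>X. f \<odot> c \<noteq> \<zero>"
  proof (rule ccontr)
    assume "\<not> ?thesis"
    hence *: "ra_rect A x x \<preceq> \<ominus> c" by (intro lub) (auto simp: disjoint_iff_le_neg Xc)
    have "c \<preceq> ra_rect A x x" using c by (simp add: arrow_iff)
    hence "c \<preceq> \<ominus> c" using * by (rule le_trans) simp_all
    thus False using c by (simp add: disjoint_iff_le_neg[symmetric] meet_idem)
  qed
  then obtain f where f: "f \<in> X" "f \<odot> c \<noteq> \<zero>" by blast
  note [simp] = Xc[OF f(1)]
  let ?g = "f \<odot> c"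
  have "?g\<^sup>\<smile> \<Zsemi> ?g \<preceq> f\<^sup>\<smile> \<Zsemi> f" by (intro comp_mono conv_mono) simp_all
  moreover have "f\<^sup>\<smile> \<Zsemi> f \<preceq> 1'" using X(1)[OF f(1)] by (simp add: ra_function_def)
  ultimately have "?g\<^sup>\<smile> \<Zsemi> ?g \<preceq> 1'" by (rule le_trans) simp_all
  moreover have "arrow x x ?g" by (rule arrow_mono[of x x c]) (use c in simp_all)
  ultimately have "?g \<in> G x" using f x by (simp add: G_iff)
  thus ?thesis by (intro bexI[of _ ?g]) simp_all
qed

text \<open>That the converse of a function is again a function is not formal. Here
  \<open>f\<^sup>\<smile>\<close> is an atom with some function below it by \<open>G_below\<close>,
  and the two must be equal.\<close>

lemma G_conv:
  assumes x: "measurable_atom A x" and f: "f \<in> G x"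
  shows "f\<^sup>\<smile> \<in> G x"
proof -
  note [simp] = measurable_atomD[OF x] G_closed[OF f]
  have "arrow x x (f\<^sup>\<smile>)" "f\<^sup>\<smile> \<noteq> \<zero>"
    using f x by (auto simp: G_iff conv_zero_iff intro: arrow_conv)
  then obtain g where g: "g \<in> G x" "g \<preceq> f\<^sup>\<smile>" using G_below[OF x] by blast
  hence "g = f\<^sup>\<smile>" using G_iff[OF x, of g]
    by (intro atom_le_eq[OF atom_conv[OF G_atom[OF x f]]]) simp_all
  thus ?thesis using g by simp
qed

lemma G_comp_conv:
  assumes x: "measurable_atom A x" and f: "f \<in> G x"
  shows "f \<Zsemi> f\<^sup>\<smile> = x"
  using G_conv_comp[OF x G_conv[OF x f]] f by (simp add: conv_conv)

lemma G_left_cancel: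
  assumes x: "measurable_atom A x" and f: "f \<in> G x" and c: "arrow x y c"
  shows "f\<^sup>\<smile> \<Zsemi> (f \<Zsemi> c) = c" "f \<Zsemi> (f\<^sup>\<smile> \<Zsemi> c) = c"
  using c f by (simp_all add: comp_assoc G_comp_conv[OF x f] G_conv_comp[OF x f] arrow_left)

lemma G_right_cancel:
  assumes x: "measurable_atom A x" and f: "f \<in> G x" and c: "arrow y x c"
  shows "(c \<Zsemi> f) \<Zsemi> f\<^sup>\<smile> = c" "(c \<Zsemi> f\<^sup>\<smile>) \<Zsemi> f = c"
  using c f by (simp_all add: comp_assoc[symmetric] G_comp_conv[OF x f] G_conv_comp[OF x f] arrow_right)

lemma G_arrow: "measurable_atom A x \<Longrightarrow> f \<in> G x \<Longrightarrow> arrow x x f"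
  by (simp add: G_iff)

lemma G_comp:
  assumes x: "measurable_atom A x" and f: "f \<in> G x" and g: "g \<in> G x"
  shows "f \<Zsemi> g \<in> G x"
proof -
  note [simp] = measurable_atomD[OF x] G_closed[OF f] G_closed[OF g]
  have "(f \<Zsemi> g)\<^sup>\<smile> \<Zsemi> (f \<Zsemi> g) = g\<^sup>\<smile> \<Zsemi> (f\<^sup>\<smile> \<Zsemi> (f \<Zsemi> g))" by (simp add: conv_comp comp_assoc)
  also have "\<dots> = x"
    using G_left_cancel(1)[OF x f G_arrow[OF x g]] G_conv_comp[OF x g] by simp
  finally have e: "(f \<Zsemi> g)\<^sup>\<smile> \<Zsemi> (f \<Zsemi> g) = x" .
  have "f \<Zsemi> g \<noteq> \<zero>" using e atom_nonzero[of x] by auto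
  moreover have "arrow x x (f \<Zsemi> g)" using f g x by (intro arrow_comp[of x x] G_arrow) simp_all
  ultimately show ?thesis using e x by (simp add: G_iff)
qed

lemma ident_in_G: "measurable_atom A x \<Longrightarrow> x \<in> G x"
  by (simp add: G_iff measurable_arrow_ident measurable_atomD atom_nonzero)

lemma atom_group_simps [simp]:
  "f \<otimes>\<^bsub>atom_group A x\<^esub> g = f \<Zsemi> g" "\<one>\<^bsub>atom_group A x\<^esub> = x"
  by (simp_all add: atom_group_def)

lemma group_atom_group:
  assumes x: "measurable_atom A x" shows "group (atom_group A x)"
proof (rule groupI)
  fix f assume f: "f \<in> G x"
  show "\<one>\<^bsub>atom_group A x\<^esub> \<otimes>\<^bsub>atom_group A x\<^esub> f = f" using G_arrow[OF x f] by (simp add: arrow_left)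
  show "\<exists>g\<in>G x. g \<otimes>\<^bsub>atom_group A x\<^esub> f = \<one>\<^bsub>atom_group A x\<^esub>"
    using G_conv[OF x f] G_conv_comp[OF x f] by auto
qed (use assms in \<open>auto simp: G_comp ident_in_G comp_assoc\<close>)

lemma inv_atom_group:
  assumes "measurable_atom A x" "f \<in> G x" shows "inv\<^bsub>atom_group A x\<^esub> f = f\<^sup>\<smile>"
  using assms by (intro group.inv_equality) (simp_all add: group_atom_group G_conv G_conv_comp)

lemma G_disjoint:
  "measurable_atom A x \<Longrightarrow> measurable_atom A y \<Longrightarrow> f \<in> G x \<Longrightarrow> f \<in> G y \<Longrightarrow> x = y"
  using G_conv_comp by metis

text \<open>Translation by \<open>f\<close> preserves order and is undone by translation by
  \<open>f\<^sup>\<smile>\<close>, so it carries atoms to atoms. An element below \<open>f;p\<close>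
  must first be recognized as starting at \<open>x\<close>, where the cancellation is valid.\<close>

lemma G_comp_atom:
  assumes x: "measurable_atom A x" and f: "f \<in> G x" and p: "ra_atom A p" "arrow x y p"
  shows "ra_atom A (f \<Zsemi> p)"
  unfolding ra_atom_def
proof (intro conjI ballI impI)
  note [simp] = measurable_atomD[OF x] G_closed[OF f] atom_closed[OF p(1)]
  show "f \<Zsemi> p \<in> carrier A" by simp
  show "f \<Zsemi> p \<noteq> \<zero>" using G_left_cancel(1)[OF x f p(2)] atom_nonzero[OF p(1)] by auto
  fix c assume [simp]: "c \<in> carrier A" and c: "c \<preceq> f \<Zsemi> p"
  have "f \<Zsemi> p = x \<Zsemi> (f \<Zsemi> p)" using G_arrow[OF x f] by (simp add: comp_assoc arrow_left)
  hence "x \<Zsemi> c = c" using c by (intro subid_left[of x c "f \<Zsemi> p"]) simp_all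
  hence fc: "f \<Zsemi> (f\<^sup>\<smile> \<Zsemi> c) = c" by (simp add: comp_assoc G_comp_conv[OF x f])
  have "f\<^sup>\<smile> \<Zsemi> c \<preceq> f\<^sup>\<smile> \<Zsemi> (f \<Zsemi> p)" using c by (intro comp_mono) simp_all
  hence "f\<^sup>\<smile> \<Zsemi> c \<preceq> p" by (simp add: G_left_cancel[OF x f p(2)])
  hence "f\<^sup>\<smile> \<Zsemi> c = \<zero> \<or> f\<^sup>\<smile> \<Zsemi> c = p" using p(1) atom_le_eq[of p "f\<^sup>\<smile> \<Zsemi> c"] by auto
  thus "c = \<zero> \<or> c = f \<Zsemi> p" using fc by auto
qed

end

section \<open>Scaffolds\<close>

definition stabilizer :: "'a relalg \<Rightarrow> ('a \<Rightarrow> 'a \<Rightarrow> 'a) \<Rightarrow> 'a \<Rightarrow> 'a \<Rightarrow> 'a set" where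
  "stabilizer A a x y = {f \<in> carrier (atom_group A x). f \<Zsemi>\<^bsub>A\<^esub> a x y = a x y}"

locale scaffolded_algebra = relation_algebra +
  fixes a
  assumes measurable: "measurable_relation_algebra A"
    and scaffold: "scaffold A a"
begin

abbreviation E where "E \<equiv> scaffold_index A"
abbreviation H where "H \<equiv> stabilizer A a"

lemma E_D: "(x, y) \<in> E \<Longrightarrow> measurable_atom A x \<and> measurable_atom A y"
  by (simp add: scaffold_index_def measurable_atoms_def)

lemma E_atoms:
  assumes "(x, y) \<in> E"
  shows "ra_atom A x" "x \<preceq> 1'" "ra_atom A y" "y \<preceq> 1'"
    "x \<in> carrier A" "y \<in> carrier A" "x\<^sup>\<smile> = x" "y\<^sup>\<smile> = y"
  using E_D[OF assms] measurable_atomD by auto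

lemma a_atom: "(x, y) \<in> E \<Longrightarrow> ra_atom A (a x y)"
  using scaffold by (auto simp: scaffold_def)

lemma a_closed: "(x, y) \<in> E \<Longrightarrow> a x y \<in> carrier A"
  using a_atom by auto

lemma a_arrow: assumes "(x, y) \<in> E" shows "arrow x y (a x y)"
  using scaffold assms a_atom[OF assms] by (auto simp: scaffold_def arrow_iff E_atoms)

lemma a_ident: "measurable_atom A x \<Longrightarrow> a x x = x"
  using scaffold by (auto simp: scaffold_def measurable_atoms_def)

lemma a_conv: "(x, y) \<in> E \<Longrightarrow> (a x y)\<^sup>\<smile> = a y x"
  using scaffold by (auto simp: scaffold_def)

lemma a_le_comp: "(x, y) \<in> E \<Longrightarrow> (y, z) \<in> E \<Longrightarrow> a x z \<preceq> a x y \<Zsemi> a y z"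
  using scaffold by (auto simp: scaffold_def)

section \<open>The index relation as an equivalence\<close>

lemma E_I:
  assumes x: "measurable_atom A x" and y: "measurable_atom A y" and c: "arrow x y c" "c \<noteq> \<zero>"
  shows "(x, y) \<in> E"
proof -
  have "c \<preceq> ra_rect A x y" using c x y by (simp add: arrow_iff measurable_atomD)
  hence "ra_rect A x y \<noteq> \<zero>" using c by (auto simp: le_zero_iff)
  thus ?thesis using x y by (simp add: scaffold_index_def measurable_atoms_def)
qed

lemma E_refl: "measurable_atom A x \<Longrightarrow> (x, x) \<in> E"
  by (rule E_I[where c = x]) (simp_all add: measurable_arrow_ident measurable_atomD atom_nonzero)

lemma E_sym:
  assumes "(x, y) \<in> E" shows "(y, x) \<in> E"
proof (rule E_I)
  show "arrow y x ((a x y)\<^sup>\<smile>)" using assms a_arrow by (intro arrow_conv) (simp_all add: E_atoms)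
  show "(a x y)\<^sup>\<smile> \<noteq> \<zero>" using a_atom[OF assms] by (simp add: conv_zero_iff atom_nonzero)
qed (use assms E_D in auto)

lemma a_comp_conv: "(x, y) \<in> E \<Longrightarrow> x \<preceq> a x y \<Zsemi> a y x"
  using arrow_dom[OF _ _ a_arrow] a_atom by (simp add: E_atoms a_conv atom_nonzero)

text \<open>The composite \<open>a x y;a y z\<close> is a nonzero arrow: since \<open>y\<close> is
  below \<open>a y x;a x y\<close>, composing it with \<open>a y x\<close> on the left gives
  something above \<open>a y z\<close>.\<close>

lemma E_trans:
  assumes xy: "(x, y) \<in> E" and yz: "(y, z) \<in> E" shows "(x, z) \<in> E"
proof (rule E_I)
  note [simp] = a_closed[OF xy] a_closed[OF yz] a_closed[OF E_sym[OF xy]] E_atoms[OF xy]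
  show "arrow x z (a x y \<Zsemi> a y z)"
    using xy yz by (intro arrow_comp[of x y] a_arrow) (simp_all add: E_atoms)
  have "y \<Zsemi> a y z \<preceq> (a y x \<Zsemi> a x y) \<Zsemi> a y z"
    using a_comp_conv[OF E_sym[OF xy]] by (intro comp_mono) simp_all
  moreover have "y \<Zsemi> a y z = a y z" using a_arrow[OF yz] by (simp add: arrow_left)
  ultimately have "a y z \<preceq> a y x \<Zsemi> (a x y \<Zsemi> a y z)" by (simp add: comp_assoc)
  thus "a x y \<Zsemi> a y z \<noteq> \<zero>" using a_atom[OF yz] by (auto simp: le_zero_iff atom_nonzero)
qed (use assms E_D in auto)

lemma equiv_E: "equiv (measurable_atoms A) E"
proof (rule equivI)
  show "E \<subseteq> measurable_atoms A \<times> measurable_atoms A" by (auto simp: scaffold_index_def)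
  show "refl_on (measurable_atoms A) E" by (auto simp: refl_on_def measurable_atoms_def E_refl)
  show "sym E" by (rule symI) (rule E_sym)
  show "trans E" by (rule transI) (rule E_trans)
qed

section \<open>Atoms below a rectangle as translates of the scaffold atom\<close>

lemma below_arrow:
  assumes xy: "(x, y) \<in> E" and c: "arrow x y c" "c \<noteq> \<zero>"
  shows "\<exists>f\<in>G x. f \<Zsemi> a x y \<preceq> c"
proof -
  note yx = E_sym[OF xy]
  have x: "measurable_atom A x" using E_D[OF xy] by simp
  note [simp] = a_closed[OF xy] a_closed[OF yx] E_atoms[OF xy] arrow_closed[OF c(1)]
  \<comment> \<open>Returning to \<open>x\<close> along \<open>a y x\<close> turns \<open>c\<close>
    into a nonzero arrow from \<open>x\<close> to itself, so some group element \<open>f\<close>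
    lies below it; the cycle law brings this back to \<open>c\<close>.\<close>
  have "c \<Zsemi> y \<preceq> c \<Zsemi> (a y x \<Zsemi> a x y)"
    using a_comp_conv[OF yx] by (intro comp_mono) simp_all
  hence "c \<preceq> (c \<Zsemi> a y x) \<Zsemi> a x y" using c by (simp add: arrow_right comp_assoc)
  hence "c \<Zsemi> a y x \<noteq> \<zero>" using c by (auto simp: le_zero_iff)
  moreover have "arrow x x (c \<Zsemi> a y x)" using c yx by (intro arrow_comp[of x y] a_arrow) simp_all
  ultimately obtain f where f: "f \<in> G x" "f \<preceq> c \<Zsemi> a y x" using G_below[OF x] by blast
  have fa: "ra_atom A (f \<Zsemi> a x y)" by (rule G_comp_atom[OF x f(1) a_atom[OF xy] a_arrow[OF xy]])
  have "f \<odot> (c \<Zsemi> a y x) \<noteq> \<zero>" using f G_atom[OF x f(1)] by (simp add: atom_le_iff_meets)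
  hence "(f \<Zsemi> a x y) \<odot> c \<noteq> \<zero>"
    using f cycle_right[of c "a y x" f] by (simp add: meet_commute a_conv[OF yx])
  hence "f \<Zsemi> a x y \<preceq> c" using fa by (simp add: atom_le_iff_meets)
  thus ?thesis using f by blast
qed

text \<open>An atom above a translate of \<open>a x y\<close> is equal to it, so the action of
  \<open>G x\<close> on these atoms is transitive. Together with the right-handed version, this
  supplies each \<open>f\<close> with a partner \<open>g\<close> such that
  \<open>f;a x y = a x y;g\<close>.\<close>

lemma arrow_atom_left:
  assumes xy: "(x, y) \<in> E" and p: "ra_atom A p" "arrow x y p"
  shows "\<exists>f\<in>G x. p = f \<Zsemi> a x y"
proof -
  have x: "measurable_atom A x" using E_D[OF xy] by simp
  obtain f where f: "f \<in> G x" "f \<Zsemi> a x y \<preceq> p"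
    using below_arrow[OF xy p(2)] atom_nonzero[OF p(1)] by blast
  have q: "ra_atom A (f \<Zsemi> a x y)" by (rule G_comp_atom[OF x f(1) a_atom[OF xy] a_arrow[OF xy]])
  have "f \<Zsemi> a x y = p" by (rule atom_le_eq[OF p(1) f(2) atom_closed[OF q] atom_nonzero[OF q]])
  thus ?thesis using f by auto
qed

lemma arrow_atom_right:
  assumes xy: "(x, y) \<in> E" and p: "ra_atom A p" "arrow x y p"
  shows "\<exists>g\<in>G y. p = a x y \<Zsemi> g"
proof -
  note yx = E_sym[OF xy]
  have y: "measurable_atom A y" using E_D[OF xy] by simp
  have "arrow y x (p\<^sup>\<smile>)" using p xy by (intro arrow_conv) (simp_all add: E_atoms)
  then obtain f where f: "f \<in> G y" "p\<^sup>\<smile> = f \<Zsemi> a y x"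
    using arrow_atom_left[OF yx atom_conv[OF p(1)]] by blast
  have "p = (f \<Zsemi> a y x)\<^sup>\<smile>" using f p(1) conv_conv[of p] by simp
  also have "\<dots> = a x y \<Zsemi> f\<^sup>\<smile>" using f by (simp add: conv_comp a_closed[OF yx] a_conv[OF yx])
  finally show ?thesis using G_conv[OF y f(1)] by blast
qed

lemma atom_comp_G:
  assumes xy: "(x, y) \<in> E" and p: "ra_atom A p" "arrow x y p" and g: "g \<in> G y"
  shows "ra_atom A (p \<Zsemi> g)"
proof -
  have y: "measurable_atom A y" using E_D[OF xy] by simp
  have "arrow y x (p\<^sup>\<smile>)" using p xy by (intro arrow_conv) (simp_all add: E_atoms)
  hence "ra_atom A (g\<^sup>\<smile> \<Zsemi> p\<^sup>\<smile>)" by (intro G_comp_atom[OF y G_conv[OF y g] atom_conv[OF p(1)]])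
  hence "ra_atom A ((g\<^sup>\<smile> \<Zsemi> p\<^sup>\<smile>)\<^sup>\<smile>)" by (rule atom_conv)
  thus ?thesis using g p by (simp add: conv_comp conv_conv)
qed

text \<open>Since measurable atoms sum to \<open>1'\<close>, two of them cut out a nonzero part
  \<open>x;b;y\<close> of \<open>b\<close>, which is an arrow and so lies above a translate of
  \<open>a x y\<close>.\<close>

lemma dense:
  assumes b: "b \<in> carrier A" "b \<noteq> \<zero>"
  shows "\<exists>x y. (x, y) \<in> E \<and> (\<exists>f\<in>G x. f \<Zsemi> a x y \<preceq> b)"
proof -
  note [simp] = b(1)
  obtain X where X: "\<And>x. x \<in> X \<Longrightarrow> measurable_atom A x" "ra_is_sum A X 1'"
    using measurable unfolding measurable_relation_algebra_def by blast
  have lub: "1' \<preceq> u" if "u \<in> carrier A" "\<And>x. x \<in> X \<Longrightarrow> x \<preceq> u" for u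
    using X(2) that by (auto simp: least_def Upper_def ra_order_def)
  \<comment> \<open>If every \<open>x\<close> in \<open>X\<close> killed \<open>c\<close>, all of
    them would avoid \<open>\<U>;c\<^sup>\<smile>\<close>; its complement would then bound
    \<open>1'\<close> as well, which forces \<open>c\<close> to be zero.\<close>
  have left: "\<exists>x\<in>X. x \<Zsemi> c \<noteq> \<zero>" if c: "c \<noteq> \<zero>" and [simp]: "c \<in> carrier A" for c
  proof (rule ccontr)
    assume *: "\<not> ?thesis"
    have "x \<preceq> \<ominus> (\<U> \<Zsemi> c\<^sup>\<smile>)" if "x \<in> X" for x
    proof -
      note [simp] = measurable_atomD(3)[OF X(1)[OF that]]
      have "(x \<Zsemi> c) \<odot> \<U> = \<zero>" using * that by (simp add: meet_unit)
      hence "(\<U> \<Zsemi> c\<^sup>\<smile>) \<odot> x = \<zero>" using cycle_right[of x c \<U>] by simp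
      thus ?thesis by (simp add: disjoint_iff_le_neg[symmetric] meet_commute)
    qed
    hence "1' \<preceq> \<ominus> (\<U> \<Zsemi> c\<^sup>\<smile>)" by (intro lub) simp_all
    hence "(\<U> \<Zsemi> c\<^sup>\<smile>) \<odot> 1' = \<zero>" by (simp add: disjoint_iff_le_neg[symmetric] meet_commute)
    hence "(1' \<Zsemi> c) \<odot> \<U> = \<zero>" using cycle_right[of "1'" c \<U>] by simp
    thus False using c by (simp add: ident_comp meet_unit)
  qed
  obtain x where x: "x \<in> X" "x \<Zsemi> b \<noteq> \<zero>" using left b by blast
  note mx = measurable_atomD[OF X(1)[OF x(1)]]
  note [simp] = mx(3)
  have "(x \<Zsemi> b)\<^sup>\<smile> \<noteq> \<zero>" using x by (simp add: conv_zero_iff)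
  then obtain y where y: "y \<in> X" "y \<Zsemi> (x \<Zsemi> b)\<^sup>\<smile> \<noteq> \<zero>"
    using left[of "(x \<Zsemi> b)\<^sup>\<smile>"] by auto
  note my = measurable_atomD[OF X(1)[OF y(1)]]
  note [simp] = my(3)
  let ?c = "x \<Zsemi> b \<Zsemi> y"
  have "?c\<^sup>\<smile> = y \<Zsemi> (x \<Zsemi> b)\<^sup>\<smile>" by (simp add: conv_comp my)
  hence c: "?c \<noteq> \<zero>" using y by auto
  have arr: "arrow x y ?c" unfolding arrow_def
    using mx(5) my(5) by (auto simp: comp_assoc) (simp add: comp_assoc[symmetric])
  have xy: "(x, y) \<in> E" using X(1) x(1) y(1) arr c by (intro E_I) auto
  obtain f where f: "f \<in> G x" "f \<Zsemi> a x y \<preceq> ?c" using below_arrow[OF xy arr c] by blast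
  have "x \<Zsemi> b \<Zsemi> y \<preceq> 1' \<Zsemi> b \<Zsemi> 1'" using mx my by (intro comp_mono) simp_all
  hence "?c \<preceq> b" by (simp add: ident_comp comp_ident)
  hence "f \<Zsemi> a x y \<preceq> b" using f(1) a_closed[OF xy] by (intro le_trans[OF f(2)]) simp_all
  thus ?thesis using xy f by blast
qed

text \<open>That is, \<open>\<phi>\<^sub>x\<^sub>y\<close> sends the coset of \<open>f\<close> to the coset of \<open>g\<close>.\<close>

definition intertwines where
  "intertwines x y f g \<longleftrightarrow> f \<in> G x \<and> g \<in> G y \<and> f \<Zsemi> a x y = a x y \<Zsemi> g"

section \<open>Intertwining as a multiplicative correspondence\<close>

lemma intertwines_ex_right:
  assumes xy: "(x, y) \<in> E" and f: "f \<in> G x"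
  shows "\<exists>g. intertwines x y f g"
proof -
  have x: "measurable_atom A x" using E_D[OF xy] by simp
  have "arrow x y (f \<Zsemi> a x y)"
    using xy f by (intro arrow_comp[of x x] G_arrow a_arrow) (simp_all add: x E_atoms)
  from arrow_atom_right[OF xy G_comp_atom[OF x f a_atom[OF xy] a_arrow[OF xy]] this]
  show ?thesis using f by (auto simp: intertwines_def)
qed

lemma intertwines_ex_left:
  assumes xy: "(x, y) \<in> E" and g: "g \<in> G y"
  shows "\<exists>f. intertwines x y f g"
proof -
  have y: "measurable_atom A y" using E_D[OF xy] by simp
  have "arrow x y (a x y \<Zsemi> g)"
    using xy g by (intro arrow_comp[of x y] G_arrow a_arrow) (simp_all add: y E_atoms)
  from arrow_atom_left[OF xy atom_comp_G[OF xy a_atom[OF xy] a_arrow[OF xy] g] this]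
  show ?thesis using g by (force simp: intertwines_def)
qed

lemma intertwines_comp:
  assumes xy: "(x, y) \<in> E" and 1: "intertwines x y f g" and 2: "intertwines x y f' g'"
  shows "intertwines x y (f \<Zsemi> f') (g \<Zsemi> g')"
proof -
  have mem: "f \<in> G x" "f' \<in> G x" "g \<in> G y" "g' \<in> G y"
    using 1 2 by (simp_all add: intertwines_def)
  note [simp] = a_closed[OF xy] mem[THEN G_closed]
  have "(f \<Zsemi> f') \<Zsemi> a x y = f \<Zsemi> (f' \<Zsemi> a x y)" by (simp add: comp_assoc)
  also have "\<dots> = (f \<Zsemi> a x y) \<Zsemi> g'" using 2 by (simp add: intertwines_def comp_assoc)
  also have "\<dots> = a x y \<Zsemi> (g \<Zsemi> g')" using 1 by (simp add: intertwines_def comp_assoc)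
  finally show ?thesis using mem E_D[OF xy] by (simp add: intertwines_def G_comp)
qed

lemma intertwines_conv:
  assumes xy: "(x, y) \<in> E" and 1: "intertwines x y f g"
  shows "intertwines x y (f\<^sup>\<smile>) (g\<^sup>\<smile>)"
proof -
  have mem: "f \<in> G x" "g \<in> G y" using 1 by (simp_all add: intertwines_def)
  note [simp] = a_closed[OF xy] mem[THEN G_closed]
  have x: "measurable_atom A x" and y: "measurable_atom A y" using E_D[OF xy] by auto
  have "f\<^sup>\<smile> \<Zsemi> a x y = f\<^sup>\<smile> \<Zsemi> (((a x y) \<Zsemi> g) \<Zsemi> g\<^sup>\<smile>)"
    by (simp add: G_right_cancel[OF y mem(2) a_arrow[OF xy]])
  also have "\<dots> = (f\<^sup>\<smile> \<Zsemi> (f \<Zsemi> a x y)) \<Zsemi> g\<^sup>\<smile>"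
    using 1 by (simp add: intertwines_def comp_assoc)
  also have "\<dots> = a x y \<Zsemi> g\<^sup>\<smile>" by (simp add: G_left_cancel[OF x mem(1) a_arrow[OF xy]])
  finally show ?thesis using mem x y by (simp add: intertwines_def G_conv)
qed

text \<open>The converse of the equation for \<open>f\<^sup>\<smile>\<close> and
  \<open>g\<^sup>\<smile>\<close> along \<open>a x y\<close> is the equation for \<open>g\<close>
  and \<open>f\<close> along \<open>a y x\<close>.\<close>

lemma intertwines_sym:
  assumes xy: "(x, y) \<in> E"
  shows "intertwines y x g f \<longleftrightarrow> intertwines x y f g"
proof -
  have *: "intertwines y x g f" if xy: "(x, y) \<in> E" and 1: "intertwines x y f g" for x y f g
  proof -
    have "intertwines x y (f\<^sup>\<smile>) (g\<^sup>\<smile>)" by (rule intertwines_conv[OF that])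
    hence "(f\<^sup>\<smile> \<Zsemi> a x y)\<^sup>\<smile> = (a x y \<Zsemi> g\<^sup>\<smile>)\<^sup>\<smile>" by (simp add: intertwines_def)
    thus ?thesis using 1 by (auto simp: intertwines_def conv_comp conv_conv a_closed[OF xy] a_conv[OF xy])
  qed
  show ?thesis using *[OF xy] *[OF E_sym[OF xy]] by blast
qed

section \<open>Stabilizers of scaffold atoms\<close>

lemma stabilizer_iff_left: "(x, y) \<in> E \<Longrightarrow> f \<in> H x y \<longleftrightarrow> intertwines x y f y"
  using E_D ident_in_G by (auto simp: stabilizer_def intertwines_def arrow_right[OF a_arrow])

lemma stabilizer_iff_right: "(x, y) \<in> E \<Longrightarrow> g \<in> H y x \<longleftrightarrow> intertwines x y x g"
  using stabilizer_iff_left[of y x g] E_sym intertwines_sym by blast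

lemma stabilizer_subset: "H x y \<subseteq> G x"
  by (auto simp: stabilizer_def)

text \<open>The stabilizer behaves like a kernel, although partners are not unique: its elements are
  those with the unit \<open>y\<close> as a partner, and if \<open>g\<close> is a partner of
  \<open>f\<close>, then \<open>f;h;f\<^sup>\<smile>\<close> has the partner
  \<open>g;y;g\<^sup>\<smile> = y\<close>.\<close>

lemma stabilizer_normal:
  assumes xy: "(x, y) \<in> E" shows "H x y \<lhd> atom_group A x"
proof -
  have x: "measurable_atom A x" and y: "measurable_atom A y" using E_D[OF xy] by auto
  interpret group "atom_group A x" by (rule group_atom_group[OF x])
  note st = stabilizer_iff_left[OF xy]
  have sub: "subgroup (H x y) (atom_group A x)"
  proof (rule subgroupI)
    have "x \<in> H x y" using ident_in_G[OF x] a_arrow[OF xy] by (simp add: stabilizer_def arrow_left)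
    thus "H x y \<noteq> {}" by blast
    show "inv\<^bsub>atom_group A x\<^esub> f \<in> H x y" if "f \<in> H x y" for f
      using that intertwines_conv[OF xy, of f y] stabilizer_subset[of x y]
      by (auto simp: st inv_atom_group[OF x] measurable_atomD[OF y])
    show "f \<otimes>\<^bsub>atom_group A x\<^esub> g \<in> H x y" if "f \<in> H x y" "g \<in> H x y" for f g
      using that intertwines_comp[OF xy, of f y g y] by (simp add: st measurable_atomD[OF y])
  qed (rule stabilizer_subset)
  show ?thesis
  proof (rule normal_invI[OF sub])
    fix f h assume f: "f \<in> G x" and h: "h \<in> H x y"
    obtain g where g: "intertwines x y f g" using intertwines_ex_right[OF xy f] by blast
    hence gy: "g \<in> G y" by (simp add: intertwines_def)
    have "intertwines x y (f \<Zsemi> h \<Zsemi> f\<^sup>\<smile>) (g \<Zsemi> y \<Zsemi> g\<^sup>\<smile>)"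
      using g h by (intro intertwines_comp intertwines_conv xy) (simp_all add: st)
    moreover have "g \<Zsemi> y \<Zsemi> g\<^sup>\<smile> = y"
      using G_arrow[OF y gy] G_comp_conv[OF y gy] by (simp add: arrow_right)
    ultimately show "f \<otimes>\<^bsub>atom_group A x\<^esub> h \<otimes>\<^bsub>atom_group A x\<^esub> inv\<^bsub>atom_group A x\<^esub> f \<in> H x y"
      using f by (simp add: st inv_atom_group[OF x])
  qed
qed

text \<open>The cycle law turns \<open>f \<preceq> a x y;a y x\<close> into
  \<open>a x y \<preceq> f;a x y\<close>, where both sides are atoms. As an inequality, membership
  can be combined with the scaffold inequality.\<close>

lemma stabilizer_iff_le:
  assumes xy: "(x, y) \<in> E" and f: "f \<in> G x"
  shows "f \<in> H x y \<longleftrightarrow> f \<preceq> a x y \<Zsemi> a y x"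
proof -
  have x: "measurable_atom A x" using E_D[OF xy] by simp
  note fa = G_comp_atom[OF x f a_atom[OF xy] a_arrow[OF xy]]
  have "f \<preceq> a x y \<Zsemi> a y x \<longleftrightarrow> a x y \<preceq> f \<Zsemi> a x y"
    using atom_le_comp_right[OF G_atom[OF x f] a_atom[OF xy] a_closed[OF E_sym[OF xy]]]
    by (simp add: a_conv[OF E_sym[OF xy]])
  also have "\<dots> \<longleftrightarrow> f \<Zsemi> a x y = a x y"
    using atom_le_eq[OF fa _ a_closed[OF xy] atom_nonzero[OF a_atom[OF xy]]] a_closed[OF xy] by auto
  finally show ?thesis using f by (simp add: stabilizer_def)
qed

text \<open>Once \<open>k1\<close> is found below \<open>c\<close> by the cycle law, the second
  factor is forced to be \<open>k1\<^sup>\<smile>;k\<close>, so \<open>k\<close> is the product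
  itself and not merely below it.\<close>

lemma G_le_comp:
  assumes x: "measurable_atom A x" and c: "arrow x x c" "arrow x x d"
    and k: "k \<in> G x" "k \<preceq> c \<Zsemi> d"
  shows "\<exists>k1\<in>G x. \<exists>k2\<in>G x. k1 \<preceq> c \<and> k2 \<preceq> d \<and> k = k1 \<Zsemi> k2"
proof -
  note [simp] = measurable_atomD[OF x] arrow_closed[OF c(1)] arrow_closed[OF c(2)] G_closed[OF k(1)]
  let ?m = "c \<odot> (k \<Zsemi> d\<^sup>\<smile>)"
  have "(c \<Zsemi> d) \<odot> k \<noteq> \<zero>" using k G_atom[OF x k(1)] by (simp add: atom_le_iff_meets meet_commute)
  hence "?m \<noteq> \<zero>" using cycle_right[of c d k] by (simp add: meet_commute)
  moreover have "arrow x x ?m" by (rule arrow_mono[of x x c]) (use c in simp_all)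
  ultimately obtain k1 where k1: "k1 \<in> G x" "k1 \<preceq> ?m" using G_below[OF x] by blast
  note [simp] = G_closed[OF k1(1)]
  have le: "k1 \<preceq> c" "k1 \<preceq> k \<Zsemi> d\<^sup>\<smile>" by (auto intro: le_trans[OF k1(2)])
  have "k \<preceq> k1 \<Zsemi> d"
    using atom_le_comp_right[OF G_atom[OF x k(1)] G_atom[OF x k1(1)], of d] le by simp
  hence "k1\<^sup>\<smile> \<Zsemi> k \<preceq> k1\<^sup>\<smile> \<Zsemi> (k1 \<Zsemi> d)" by (intro comp_mono) simp_all
  hence "k1\<^sup>\<smile> \<Zsemi> k \<preceq> d" by (simp add: G_left_cancel[OF x k1(1) c(2)])
  moreover have "k = k1 \<Zsemi> (k1\<^sup>\<smile> \<Zsemi> k)" by (simp add: G_left_cancel[OF x k1(1) G_arrow[OF x k(1)]])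
  ultimately show ?thesis using le k1 G_comp[OF x G_conv[OF x k1(1)] k(1)] by blast
qed

section \<open>Products of two stabilizers\<close>

definition N where "N x y z = H x y <#>\<^bsub>atom_group A x\<^esub> H x z"

lemma N_iff: "k \<in> N x y z \<longleftrightarrow> (\<exists>k1\<in>H x y. \<exists>k2\<in>H x z. k = k1 \<Zsemi> k2)"
  by (auto simp: N_def set_mult_def)

lemma N_subgroup:
  assumes "(x, y) \<in> E" "(x, z) \<in> E" shows "subgroup (N x y z) (atom_group A x)"
  unfolding N_def using assms E_D
  by (intro group.mult_norm_subgroup group_atom_group normal_imp_subgroup stabilizer_normal) auto

lemma N_commute:
  assumes "(x, y) \<in> E" "(x, z) \<in> E" shows "N x y z = N x z y"
  unfolding N_def using assms E_D
  by (intro group.commut_normal group_atom_group normal_imp_subgroup stabilizer_normal) auto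

text \<open>A factor from \<open>H y x\<close> is absorbed by \<open>a x y\<close> and one from
  \<open>H y z\<close> by \<open>a y z\<close>, which leaves the scaffold inequality. Conversely,
  cycling gives \<open>k;a y z \<preceq> a y x;a x z\<close>; bounding \<open>a x z\<close> by
  \<open>a x y;a y z\<close> and composing with \<open>a z y\<close> puts \<open>k\<close> below
  \<open>(a y x;a x y);(a y z;a z y)\<close>, and the group elements below these two factors are the
  two stabilizers.\<close>

lemma N_iff_le:
  assumes xy: "(x, y) \<in> E" and yz: "(y, z) \<in> E" and k: "k \<in> G y"
  shows "k \<in> N y x z \<longleftrightarrow> a x z \<preceq> a x y \<Zsemi> (k \<Zsemi> a y z)"
proof
  note xz = E_trans[OF xy yz] and yx = E_sym[OF xy] and zy = E_sym[OF yz]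
  have y: "measurable_atom A y" and z: "measurable_atom A z" using E_D[OF yz] by auto
  note [simp] = a_closed[OF xy] a_closed[OF yz] a_closed[OF xz] a_closed[OF yx] a_closed[OF zy]
    G_closed[OF k] measurable_atomD[OF y]
  {
    assume "k \<in> N y x z"
    then obtain k1 k2 where k12: "k1 \<in> H y x" "k2 \<in> H y z" "k = k1 \<Zsemi> k2" by (auto simp: N_iff)
    have [simp]: "k1 \<in> carrier A" "k2 \<in> carrier A" using k12 stabilizer_subset by (blast intro: G_closed)+
    have "a x y \<Zsemi> (k \<Zsemi> a y z) = (a x y \<Zsemi> k1) \<Zsemi> (k2 \<Zsemi> a y z)" using k12 by (simp add: comp_assoc)
    moreover have "a x y \<Zsemi> k1 = a x y"
      using k12(1) stabilizer_iff_right[OF xy] a_arrow[OF xy] by (auto simp: intertwines_def arrow_left)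
    moreover have "k2 \<Zsemi> a y z = a y z" using k12(2) by (simp add: stabilizer_def)
    ultimately show "a x z \<preceq> a x y \<Zsemi> (k \<Zsemi> a y z)" using a_le_comp[OF xy yz] by simp
  }
  assume le: "a x z \<preceq> a x y \<Zsemi> (k \<Zsemi> a y z)"
  let ?q = "k \<Zsemi> a y z"
  have "ra_atom A ?q" by (rule G_comp_atom[OF y k a_atom[OF yz] a_arrow[OF yz]])
  hence q: "?q \<preceq> a y x \<Zsemi> a x z"
    using le atom_le_comp_left[OF a_atom[OF xz], of ?q "a x y"] by (simp add: a_conv[OF xy])
  have "k \<Zsemi> y \<preceq> k \<Zsemi> (a y z \<Zsemi> a z y)" using a_comp_conv[OF yz] by (intro comp_mono) simp_all
  also have "k \<Zsemi> (a y z \<Zsemi> a z y) = ?q \<Zsemi> a z y" by (simp add: comp_assoc)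
  finally have 1: "k \<preceq> ?q \<Zsemi> a z y" using G_arrow[OF y k] by (simp add: arrow_right)
  have "a y x \<Zsemi> a x z \<preceq> a y x \<Zsemi> (a x y \<Zsemi> a y z)"
    by (rule comp_mono) (use a_le_comp[OF xy yz] in simp_all)
  with q have "?q \<preceq> a y x \<Zsemi> (a x y \<Zsemi> a y z)" by (rule le_trans) simp_all
  hence 2: "?q \<Zsemi> a z y \<preceq> (a y x \<Zsemi> (a x y \<Zsemi> a y z)) \<Zsemi> a z y" by (rule comp_mono) simp_all
  have "k \<preceq> (a y x \<Zsemi> (a x y \<Zsemi> a y z)) \<Zsemi> a z y" using 1 2 by (rule le_trans) simp_all
  also have "\<dots> = (a y x \<Zsemi> a x y) \<Zsemi> (a y z \<Zsemi> a z y)" by (simp add: comp_assoc)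
  finally have k': "k \<preceq> (a y x \<Zsemi> a x y) \<Zsemi> (a y z \<Zsemi> a z y)" .
  have "arrow y y (a y x \<Zsemi> a x y)" using xy yx by (intro arrow_comp[of y x] a_arrow) simp_all
  moreover have "arrow y y (a y z \<Zsemi> a z y)" using yz zy by (intro arrow_comp[of y z] a_arrow) simp_all
  ultimately obtain k1 k2 where "k1 \<in> G y" "k2 \<in> G y" "k1 \<preceq> a y x \<Zsemi> a x y" "k2 \<preceq> a y z \<Zsemi> a z y"
    "k = k1 \<Zsemi> k2" using G_le_comp[OF y _ _ k k'] by blast
  thus "k \<in> N y x z" using stabilizer_iff_le[OF yx] stabilizer_iff_le[OF yz] by (auto simp: N_iff)
qed

text \<open>Elementwise form of the frame condition on images of products of stabilizers. Passing
  \<open>g\<close> through \<open>a x y\<close> as \<open>f\<close>, and then moving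
  \<open>f\<close> and \<open>a x y\<close> to the other side, turns the criterion for
  \<open>g\<close> along \<open>x, y, z\<close> into the one for \<open>f\<^sup>\<smile>\<close>
  along \<open>y, x, z\<close>.\<close>

lemma N_intertwines:
  assumes xy: "(x, y) \<in> E" and yz: "(y, z) \<in> E" and fg: "intertwines x y f g"
  shows "f \<in> N x y z \<longleftrightarrow> g \<in> N y x z"
proof -
  note xz = E_trans[OF xy yz] and yx = E_sym[OF xy]
  have x: "measurable_atom A x" using E_D[OF xy] by auto
  have mem: "f \<in> G x" "g \<in> G y" using fg by (simp_all add: intertwines_def)
  note f' = G_conv[OF x mem(1)]
  note [simp] = a_closed[OF xy] a_closed[OF yz] a_closed[OF xz] a_closed[OF yx] mem[THEN G_closed]
  interpret X: group "atom_group A x" by (rule group_atom_group[OF x])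
  interpret NX: subgroup "N x y z" "atom_group A x" by (rule N_subgroup[OF xy xz])
  have cancel: "f\<^sup>\<smile> \<Zsemi> (f \<Zsemi> c) = c" "f \<Zsemi> (f\<^sup>\<smile> \<Zsemi> c) = c" if "arrow x z c" for c
    using G_left_cancel[OF x mem(1) that] by simp_all
  have az: "arrow x z (a x y \<Zsemi> a y z)"
    using xy yz by (intro arrow_comp[of x y] a_arrow) (simp_all add: E_atoms)
  have "g \<in> N y x z \<longleftrightarrow> a x z \<preceq> (a x y \<Zsemi> g) \<Zsemi> a y z"
    by (simp add: N_iff_le[OF xy yz mem(2)] comp_assoc)
  also have "\<dots> \<longleftrightarrow> a x z \<preceq> f \<Zsemi> (a x y \<Zsemi> a y z)"
    using fg by (simp add: intertwines_def comp_assoc)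
  also have "\<dots> \<longleftrightarrow> f\<^sup>\<smile> \<Zsemi> a x z \<preceq> a x y \<Zsemi> a y z"
  proof
    assume "a x z \<preceq> f \<Zsemi> (a x y \<Zsemi> a y z)"
    hence "f\<^sup>\<smile> \<Zsemi> a x z \<preceq> f\<^sup>\<smile> \<Zsemi> (f \<Zsemi> (a x y \<Zsemi> a y z))" by (intro comp_mono) simp_all
    thus "f\<^sup>\<smile> \<Zsemi> a x z \<preceq> a x y \<Zsemi> a y z" by (simp only: cancel(1)[OF az])
  next
    assume "f\<^sup>\<smile> \<Zsemi> a x z \<preceq> a x y \<Zsemi> a y z"
    hence "f \<Zsemi> (f\<^sup>\<smile> \<Zsemi> a x z) \<preceq> f \<Zsemi> (a x y \<Zsemi> a y z)" 
      by (rule comp_mono[OF le_refl[OF G_closed[OF mem(1)]]]) simp_all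
    thus "a x z \<preceq> f \<Zsemi> (a x y \<Zsemi> a y z)" by (simp only: cancel(2)[OF a_arrow[OF xz]])
  qed
  also have "\<dots> \<longleftrightarrow> a y z \<preceq> a y x \<Zsemi> (f\<^sup>\<smile> \<Zsemi> a x z)"
    using atom_le_comp_left[OF G_comp_atom[OF x f' a_atom[OF xz] a_arrow[OF xz]] a_atom[OF yz], of "a x y"]
    by (simp add: a_conv[OF xy])
  also have "\<dots> \<longleftrightarrow> f\<^sup>\<smile> \<in> N x y z" by (simp add: N_iff_le[OF yx xz f'])
  also have "\<dots> \<longleftrightarrow> f \<in> N x y z"
    using NX.m_inv_closed[of f] NX.m_inv_closed[of "f\<^sup>\<smile>"] mem f'
    by (auto simp: inv_atom_group[OF x] conv_conv)
  finally show ?thesis by blast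
qed

end

section \<open>The frame of a scaffold\<close>

text \<open>The groups consist of elements of the algebra itself. \<open>phi\<close> takes the image
  of a set under the intertwining relation, so no representative of a coset has to be
  chosen.\<close>

definition scaffold_frame :: "'a relalg \<Rightarrow> ('a \<Rightarrow> 'a \<Rightarrow> 'a) \<Rightarrow> ('a, 'a) grp_pair" where
  "scaffold_frame A a = \<lparr>idx = measurable_atoms A, eqv = scaffold_index A, grp = atom_group A,
    HH = stabilizer A a, KK = (\<lambda>x y. stabilizer A a y x),
    phi = (\<lambda>x y \<xi>. {g \<in> carrier (atom_group A y). \<exists>f\<in>\<xi>. f \<Zsemi>\<^bsub>A\<^esub> a x y = a x y \<Zsemi>\<^bsub>A\<^esub> g})\<rparr>"

context scaffolded_algebra
begin

abbreviation F where "F \<equiv> scaffold_frame A a"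

lemma frame_simps [simp]:
  "idx F = measurable_atoms A" "eqv F = E" "grp F = atom_group A" "HH F = H" "KK F x y = H y x"
  by (simp_all add: scaffold_frame_def)

lemma phi_iff: "\<xi> \<subseteq> G x \<Longrightarrow> g \<in> phi F x y \<xi> \<longleftrightarrow> (\<exists>f\<in>\<xi>. intertwines x y f g)"
  by (auto simp: scaffold_frame_def intertwines_def)

text \<open>Multiplying by the pair \<open>(f, g)\<close> or its inverse reduces this to stabilizing
  elements, which are those with partner \<open>y\<close>. A coset is thus the full set of elements
  having a given partner.\<close>

lemma stabilizer_coset_iff:
  assumes xy: "(x, y) \<in> E" and fg: "intertwines x y f g"
  shows "f' \<in> H x y #>\<^bsub>atom_group A x\<^esub> f \<longleftrightarrow> intertwines x y f' g"
proof -
  have x: "measurable_atom A x" and y: "measurable_atom A y" using E_D[OF xy] by auto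
  have f: "f \<in> G x" and g: "g \<in> G y" using fg by (simp_all add: intertwines_def)
  interpret group "atom_group A x" by (rule group_atom_group[OF x])
  interpret S: subgroup "H x y" "atom_group A x"
    by (rule normal_imp_subgroup[OF stabilizer_normal[OF xy]])
  have "f' \<in> H x y #>\<^bsub>atom_group A x\<^esub> f \<longleftrightarrow> f' \<in> G x \<and> intertwines x y (f' \<Zsemi> f\<^sup>\<smile>) y"
    using S.rcos_module[OF is_group f, of f'] S.elemrcos_carrier[OF is_group f, of f']
    by (auto simp: inv_atom_group[OF x f] stabilizer_iff_left[OF xy])
  also have "\<dots> \<longleftrightarrow> intertwines x y f' g"
  proof (intro iffI conjI)
    assume *: "f' \<in> G x \<and> intertwines x y (f' \<Zsemi> f\<^sup>\<smile>) y"
    from intertwines_comp[OF xy conjunct2[OF *] fg] show "intertwines x y f' g"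
      using * by (simp add: G_right_cancel[OF x f G_arrow[OF x]] arrow_left[OF G_arrow[OF y g]])
  next
    assume *: "intertwines x y f' g"
    thus "f' \<in> G x" by (simp add: intertwines_def)
    show "intertwines x y (f' \<Zsemi> f\<^sup>\<smile>) y"
      using intertwines_comp[OF xy * intertwines_conv[OF xy fg]] by (simp add: G_comp_conv[OF y g])
  qed
  finally show ?thesis .
qed

lemma coset_subset:
  "(x, y) \<in> E \<Longrightarrow> f \<in> G x \<Longrightarrow> H x y #>\<^bsub>atom_group A x\<^esub> f \<subseteq> G x"
  using E_D by (intro monoid.r_coset_subset_G group.is_monoid group_atom_group stabilizer_subset) auto

text \<open>Elements of one coset share their partners, so the image consists of all partners of
  \<open>f\<close>, again a coset by symmetry.\<close>

lemma phi_coset: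
  assumes xy: "(x, y) \<in> E" and fg: "intertwines x y f g"
  shows "phi F x y (H x y #>\<^bsub>atom_group A x\<^esub> f) = H y x #>\<^bsub>atom_group A y\<^esub> g"
proof (rule Set.set_eqI)
  fix g'
  have f: "f \<in> G x" using fg by (simp add: intertwines_def)
  have "g' \<in> phi F x y (H x y #>\<^bsub>atom_group A x\<^esub> f) \<longleftrightarrow>
      (\<exists>f'. intertwines x y f' g \<and> intertwines x y f' g')"
    by (simp add: phi_iff[OF coset_subset[OF xy f]] Bex_def stabilizer_coset_iff[OF xy fg])
  also have "\<dots> \<longleftrightarrow> intertwines x y f g'"
    using fg by (auto simp: intertwines_def)
  also have "\<dots> \<longleftrightarrow> g' \<in> H y x #>\<^bsub>atom_group A y\<^esub> g"
    using stabilizer_coset_iff[OF E_sym[OF xy], of g f g'] fg by (simp add: intertwines_sym[OF xy])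
  finally show "g' \<in> phi F x y (H x y #>\<^bsub>atom_group A x\<^esub> f) \<longleftrightarrow> g' \<in> H y x #>\<^bsub>atom_group A y\<^esub> g" .
qed

lemma quotient_cases:
  assumes "(x, y) \<in> E" "\<xi> \<in> carrier (atom_group A x Mod H x y)"
  obtains f g where "intertwines x y f g" "\<xi> = H x y #>\<^bsub>atom_group A x\<^esub> f"
  using assms intertwines_ex_right[OF assms(1)] unfolding carrier_FactGroup by blast

lemma coset_in_quotient:
  "intertwines x y f g \<Longrightarrow> H x y #>\<^bsub>atom_group A x\<^esub> f \<in> carrier (atom_group A x Mod H x y)"
  by (auto simp: carrier_FactGroup intertwines_def)

lemma phi_inverse:
  assumes xy: "(x, y) \<in> E" and \<xi>: "\<xi> \<in> carrier (atom_group A x Mod H x y)"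
  shows "phi F x y \<xi> \<in> carrier (atom_group A y Mod H y x)" "phi F y x (phi F x y \<xi>) = \<xi>"
proof -
  obtain f g where fg: "intertwines x y f g" and \<xi>: "\<xi> = H x y #>\<^bsub>atom_group A x\<^esub> f"
    using quotient_cases[OF xy \<xi>] .
  have gf: "intertwines y x g f" using fg by (simp add: intertwines_sym[OF xy])
  show "phi F x y \<xi> \<in> carrier (atom_group A y Mod H y x)"
    using coset_in_quotient[OF gf] by (simp add: \<xi> phi_coset[OF xy fg])
  show "phi F y x (phi F x y \<xi>) = \<xi>"
    by (simp add: \<xi> phi_coset[OF xy fg] phi_coset[OF E_sym[OF xy] gf])
qed

lemma phi_iso:
  assumes xy: "(x, y) \<in> E"
  shows "phi F x y \<in> iso (atom_group A x Mod H x y) (atom_group A y Mod H y x)"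
proof (rule isoI)
  show "phi F x y \<in> hom (atom_group A x Mod H x y) (atom_group A y Mod H y x)"
  proof (rule homI)
    fix \<xi> \<xi>' assume \<xi>: "\<xi> \<in> carrier (atom_group A x Mod H x y)"
      and \<xi>': "\<xi>' \<in> carrier (atom_group A x Mod H x y)"
    obtain f g where fg: "intertwines x y f g" and \<xi>: "\<xi> = H x y #>\<^bsub>atom_group A x\<^esub> f"
      using quotient_cases[OF xy \<xi>] .
    obtain f' g' where fg': "intertwines x y f' g'" and \<xi>': "\<xi>' = H x y #>\<^bsub>atom_group A x\<^esub> f'"
      using quotient_cases[OF xy \<xi>'] .
    have mem: "f \<in> G x" "f' \<in> G x" "g \<in> G y" "g' \<in> G y"
      using fg fg' by (simp_all add: intertwines_def)
    show "phi F x y (\<xi> \<otimes>\<^bsub>atom_group A x Mod H x y\<^esub> \<xi>') =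
        phi F x y \<xi> \<otimes>\<^bsub>atom_group A y Mod H y x\<^esub> phi F x y \<xi>'"
      using normal.rcos_sum[OF stabilizer_normal[OF xy] mem(1,2)]
        normal.rcos_sum[OF stabilizer_normal[OF E_sym[OF xy]] mem(3,4)]
        phi_coset[OF xy intertwines_comp[OF xy fg fg']]
      by (simp add: \<xi> \<xi>' phi_coset[OF xy fg] phi_coset[OF xy fg'])
  qed (rule phi_inverse(1)[OF xy])
  show "bij_betw (phi F x y) (carrier (atom_group A x Mod H x y)) (carrier (atom_group A y Mod H y x))"
    by (rule bij_betw_byWitness[where f' = "phi F y x"])
      (use phi_inverse[OF xy] phi_inverse[OF E_sym[OF xy]] in auto)
qed

lemma group_pair_scaffold_frame: "group_pair F"
  unfolding group_pair_def
proof (intro conjI ballI)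
  show "equiv (idx F) (eqv F)" using equiv_E by simp
  show "group (grp F x)" if "x \<in> idx F" for x
    using that by (simp add: measurable_atoms_def group_atom_group)
  show "disjoint_family_on (\<lambda>x. carrier (grp F x)) (idx F)"
    using G_disjoint by (auto simp: disjoint_family_on_def measurable_atoms_def)
  fix p assume "p \<in> eqv F"
  then obtain x y where p: "p = (x, y)" "(x, y) \<in> E" by (cases p) auto
  show "case p of (x, y) \<Rightarrow> HH F x y \<lhd> grp F x \<and> KK F x y \<lhd> grp F y \<and>
      phi F x y \<in> iso (grp F x Mod HH F x y) (grp F y Mod KK F x y)"
    using p stabilizer_normal E_sym phi_iso by simp
qed

text \<open>The closure assumption makes \<open>M\<close> a union of cosets of \<open>H x y\<close>,
  so each element of \<open>M\<close> brings its whole coset along. Frame conditions about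
  \<open>phi_image\<close> thereby become statements about intertwining elements.\<close>

lemma phi_image_iff:
  assumes xy: "(x, y) \<in> E" and M: "M \<subseteq> G x" "\<And>f h. f \<in> M \<Longrightarrow> h \<in> H x y \<Longrightarrow> h \<Zsemi> f \<in> M"
  shows "g \<in> phi_image F x y M \<longleftrightarrow> (\<exists>f\<in>M. intertwines x y f g)"
proof
  have x: "measurable_atom A x" using E_D[OF xy] by simp
  {
    assume "g \<in> phi_image F x y M"
    then obtain \<xi> where "\<xi> \<subseteq> M" "g \<in> phi F x y \<xi>" by (auto simp: phi_image_def)
    thus "\<exists>f\<in>M. intertwines x y f g" using M(1) phi_iff[of \<xi> x g y] by blast
  }
  assume "\<exists>f\<in>M. intertwines x y f g"
  then obtain f where f: "f \<in> M" "intertwines x y f g" by blast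
  hence fx: "f \<in> G x" by (simp add: intertwines_def)
  let ?\<xi> = "H x y #>\<^bsub>atom_group A x\<^esub> f"
  have "?\<xi> \<subseteq> M" using M(2)[OF f(1)] by (auto simp: r_coset_def)
  moreover have "?\<xi> \<in> rcosets\<^bsub>atom_group A x\<^esub> H x y" using fx by (auto simp: RCOSETS_def)
  moreover have "g \<in> phi F x y ?\<xi>"
    using f(2) stabilizer_coset_iff[OF xy f(2), of f] by (auto simp: phi_iff[OF coset_subset[OF xy fx]])
  ultimately show "g \<in> phi_image F x y M" by (auto simp: phi_image_def)
qed

lemma stabilizer_subset_N:
  assumes "(x, y) \<in> E" "(x, z) \<in> E"
  shows "H x y \<subseteq> N x y z" "H x z \<subseteq> N x y z"
proof -
  have *: "H x y \<subseteq> N x y z" if "(x, y) \<in> E" "(x, z) \<in> E" for y z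
  proof
    fix h assume h: "h \<in> H x y"
    have x: "measurable_atom A x" using E_D[OF that(1)] by simp
    have "x \<in> H x z"
      using ident_in_G[OF x] a_arrow[OF that(2)] by (simp add: stabilizer_def arrow_left)
    moreover have "h = h \<Zsemi> x" using h stabilizer_subset G_arrow[OF x] by (blast intro: arrow_right[symmetric])
    ultimately show "h \<in> N x y z" using h by (auto simp: N_iff)
  qed
  show "H x y \<subseteq> N x y z" "H x z \<subseteq> N x y z"
    using *[OF assms] *[OF assms(2,1)] N_commute[OF assms] by auto
qed

lemma phi_image_N:
  assumes xy: "(x, y) \<in> E" and yz: "(y, z) \<in> E"
  shows "phi_image F x y (N x y z) = N y x z"
proof (rule Set.set_eqI)
  fix g
  note xz = E_trans[OF xy yz]
  interpret NX: subgroup "N x y z" "atom_group A x" by (rule N_subgroup[OF xy xz])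
  interpret NY: subgroup "N y x z" "atom_group A y" by (rule N_subgroup[OF E_sym[OF xy] yz])
  have closed: "h \<Zsemi> f \<in> N x y z" if "f \<in> N x y z" "h \<in> H x y" for f h
    using NX.m_closed[of h f] that stabilizer_subset_N[OF xy xz] by auto
  have "g \<in> phi_image F x y (N x y z) \<longleftrightarrow> (\<exists>f\<in>N x y z. intertwines x y f g)"
    using NX.subset closed by (intro phi_image_iff[OF xy])
  also have "\<dots> \<longleftrightarrow> g \<in> N y x z"
    using N_intertwines[OF xy yz] intertwines_ex_left[OF xy] NY.subset by blast
  finally show "g \<in> phi_image F x y (N x y z) \<longleftrightarrow> g \<in> N y x z" .
qed

text \<open>Transporting along \<open>y\<close> and transporting directly agree up to \<open>N z x y\<close>.\<close>

lemma intertwines_path: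
  assumes xy: "(x, y) \<in> E" and yz: "(y, z) \<in> E"
    and fg: "intertwines x y f g" and gk: "intertwines y z g k" and fk': "intertwines x z f k'"
  shows "k' \<Zsemi> k\<^sup>\<smile> \<in> N z x y"
proof -
  note xz = E_trans[OF xy yz] and zy = E_sym[OF yz]
  have x: "measurable_atom A x" and y: "measurable_atom A y" and z: "measurable_atom A z"
    using E_D[OF xy] E_D[OF yz] by auto
  have mem: "f \<in> G x" "g \<in> G y" "k \<in> G z" "k' \<in> G z"
    using fg gk fk' by (simp_all add: intertwines_def)
  note [simp] = a_closed[OF xy] a_closed[OF yz] a_closed[OF xz] a_closed[OF zy] mem[THEN G_closed]
  have 1: "f \<Zsemi> a x z = a x z \<Zsemi> k'" and 2: "f \<Zsemi> a x y = a x y \<Zsemi> g"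
    using fg fk' by (simp_all add: intertwines_def)
  have "intertwines z y (k\<^sup>\<smile>) (g\<^sup>\<smile>)"
    using intertwines_conv[OF yz gk] by (simp add: intertwines_sym[OF yz])
  hence 3: "k\<^sup>\<smile> \<Zsemi> a z y = a z y \<Zsemi> g\<^sup>\<smile>" by (simp add: intertwines_def)
  \<comment> \<open>Composing with \<open>g\<^sup>\<smile>\<close> on the right restores
    \<open>a x y\<close> on the smaller side; on the larger side \<open>f\<close> passes through
    \<open>a x z\<close> as \<open>k'\<close> and \<open>g\<^sup>\<smile>\<close> through
    \<open>a z y\<close> as \<open>k\<^sup>\<smile>\<close>, so that
    \<open>k';k\<^sup>\<smile>\<close> appears in the middle.\<close>
  have "f \<Zsemi> a x y \<preceq> f \<Zsemi> (a x z \<Zsemi> a z y)"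
    using a_le_comp[OF xz zy] by (intro comp_mono le_refl) simp_all
  hence "(f \<Zsemi> a x y) \<Zsemi> g\<^sup>\<smile> \<preceq> (f \<Zsemi> (a x z \<Zsemi> a z y)) \<Zsemi> g\<^sup>\<smile>"
    by (rule comp_mono) simp_all
  moreover have "(f \<Zsemi> a x y) \<Zsemi> g\<^sup>\<smile> = a x y"
    unfolding 2 by (rule G_right_cancel[OF y mem(2) a_arrow[OF xy]])
  moreover have "(f \<Zsemi> (a x z \<Zsemi> a z y)) \<Zsemi> g\<^sup>\<smile> = (f \<Zsemi> a x z) \<Zsemi> (a z y \<Zsemi> g\<^sup>\<smile>)"
    by (simp add: comp_assoc)
  moreover have "\<dots> = a x z \<Zsemi> ((k' \<Zsemi> k\<^sup>\<smile>) \<Zsemi> a z y)"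
    unfolding 1 3[symmetric] by (simp add: comp_assoc)
  ultimately have "a x y \<preceq> a x z \<Zsemi> ((k' \<Zsemi> k\<^sup>\<smile>) \<Zsemi> a z y)" by simp
  thus ?thesis using N_iff_le[OF xz zy G_comp[OF z mem(4) G_conv[OF z mem(3)]]] by simp
qed

text \<open>The two routes from \<open>f\<close> to \<open>G z\<close> end in elements that differ
  by a member of \<open>N z x y\<close>. This discrepancy pulls back to some \<open>u\<close> in
  \<open>N x y z\<close>; since \<open>M\<close> is a coset of that group, \<open>u;f\<close> is
  still in \<open>M\<close>, and starting from it corrects the endpoint.\<close>

lemma phi_image_comp:
  assumes xy: "(x, y) \<in> E" and yz: "(y, z) \<in> E"
    and M: "M \<in> carrier (atom_group A x Mod N x y z)"
  shows "phi_image F y z (phi_image F x y M) = phi_image F x z M"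
proof -
  note xz = E_trans[OF xy yz] and zy = E_sym[OF yz]
  have x: "measurable_atom A x" and y: "measurable_atom A y" and z: "measurable_atom A z"
    using E_D[OF xy] E_D[OF yz] by auto
  interpret group "atom_group A x" by (rule group_atom_group[OF x])
  interpret NX: subgroup "N x y z" "atom_group A x" by (rule N_subgroup[OF xy xz])
  interpret NZ: subgroup "N z x y" "atom_group A z" by (rule N_subgroup[OF E_sym[OF xz] zy])
  obtain f0 where f0: "f0 \<in> G x" and M: "M = N x y z #>\<^bsub>atom_group A x\<^esub> f0"
    using M by (auto simp: carrier_FactGroup)
  have Msub: "M \<subseteq> G x" unfolding M using f0 by (intro r_coset_subset_G NX.subset)
  have Mcl: "u \<Zsemi> f \<in> M" if u: "u \<in> N x y z" and f: "f \<in> M" for u f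
  proof -
    obtain n where n: "n \<in> N x y z" "f = n \<Zsemi> f0" using f by (auto simp: M r_coset_def)
    have "u \<Zsemi> f = (u \<Zsemi> n) \<Zsemi> f0"
      using n(1) u f0 NX.mem_carrier by (simp add: n(2) comp_assoc[of u n f0] G_closed[of _ x])
    moreover have "u \<Zsemi> n \<in> N x y z" using NX.m_closed[OF u n(1)] by simp
    ultimately show ?thesis by (auto simp: M r_coset_def)
  qed
  let ?M' = "phi_image F x y M"
  have M': "g \<in> ?M' \<longleftrightarrow> (\<exists>f\<in>M. intertwines x y f g)" for g
    using Msub Mcl stabilizer_subset_N[OF xy xz] by (intro phi_image_iff[OF xy]) auto
  have M'sub: "?M' \<subseteq> G y" by (auto simp: M' intertwines_def)
  have M'cl: "h \<Zsemi> g \<in> ?M'" if g: "g \<in> ?M'" and h: "h \<in> H y z" for g h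
  proof -
    obtain f where f: "f \<in> M" "intertwines x y f g" using g M' by blast
    have hN: "h \<in> N y x z" using h stabilizer_subset_N[OF E_sym[OF xy] yz] by blast
    have "h \<in> G y" using h stabilizer_subset by blast
    then obtain u where u: "intertwines x y u h" using intertwines_ex_left[OF xy] by blast
    hence "u \<in> N x y z" using N_intertwines[OF xy yz u] hN by simp
    thus ?thesis using Mcl[OF _ f(1)] intertwines_comp[OF xy u f(2)] M' by blast
  qed
  have L: "k \<in> phi_image F y z ?M' \<longleftrightarrow> (\<exists>f\<in>M. \<exists>g. intertwines x y f g \<and> intertwines y z g k)" for k
    using phi_image_iff[OF yz M'sub M'cl, of k] M' by blast
  have R: "k \<in> phi_image F x z M \<longleftrightarrow> (\<exists>f\<in>M. intertwines x z f k)" for k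
    using Msub Mcl stabilizer_subset_N[OF xy xz] by (intro phi_image_iff[OF xz]) auto
  show ?thesis
  proof (intro Set.set_eqI iffI)
    fix k assume "k \<in> phi_image F y z ?M'"
    then obtain f g where f: "f \<in> M" and fg: "intertwines x y f g" and gk: "intertwines y z g k"
      using L by blast
    obtain k' where fk': "intertwines x z f k'" using intertwines_ex_right[OF xz] f Msub by blast
    have mem: "k \<in> G z" "k' \<in> G z" using gk fk' by (simp_all add: intertwines_def)
    let ?k2 = "k' \<Zsemi> k\<^sup>\<smile>"
    have k2: "?k2 \<in> N z x y" by (rule intertwines_path[OF xy yz fg gk fk'])
    have k2': "?k2\<^sup>\<smile> \<in> N z x y"
      using NZ.m_inv_closed[OF k2] k2 NZ.subset by (auto simp: inv_atom_group[OF z])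
    then obtain u where u: "intertwines x z u (?k2\<^sup>\<smile>)"
      using intertwines_ex_left[OF xz] NZ.subset by blast
    have "u \<in> N x y z"
      using N_intertwines[OF xz zy u] k2' N_commute[OF xy xz] by simp
    moreover have "?k2\<^sup>\<smile> \<Zsemi> k' = k"
    proof -
      have "?k2\<^sup>\<smile> \<Zsemi> k' = k \<Zsemi> (k'\<^sup>\<smile> \<Zsemi> k')" using mem by (simp add: conv_comp conv_conv comp_assoc)
      thus ?thesis using G_conv_comp[OF z mem(2)] G_arrow[OF z mem(1)] by (simp add: arrow_right)
    qed
    ultimately show "k \<in> phi_image F x z M"
      using R Mcl[OF _ f] intertwines_comp[OF xz u fk'] by fastforce
  next
    fix k' assume "k' \<in> phi_image F x z M"
    then obtain f where f: "f \<in> M" and fk': "intertwines x z f k'" using R by blast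
    obtain g where fg: "intertwines x y f g" using intertwines_ex_right[OF xy] f Msub by blast
    then obtain k where gk: "intertwines y z g k"
      using intertwines_ex_right[OF yz] by (auto simp: intertwines_def)
    have mem: "k \<in> G z" "k' \<in> G z" using gk fk' by (simp_all add: intertwines_def)
    let ?k2 = "k' \<Zsemi> k\<^sup>\<smile>"
    have k2: "?k2 \<in> N z x y" by (rule intertwines_path[OF xy yz fg gk fk'])
    \<comment> \<open>To correct the route through \<open>y\<close>, the discrepancy is pulled back
      in two stages, to \<open>w\<close> in \<open>G y\<close> and then to \<open>u\<close> in
      \<open>G x\<close>.\<close>
    then obtain w where w: "intertwines y z w ?k2"
      using intertwines_ex_left[OF yz] NZ.subset by blast
    then obtain u where u: "intertwines x y u w"
      using intertwines_ex_left[OF xy] by (auto simp: intertwines_def)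
    have "w \<in> N y z x"
      using N_intertwines[OF zy E_sym[OF xy], of ?k2 w] w k2 N_commute[OF E_sym[OF xz] zy]
      by (simp add: intertwines_sym[OF yz])
    hence "u \<in> N x y z" using N_intertwines[OF xy yz u] N_commute[OF E_sym[OF xy] yz] by simp
    hence uf: "u \<Zsemi> f \<in> M" by (rule Mcl[OF _ f])
    have "?k2 \<Zsemi> k = k'" by (rule G_right_cancel(2)[OF z mem(1) G_arrow[OF z mem(2)]])
    hence "intertwines y z (w \<Zsemi> g) k'" using intertwines_comp[OF yz w gk] by simp
    thus "k' \<in> phi_image F y z ?M'" using L uf intertwines_comp[OF xy u fg] by blast
  qed
qed

lemma stabilizer_ident: assumes x: "measurable_atom A x" shows "H x x = {x}"
  using x ident_in_G[OF x]
  by (auto simp: stabilizer_def a_ident measurable_atomD dest: arrow_right[OF G_arrow[OF x]])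

lemma frame_scaffold_frame: "frame F"
  unfolding frame_def
proof (intro conjI allI impI)
  show "group_pair F" by (rule group_pair_scaffold_frame)
  show "\<forall>x\<in>idx F. HH F x x = {\<one>\<^bsub>grp F x\<^esub>} \<and> KK F x x = {\<one>\<^bsub>grp F x\<^esub>} \<and>
      (\<forall>\<xi>\<in>carrier (grp F x Mod {\<one>\<^bsub>grp F x\<^esub>}). phi F x x \<xi> = \<xi>)"
  proof (intro ballI conjI)
    fix x assume "x \<in> idx F"
    hence x: "measurable_atom A x" by (simp add: measurable_atoms_def)
    show "HH F x x = {\<one>\<^bsub>grp F x\<^esub>}" "KK F x x = {\<one>\<^bsub>grp F x\<^esub>}" by (simp_all add: stabilizer_ident[OF x])
    fix \<xi> assume "\<xi> \<in> carrier (grp F x Mod {\<one>\<^bsub>grp F x\<^esub>})"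
    then obtain f where f: "f \<in> G x" "\<xi> = H x x #>\<^bsub>atom_group A x\<^esub> f"
      by (auto simp: carrier_FactGroup stabilizer_ident[OF x])
    have "intertwines x x f f"
      using f G_arrow[OF x f(1)] by (simp add: intertwines_def a_ident[OF x] arrow_left arrow_right)
    thus "phi F x x \<xi> = \<xi>" using phi_coset[OF E_refl[OF x]] f by simp
  qed
  show "\<forall>(x, y)\<in>eqv F. HH F y x = KK F x y \<and> KK F y x = HH F x y \<and>
      (\<forall>\<xi>\<in>carrier (grp F x Mod HH F x y). phi F y x (phi F x y \<xi>) = \<xi>) \<and>
      (\<forall>\<eta>\<in>carrier (grp F y Mod KK F x y). phi F x y (phi F y x \<eta>) = \<eta>)"
    using phi_inverse(2) E_sym by auto
  fix x y z assume "(x, y) \<in> eqv F \<and> (y, z) \<in> eqv F"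
  hence xy: "(x, y) \<in> E" and yz: "(y, z) \<in> E" by simp_all
  show "phi_image F x y (HH F x y <#>\<^bsub>grp F x\<^esub> HH F x z) = KK F x y <#>\<^bsub>grp F y\<^esub> HH F y z"
    using phi_image_N[OF xy yz] by (simp add: N_def)
  show "\<forall>M\<in>carrier (grp F x Mod (HH F x y <#>\<^bsub>grp F x\<^esub> HH F x z)).
      phi_image F y z (phi_image F x y M) = phi_image F x z M"
    using phi_image_comp[OF xy yz] by (simp add: N_def)
qed

section \<open>Cells\<close>

text \<open>The converse on \<open>f\<close> makes \<open>cell x y f g = f0;a x y\<close> equivalent
  to \<open>(f;f0);a x y = a x y;g\<close>, that is, to \<open>g\<close> being a partner of
  \<open>f;f0\<close>.\<close>

definition cell where "cell x y f g = f\<^sup>\<smile> \<Zsemi> (a x y \<Zsemi> g)"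

lemma cell_atom:
  assumes xy: "(x, y) \<in> E" and f: "f \<in> G x" and g: "g \<in> G y"
  shows "ra_atom A (cell x y f g)" "arrow x y (cell x y f g)"
proof -
  have x: "measurable_atom A x" and y: "measurable_atom A y" using E_D[OF xy] by auto
  have ag: "ra_atom A (a x y \<Zsemi> g)" "arrow x y (a x y \<Zsemi> g)"
    using arrow_comp[OF a_arrow[OF xy] G_arrow[OF y g]] atom_comp_G[OF xy a_atom[OF xy] a_arrow[OF xy] g]
      E_atoms[OF xy] by auto
  show "ra_atom A (cell x y f g)"
    unfolding cell_def by (rule G_comp_atom[OF x G_conv[OF x f] ag])
  show "arrow x y (cell x y f g)"
    unfolding cell_def by (rule arrow_comp[OF G_arrow[OF x G_conv[OF x f]] ag(2)]) (simp_all add: E_atoms[OF xy])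
qed

lemma cell_closed: "(x, y) \<in> E \<Longrightarrow> f \<in> G x \<Longrightarrow> g \<in> G y \<Longrightarrow> cell x y f g \<in> carrier A"
  using cell_atom by auto

text \<open>Translating \<open>p\<close> by the given point, or by its inverse, yields an atom,
  which in turn is a translate of \<open>a x y\<close>; the translating element gives the point
  sought.\<close>

lemma cell_surj:
  assumes xy: "(x, y) \<in> E" and p: "ra_atom A p" "arrow x y p"
  shows "f \<in> G x \<Longrightarrow> \<exists>g\<in>G y. cell x y f g = p" "g \<in> G y \<Longrightarrow> \<exists>f\<in>G x. cell x y f g = p"
proof -
  have x: "measurable_atom A x" and y: "measurable_atom A y" using E_D[OF xy] by auto
  note [simp] = a_closed[OF xy] atom_closed[OF p(1)]
  {
    assume f: "f \<in> G x"
    note fp = arrow_comp[OF G_arrow[OF x f] p(2) E_atoms(5,6)[OF xy]]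
    obtain g where g: "g \<in> G y" "f \<Zsemi> p = a x y \<Zsemi> g"
      using arrow_atom_right[OF xy G_comp_atom[OF x f p] fp] by blast
    have "cell x y f g = f\<^sup>\<smile> \<Zsemi> (f \<Zsemi> p)" by (simp add: cell_def g)
    thus "\<exists>g\<in>G y. cell x y f g = p" using g G_left_cancel(1)[OF x f p(2)] by auto
  next
    assume g: "g \<in> G y"
    have pg: "arrow x y (p \<Zsemi> g\<^sup>\<smile>)"
      by (rule arrow_comp[OF p(2) G_arrow[OF y G_conv[OF y g]] E_atoms(5,6)[OF xy]])
    obtain f where f: "f \<in> G x" "p \<Zsemi> g\<^sup>\<smile> = f \<Zsemi> a x y"
      using arrow_atom_left[OF xy atom_comp_G[OF xy p G_conv[OF y g]] pg] by blast
    have "cell x y (f\<^sup>\<smile>) g = (f \<Zsemi> a x y) \<Zsemi> g" using f g by (simp add: cell_def conv_conv comp_assoc)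
    also have "\<dots> = p" unfolding f(2)[symmetric] by (rule G_right_cancel(2)[OF y g p(2)])
    finally show "\<exists>f\<in>G x. cell x y f g = p" using G_conv[OF x f(1)] by blast
  }
qed

lemma cell_conv:
  assumes xy: "(x, y) \<in> E" and f: "f \<in> G x" and g: "g \<in> G y"
  shows "(cell x y f g)\<^sup>\<smile> = cell y x g f"
  using f g a_closed[OF xy] a_closed[OF E_sym[OF xy]]
  by (simp add: cell_def conv_comp conv_conv a_conv[OF xy] comp_assoc)

text \<open>In the scaffold inequality translated by \<open>f\<close> and \<open>g\<close>, the unit
  of \<open>G y\<close> can be inserted as \<open>h;h\<^sup>\<smile>\<close> for any
  \<open>h\<close>; the right side then falls apart into two cells.\<close>

lemma cell_comp_le:
  assumes xy: "(x, y) \<in> E" and yz: "(y, z) \<in> E" and f: "f \<in> G x" and h: "h \<in> G y" and g: "g \<in> G z"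
  shows "cell x z f g \<preceq> cell x y f h \<Zsemi> cell y z h g"
proof -
  note xz = E_trans[OF xy yz]
  have y: "measurable_atom A y" using E_D[OF xy] by auto
  note [simp] = a_closed[OF xy] a_closed[OF yz] a_closed[OF xz] f[THEN G_closed] h[THEN G_closed]
    g[THEN G_closed]
  have "a x z \<Zsemi> g \<preceq> (a x y \<Zsemi> a y z) \<Zsemi> g"
    by (rule comp_mono[OF a_le_comp[OF xy yz]]) simp_all
  hence "cell x z f g \<preceq> f\<^sup>\<smile> \<Zsemi> ((a x y \<Zsemi> a y z) \<Zsemi> g)"
    unfolding cell_def by (rule comp_mono_right) simp_all
  moreover have "f\<^sup>\<smile> \<Zsemi> ((a x y \<Zsemi> a y z) \<Zsemi> g) = f\<^sup>\<smile> \<Zsemi> ((a x y \<Zsemi> (h \<Zsemi> (h\<^sup>\<smile> \<Zsemi> a y z))) \<Zsemi> g)"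
    by (simp only: G_left_cancel(2)[OF y h a_arrow[OF yz]])
  moreover have "\<dots> = cell x y f h \<Zsemi> cell y z h g" by (simp add: cell_def comp_assoc)
  ultimately show ?thesis by simp
qed

text \<open>A factorization through \<open>y\<close> gives \<open>a x z \<preceq> a x y \<Zsemi> k \<Zsemi> a y z\<close>; writing \<open>k\<close> as a product
  of stabilizing factors shifts both factors to a common middle point \<open>h\<close>.\<close>

lemma cell_split:
  assumes xy: "(x, y) \<in> E" and yz: "(y, z) \<in> E" and f: "f \<in> G x" and g: "g \<in> G z"
    and p: "ra_atom A p" "arrow x y p" and q: "ra_atom A q" "arrow y z q"
    and le: "cell x z f g \<preceq> p \<Zsemi> q"
  shows "\<exists>h\<in>G y. cell x y f h = p \<and> cell y z h g = q"
proof -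
  note xz = E_trans[OF xy yz]
  have x: "measurable_atom A x" and y: "measurable_atom A y" and z: "measurable_atom A z"
    using E_D[OF xy] E_D[OF yz] by auto
  obtain h1 where h1: "h1 \<in> G y" "cell x y f h1 = p" using cell_surj(1)[OF xy p f] by blast
  obtain h2 where h2: "h2 \<in> G y" "cell y z h2 g = q" using cell_surj(2)[OF yz q g] by blast
  note [simp] = a_closed[OF xy] a_closed[OF yz] a_closed[OF xz] f[THEN G_closed] g[THEN G_closed]
    h1(1)[THEN G_closed] h2(1)[THEN G_closed]
  let ?k = "h1 \<Zsemi> h2\<^sup>\<smile>"
  note k = G_comp[OF y h1(1) G_conv[OF y h2(1)]]
  let ?r = "a x y \<Zsemi> (?k \<Zsemi> a y z)"
  have r: "arrow x z ?r"
    by (intro arrow_comp[of _ y] a_arrow xy yz G_arrow y k) (simp_all add: E_atoms[OF xy] E_atoms[OF yz])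
  have "p \<Zsemi> q = f\<^sup>\<smile> \<Zsemi> (?r \<Zsemi> g)" by (simp add: h1(2)[symmetric] h2(2)[symmetric] cell_def comp_assoc)
  with le have "f\<^sup>\<smile> \<Zsemi> (a x z \<Zsemi> g) \<preceq> f\<^sup>\<smile> \<Zsemi> (?r \<Zsemi> g)" by (simp add: cell_def)
  hence "f \<Zsemi> (f\<^sup>\<smile> \<Zsemi> (a x z \<Zsemi> g)) \<preceq> f \<Zsemi> (f\<^sup>\<smile> \<Zsemi> (?r \<Zsemi> g))"
    by (rule comp_mono_right) simp_all
  hence "a x z \<Zsemi> g \<preceq> ?r \<Zsemi> g"
    by (simp only: G_left_cancel(2)[OF x f arrow_comp[OF a_arrow[OF xz] G_arrow[OF z g] E_atoms(5,6)[OF xz]]]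
        G_left_cancel(2)[OF x f arrow_comp[OF r G_arrow[OF z g] E_atoms(5,6)[OF xz]]])
  hence "(a x z \<Zsemi> g) \<Zsemi> g\<^sup>\<smile> \<preceq> (?r \<Zsemi> g) \<Zsemi> g\<^sup>\<smile>" by (rule comp_mono) simp_all
  hence "a x z \<preceq> ?r" by (simp only: G_right_cancel(1)[OF z g a_arrow[OF xz]] G_right_cancel(1)[OF z g r])
  hence "?k \<in> N y x z" by (simp add: N_iff_le[OF xy yz k])
  then obtain k1 k2 where k1: "k1 \<in> H y x" and k2: "k2 \<in> H y z" and kk: "?k = k1 \<Zsemi> k2"
    by (auto simp: N_iff)
  have mem: "k1 \<in> G y" "k2 \<in> G y" using k1 k2 stabilizer_subset by auto
  note [simp] = mem[THEN G_closed]
  let ?h = "k1\<^sup>\<smile> \<Zsemi> h1"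
  have h: "?h \<in> G y" by (rule G_comp[OF y G_conv[OF y mem(1)] h1(1)])
  have "intertwines x y x (k1\<^sup>\<smile>)"
    using intertwines_conv[OF xy, of x k1] k1 measurable_atomD[OF x] by (simp add: stabilizer_iff_right[OF xy])
  hence "a x y \<Zsemi> k1\<^sup>\<smile> = a x y" using a_arrow[OF xy] by (simp add: intertwines_def arrow_left)
  hence "a x y \<Zsemi> ?h = a x y \<Zsemi> h1" by (simp add: comp_assoc)
  hence 1: "cell x y f ?h = p" using h1 by (simp add: cell_def)
  have "h2\<^sup>\<smile> = h1\<^sup>\<smile> \<Zsemi> (h1 \<Zsemi> h2\<^sup>\<smile>)"
    using G_left_cancel(1)[OF y h1(1) G_arrow[OF y G_conv[OF y h2(1)]]] by simp
  also have "\<dots> = ?h\<^sup>\<smile> \<Zsemi> k2" by (simp add: kk conv_comp conv_conv comp_assoc)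
  finally have "h2\<^sup>\<smile> \<Zsemi> a y z = ?h\<^sup>\<smile> \<Zsemi> (k2 \<Zsemi> a y z)" by (simp add: comp_assoc)
  hence "h2\<^sup>\<smile> \<Zsemi> a y z = ?h\<^sup>\<smile> \<Zsemi> a y z" using k2 by (simp add: stabilizer_def)
  hence "cell y z ?h g = cell y z h2 g" by (simp add: cell_def comp_assoc)
  thus ?thesis using 1 h h2 by auto
qed

lemma subid_atoms_eq:
  assumes x: "ra_atom A x" "x \<preceq> 1'" and y: "ra_atom A y" "y \<preceq> 1'" and xy: "x \<Zsemi> y \<noteq> \<zero>"
  shows "x = y"
proof -
  note [simp] = atom_closed[OF x(1)] atom_closed[OF y(1)]
  have "x \<odot> y \<noteq> \<zero>" using subid_comp_disjoint[OF x(2) y(2)] xy by auto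
  hence "x \<preceq> y" using x by (simp add: atom_le_iff_meets)
  thus ?thesis using atom_le_eq[OF y(1)] atom_nonzero[OF x(1)] by simp
qed

text \<open>Distinct subidentity atoms have product zero, so any mismatch of sources, targets or
  middle ends would make \<open>p\<close> or \<open>q;r\<close> zero.\<close>

lemma arrow_le_comp_eq:
  assumes xz: "(x, z) \<in> E" and p: "arrow x z p" "p \<noteq> \<zero>"
    and E': "(x', y') \<in> E" "(y'', z') \<in> E"
    and q: "arrow x' y' q" and r: "arrow y'' z' r" and le: "p \<preceq> q \<Zsemi> r"
  shows "x' = x" "z' = z" "y'' = y'"
proof -
  note [simp] = arrow_closed[OF p(1)] arrow_closed[OF q] arrow_closed[OF r]
    E_atoms[OF xz] E_atoms[OF E'(1)] E_atoms[OF E'(2)]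
  have "p \<preceq> x' \<Zsemi> (q \<Zsemi> r)" using le arrow_left[OF q] by (simp add: comp_assoc)
  hence "x' \<Zsemi> p = p" by (intro subid_left[of x' p "q \<Zsemi> r"]) simp_all
  hence "(x' \<Zsemi> x) \<Zsemi> p = p" using arrow_left[OF p(1)] by (simp add: comp_assoc[symmetric])
  hence "x' \<Zsemi> x \<noteq> \<zero>" using p(2) by auto
  thus "x' = x" by (intro subid_atoms_eq) simp_all
  have "p \<preceq> (q \<Zsemi> r) \<Zsemi> z'" using le arrow_right[OF r] by (simp add: comp_assoc[symmetric])
  hence "p \<Zsemi> z' = p" by (intro subid_right[of z' p "q \<Zsemi> r"]) simp_all
  hence "p \<Zsemi> (z \<Zsemi> z') = p" using arrow_right[OF p(1)] by (simp add: comp_assoc)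
  hence "z \<Zsemi> z' \<noteq> \<zero>" using p(2) by auto
  hence "z = z'" by (intro subid_atoms_eq) simp_all
  thus "z' = z" by simp
  have "q \<Zsemi> r = q \<Zsemi> ((y' \<Zsemi> y'') \<Zsemi> r)"
    using arrow_right[OF q] arrow_left[OF r] by (simp add: comp_assoc) (simp add: comp_assoc[symmetric])
  moreover have "q \<Zsemi> r \<noteq> \<zero>" using le p(2) by (auto simp: le_zero_iff)
  ultimately have "y' \<Zsemi> y'' \<noteq> \<zero>" by auto
  hence "y' = y''" by (intro subid_atoms_eq) simp_all
  thus "y'' = y'" by simp
qed

text \<open>A cell below \<open>1'\<close> forces \<open>x = y\<close> and is then the atom
  \<open>x\<close> itself, so \<open>f\<^sup>\<smile>;g = x\<close>.\<close>

lemma cell_le_ident_iff: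
  assumes xy: "(x, y) \<in> E" and f: "f \<in> G x" and g: "g \<in> G y"
  shows "cell x y f g \<preceq> 1' \<longleftrightarrow> f = g"
proof
  have x: "measurable_atom A x" and y: "measurable_atom A y" using E_D[OF xy] by auto
  note [simp] = E_atoms[OF xy] f[THEN G_closed] g[THEN G_closed] a_closed[OF xy] cell_closed[OF xy f g]
  note c = cell_atom[OF xy f g]
  {
    assume le: "cell x y f g \<preceq> 1'"
    have "x \<Zsemi> (cell x y f g \<Zsemi> y) \<preceq> x \<Zsemi> (1' \<Zsemi> y)" using le by (intro comp_mono le_refl) simp_all
    hence le': "cell x y f g \<preceq> x \<Zsemi> y" using c(2) by (simp add: arrow_left arrow_right ident_comp)
    hence "x \<Zsemi> y \<noteq> \<zero>" using atom_nonzero[OF c(1)] by (auto simp: le_zero_iff)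
    hence yx: "y = x" using subid_atoms_eq[of x y] by simp
    have "cell x y f g \<preceq> x" using le' yx measurable_atomD(5)[OF x] by simp
    hence "cell x y f g = x"
      by (rule atom_le_eq[OF E_atoms(1)[OF xy] _ cell_closed[OF xy f g] atom_nonzero[OF c(1)]])
    hence "f \<Zsemi> (f\<^sup>\<smile> \<Zsemi> g) = f \<Zsemi> x"
      using arrow_left[OF G_arrow[OF y g]] yx by (simp add: cell_def a_ident[OF x])
    moreover have "arrow x x g" using G_arrow[OF y g] yx by simp
    ultimately show "f = g" using G_left_cancel(2)[OF x f] arrow_right[OF G_arrow[OF x f]] by simp
  }
  assume [simp]: "f = g"
  have "x = y" using G_disjoint[OF x y f] g by simp
  hence "cell x y f g = x"
    using G_conv_comp[OF x f] arrow_left[OF G_arrow[OF x f]] by (auto simp: cell_def a_ident[OF y])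
  thus "cell x y f g \<preceq> 1'" by simp
qed

text \<open>\<open>P\<close> may contain elements that are not atoms, so that a down-set
  \<open>{p. p \<preceq> c}\<close> can stand for \<open>c\<close>; Boolean operations on relations
  then become set operations on \<open>P\<close>.\<close>

definition cells where
  "cells P = {(f, g). \<exists>x y. (x, y) \<in> E \<and> f \<in> G x \<and> g \<in> G y \<and> cell x y f g \<in> P}"

lemma cells_iff:
  assumes "(x, y) \<in> E" "f \<in> G x" "g \<in> G y"
  shows "(f, g) \<in> cells P \<longleftrightarrow> cell x y f g \<in> P"
  using assms G_disjoint E_D unfolding cells_def by blast

lemma cellsE:
  assumes "(f, g) \<in> cells P"
  obtains x y where "(x, y) \<in> E" "f \<in> G x" "g \<in> G y" "cell x y f g \<in> P"
  using assms by (auto simp: cells_def)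

lemma cells_eqI:
  assumes "\<And>x y f g. (x, y) \<in> E \<Longrightarrow> f \<in> G x \<Longrightarrow> g \<in> G y \<Longrightarrow> cell x y f g \<in> P \<longleftrightarrow> cell x y f g \<in> Q"
  shows "cells P = cells Q"
  using assms unfolding cells_def by blast

lemma frame_unit_eq: "frame_unit F = cells UNIV"
  by (auto simp: frame_unit_def cells_def)

lemma cells_Un: "cells P \<union> cells Q = cells (P \<union> Q)"
  by (auto simp: cells_def)

lemma cells_Union: "\<Union> (cells ` \<P>) = cells (\<Union> \<P>)"
  by (auto simp: cells_def)

lemma cells_compl: "frame_unit F - cells P = cells (- P)"
proof (intro Set.set_eqI, clarify)
  fix f g
  show "(f, g) \<in> frame_unit F - cells P \<longleftrightarrow> (f, g) \<in> cells (- P)"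
  proof (cases "\<exists>x y. (x, y) \<in> E \<and> f \<in> G x \<and> g \<in> G y")
    case True
    thus ?thesis unfolding frame_unit_eq by (auto simp: cells_iff)
  next
    case False
    thus ?thesis unfolding frame_unit_eq by (auto simp: cells_def)
  qed
qed

lemma cells_converse: "(cells P)\<inverse> = cells {p \<in> carrier A. p\<^sup>\<smile> \<in> P}"
proof (intro Set.set_eqI iffI; clarify)
  fix f g
  {
    assume "(g, f) \<in> cells P"
    then obtain x y where *: "(x, y) \<in> E" "g \<in> G x" "f \<in> G y" "cell x y g f \<in> P" by (rule cellsE)
    thus "(f, g) \<in> cells {p \<in> carrier A. p\<^sup>\<smile> \<in> P}"
      using E_sym[OF *(1)] by (simp add: cells_iff cell_conv cell_closed)
  next
    assume "(f, g) \<in> cells {p \<in> carrier A. p\<^sup>\<smile> \<in> P}"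
    then obtain x y where *: "(x, y) \<in> E" "f \<in> G x" "g \<in> G y" "(cell x y f g)\<^sup>\<smile> \<in> P"
      by (auto elim: cellsE)
    thus "(g, f) \<in> cells P" using E_sym[OF *(1)] by (simp add: cells_iff cell_conv)
  }
qed

lemma Id_on_frame_base: "Id_on (frame_base F) = cells {p. p \<preceq> 1'}"
proof (intro Set.set_eqI iffI; clarify)
  fix f g
  {
    assume "f \<in> frame_base F"
    then obtain x where x: "measurable_atom A x" and f: "f \<in> G x"
      by (auto simp: frame_base_def measurable_atoms_def)
    show "(f, f) \<in> cells {p. p \<preceq> 1'}"
      using cell_le_ident_iff[OF E_refl[OF x] f f] by (simp add: cells_iff[OF E_refl[OF x] f f])
  next
    assume "(f, g) \<in> cells {p. p \<preceq> 1'}"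
    then obtain x y where *: "(x, y) \<in> E" "f \<in> G x" "g \<in> G y" "cell x y f g \<preceq> 1'"
      by (auto elim: cellsE)
    hence "f = g" by (simp add: cell_le_ident_iff)
    thus "(f, g) \<in> Id_on (frame_base F)"
      using * E_D by (auto simp: frame_base_def measurable_atoms_def)
  }
qed

text \<open>For \<open>f\<close> in the coset of \<open>f1\<close>, the product coset in
  \<open>frame_rel\<close> consists of the partners of \<open>f;f0\<close>, and being such a partner
  means that the cell of \<open>(f, g)\<close> is \<open>f0;a x y\<close>. A frame relation thus
  collects the pairs at which one atom holds.\<close>

lemma frame_rel_eq:
  assumes xy: "(x, y) \<in> E" and fg: "intertwines x y f0 g0"
  shows "frame_rel F x y (H x y #>\<^bsub>atom_group A x\<^esub> f0) = cells {f0 \<Zsemi> a x y}"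
proof -
  have x: "measurable_atom A x" and y: "measurable_atom A y" using E_D[OF xy] by auto
  let ?c = "\<lambda>f. H x y #>\<^bsub>atom_group A x\<^esub> f" and ?d = "\<lambda>g. H y x #>\<^bsub>atom_group A y\<^esub> g"
  note yx = E_sym[OF xy]
  have mem0: "f0 \<in> G x" "g0 \<in> G y" using fg by (simp_all add: intertwines_def)
  note [simp] = a_closed[OF xy] mem0[THEN G_closed]
  have key: "g \<in> phi F x y (?c f1) <#>\<^bsub>atom_group A y\<^esub> phi F x y (?c f0) \<longleftrightarrow> g \<in> G y \<and> cell x y f g = f0 \<Zsemi> a x y"
    if f1: "intertwines x y f1 g1" and f: "f \<in> ?c f1" for f1 g1 f g
  proof -
    have f: "intertwines x y f g1" using f by (simp add: stabilizer_coset_iff[OF xy f1])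
    have mem: "f \<in> G x" "g1 \<in> G y" using f by (simp_all add: intertwines_def)
    note [simp] = mem[THEN G_closed]
    have "phi F x y (?c f1) <#>\<^bsub>atom_group A y\<^esub> phi F x y (?c f0) = ?d (g1 \<Zsemi> g0)"
      using normal.rcos_sum[OF stabilizer_normal[OF yx] mem(2) mem0(2)]
      by (simp add: phi_coset[OF xy f1] phi_coset[OF xy fg])
    moreover have "g \<in> ?d (g1 \<Zsemi> g0) \<longleftrightarrow> intertwines x y (f \<Zsemi> f0) g"
      using stabilizer_coset_iff[OF yx, of "g1 \<Zsemi> g0" "f \<Zsemi> f0" g] intertwines_comp[OF xy f fg]
      by (simp add: intertwines_sym[OF xy])
    moreover have "intertwines x y (f \<Zsemi> f0) g \<longleftrightarrow> g \<in> G y \<and> cell x y f g = f0 \<Zsemi> a x y"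
    proof -
      have fa: "arrow x y (f0 \<Zsemi> a x y)"
        by (rule arrow_comp[OF G_arrow[OF x mem0(1)] a_arrow[OF xy] E_atoms(5,6)[OF xy]])
      have "f \<Zsemi> (f0 \<Zsemi> a x y) = a x y \<Zsemi> g \<longleftrightarrow> f\<^sup>\<smile> \<Zsemi> (a x y \<Zsemi> g) = f0 \<Zsemi> a x y" if g: "g \<in> G y"
        using G_left_cancel[OF x mem(1) fa]
          G_left_cancel[OF x mem(1) arrow_comp[OF a_arrow[OF xy] G_arrow[OF y g] E_atoms(5,6)[OF xy]]]
        by metis
      thus ?thesis using G_comp[OF x mem(1) mem0(1)] by (auto simp: intertwines_def cell_def comp_assoc)
    qed
    ultimately show ?thesis by simp
  qed
  show ?thesis
  proof (intro Set.set_eqI iffI; clarify)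
    fix f g
    {
      assume "(f, g) \<in> frame_rel F x y (?c f0)"
      then obtain f1 where f1: "f1 \<in> G x" "f \<in> ?c f1"
        "g \<in> phi F x y (?c f1) <#>\<^bsub>atom_group A y\<^esub> phi F x y (?c f0)"
        by (auto simp: frame_rel_def carrier_FactGroup)
      obtain g1 where g1: "intertwines x y f1 g1" using intertwines_ex_right[OF xy f1(1)] by blast
      have "f \<in> G x" using f1(2) coset_subset[OF xy f1(1)] by blast
      thus "(f, g) \<in> cells {f0 \<Zsemi> a x y}" using key[OF g1 f1(2)] f1(3) xy by (simp add: cells_iff)
    next
      assume "(f, g) \<in> cells {f0 \<Zsemi> a x y}"
      then obtain x' y' where *: "(x', y') \<in> E" "f \<in> G x'" "g \<in> G y'" "cell x' y' f g = f0 \<Zsemi> a x y"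
        by (auto elim: cellsE)
      have "arrow x y (f0 \<Zsemi> a x y)"
        by (rule arrow_comp[OF G_arrow[OF x mem0(1)] a_arrow[OF xy] E_atoms(5,6)[OF xy]])
      moreover have "arrow x' y' (f0 \<Zsemi> a x y)" using cell_atom(2)[OF *(1-3)] * by simp
      moreover have "f0 \<Zsemi> a x y \<noteq> \<zero>" using atom_nonzero[OF cell_atom(1)[OF *(1-3)]] * by simp
      \<comment> \<open>Source and target are read off by viewing the atom as its own composite with
        the arrow \<open>y\<close>.\<close>
      ultimately have xy': "x' = x" "y' = y"
        using arrow_le_comp_eq(1,2)[OF *(1), of "f0 \<Zsemi> a x y" x y y y "f0 \<Zsemi> a x y" y]
          xy E_refl[OF y] measurable_arrow_ident[OF y] arrow_right[of x y "f0 \<Zsemi> a x y"] by auto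
      have f: "f \<in> G x" using * xy' by simp
      obtain g1 where g1: "intertwines x y f g1" using intertwines_ex_right[OF xy f] by blast
      have ff: "f \<in> ?c f" using stabilizer_coset_iff[OF xy g1] g1 by simp
      have "g \<in> phi F x y (?c f) <#>\<^bsub>atom_group A y\<^esub> phi F x y (?c f0)"
        using key[OF g1 ff] * xy' by simp
      thus "(f, g) \<in> frame_rel F x y (?c f0)"
        using ff f by (auto simp: frame_rel_def carrier_FactGroup)
    }
  qed
qed

lemma frame_rels_eq: "frame_rels F = {cells {f \<Zsemi> a x y} | x y f. (x, y) \<in> E \<and> f \<in> G x}"
proof (intro Set.set_eqI iffI)
  fix R assume "R \<in> frame_rels F"
  then obtain x y f where *: "(x, y) \<in> E" "f \<in> G x" "R = frame_rel F x y (H x y #>\<^bsub>atom_group A x\<^esub> f)"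
    by (auto simp: frame_rels_def carrier_FactGroup)
  then obtain g where "intertwines x y f g" using intertwines_ex_right by blast
  thus "R \<in> {cells {f \<Zsemi> a x y} | x y f. (x, y) \<in> E \<and> f \<in> G x}" using * frame_rel_eq[OF *(1)] by auto
next
  fix R assume "R \<in> {cells {f \<Zsemi> a x y} | x y f. (x, y) \<in> E \<and> f \<in> G x}"
  then obtain x y f where *: "(x, y) \<in> E" "f \<in> G x" "R = cells {f \<Zsemi> a x y}" by auto
  then obtain g where "intertwines x y f g" using intertwines_ex_right by blast
  hence "R = frame_rel F x y (H x y #>\<^bsub>atom_group A x\<^esub> f)" using * frame_rel_eq[OF *(1)] by auto
  thus "R \<in> frame_rels F" using * by (auto simp: frame_rels_def carrier_FactGroup)
qed

lemma carrier_group_relation_algebra: "carrier \<GG>[F] = range cells"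
proof (intro Set.set_eqI iffI)
  fix S assume "S \<in> carrier \<GG>[F]"
  then obtain X where X: "S = \<Union> X" "X \<subseteq> frame_rels F" by (auto simp: group_relation_algebra_def)
  hence "X \<subseteq> range cells" by (auto simp: frame_rels_eq)
  then obtain \<P> where "X = cells ` \<P>" by (auto simp: subset_image_iff)
  thus "S \<in> range cells" using X cells_Union by auto
next
  fix S assume "S \<in> range cells"
  then obtain P where S: "S = cells P" by auto
  \<comment> \<open>Every cell is some translate \<open>f0;a x y\<close>, so \<open>P\<close> can be
    replaced by the translates in it, whose relations are frame relations.\<close>
  have "cells P \<subseteq> \<Union> {cells {f \<Zsemi> a x y} | x y f. (x, y) \<in> E \<and> f \<in> G x \<and> f \<Zsemi> a x y \<in> P}"
  proof clarify
    fix f g assume "(f, g) \<in> cells P"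
    then obtain x y where *: "(x, y) \<in> E" "f \<in> G x" "g \<in> G y" "cell x y f g \<in> P" by (rule cellsE)
    obtain f0 where f0: "f0 \<in> G x" "cell x y f g = f0 \<Zsemi> a x y"
      using arrow_atom_left[OF *(1) cell_atom[OF *(1-3)]] by blast
    have "(f, g) \<in> cells {f0 \<Zsemi> a x y}" using * f0 by (simp add: cells_iff)
    thus "(f, g) \<in> \<Union> {cells {f \<Zsemi> a x y} | x y f. (x, y) \<in> E \<and> f \<in> G x \<and> f \<Zsemi> a x y \<in> P}"
      using * f0 by auto
  qed
  moreover have "cells {p} \<subseteq> cells P" if "p \<in> P" for p
    using that by (auto simp: cells_def)
  ultimately have "S = \<Union> {cells {f \<Zsemi> a x y} | x y f. (x, y) \<in> E \<and> f \<in> G x \<and> f \<Zsemi> a x y \<in> P}"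
    unfolding S by auto
  moreover have "{cells {f \<Zsemi> a x y} | x y f. (x, y) \<in> E \<and> f \<in> G x \<and> f \<Zsemi> a x y \<in> P} \<subseteq> frame_rels F"
    by (auto simp: frame_rels_eq)
  ultimately show "S \<in> carrier \<GG>[F]" by (auto simp: group_relation_algebra_def)
qed

lemma group_relation_algebra_simps [simp]:
  "R \<oplus>\<^bsub>\<GG>[F]\<^esub> S = R \<union> S" "\<ominus>\<^bsub>\<GG>[F]\<^esub> R = frame_unit F - R" "R \<Zsemi>\<^bsub>\<GG>[F]\<^esub> S = R O S"
  "R\<^sup>\<smile>\<^bsub>\<GG>[F]\<^esub> = R\<inverse>" "1'\<^bsub>\<GG>[F]\<^esub> = Id_on (frame_base F)"
  by (simp_all add: group_relation_algebra_def)

section \<open>The group relation algebra of a scaffold\<close>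

definition Cells where "Cells = {cell x y f g | x y f g. (x, y) \<in> E \<and> f \<in> G x \<and> g \<in> G y}"

lemma cell_in_Cells: "(x, y) \<in> E \<Longrightarrow> f \<in> G x \<Longrightarrow> g \<in> G y \<Longrightarrow> cell x y f g \<in> Cells"
  by (auto simp: Cells_def)

lemma Cells_atom: "p \<in> Cells \<Longrightarrow> ra_atom A p"
  by (auto simp: Cells_def cell_atom)

lemma Cells_arrow: "p \<in> Cells \<Longrightarrow> \<exists>x y. (x, y) \<in> E \<and> arrow x y p"
  unfolding Cells_def using cell_atom(2) by blast

lemma Cells_dense:
  assumes "b \<in> carrier A" "b \<noteq> \<zero>" shows "\<exists>p\<in>Cells. p \<preceq> b"
proof -
  obtain x y f where *: "(x, y) \<in> E" "f \<in> G x" "f \<Zsemi> a x y \<preceq> b" using dense[OF assms] by blast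
  have x: "measurable_atom A x" and y: "measurable_atom A y" using E_D[OF *(1)] by auto
  have "cell x y (f\<^sup>\<smile>) y = f \<Zsemi> a x y"
    using * by (simp add: cell_def conv_conv arrow_right[OF a_arrow])
  thus ?thesis using cell_in_Cells[OF *(1) G_conv[OF x *(2)] ident_in_G[OF y]] *(3) by auto
qed

text \<open>From left to right a middle point is given and the cells compose at it. From right to
  left an inequality between atoms has to produce such a point, which is \<open>cell_split\<close>.
  The intersections with \<open>Cells\<close> discard members of \<open>P\<close> and
  \<open>Q\<close> that no pair realizes.\<close>

lemma cells_comp: "cells P O cells Q = cells {r. \<exists>p\<in>P \<inter> Cells. \<exists>q\<in>Q \<inter> Cells. r \<preceq> p \<Zsemi> q}"
proof (intro Set.set_eqI iffI; clarify)
  fix f g h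
  assume "(f, h) \<in> cells P" "(h, g) \<in> cells Q"
  then obtain x y y' z where xy: "(x, y) \<in> E" "f \<in> G x" "h \<in> G y" "cell x y f h \<in> P"
    and yz: "(y', z) \<in> E" "h \<in> G y'" "g \<in> G z" "cell y' z h g \<in> Q" by (auto elim!: cellsE)
  have [simp]: "y' = y" using G_disjoint[of y y' h] xy yz E_D[OF xy(1)] E_D[OF yz(1)] by auto
  have "cell x z f g \<preceq> cell x y f h \<Zsemi> cell y z h g" using xy yz by (intro cell_comp_le) simp_all
  moreover have "cell x y f h \<in> P \<inter> Cells" "cell y z h g \<in> Q \<inter> Cells"
    using xy yz cell_in_Cells by auto
  moreover have "(x, z) \<in> E" using E_trans[OF xy(1)] yz(1) by simp
  ultimately show "(f, g) \<in> cells {r. \<exists>p\<in>P \<inter> Cells. \<exists>q\<in>Q \<inter> Cells. r \<preceq> p \<Zsemi> q}"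
    using xy yz cells_iff[of x z f g] by blast
next
  fix f g
  assume "(f, g) \<in> cells {r. \<exists>p\<in>P \<inter> Cells. \<exists>q\<in>Q \<inter> Cells. r \<preceq> p \<Zsemi> q}"
  then obtain x z p q where xz: "(x, z) \<in> E" and f: "f \<in> G x" and g: "g \<in> G z"
    and p: "p \<in> P" "p \<in> Cells" and q: "q \<in> Q" "q \<in> Cells" and le: "cell x z f g \<preceq> p \<Zsemi> q"
    by (auto elim!: cellsE)
  obtain x' y where p': "(x', y) \<in> E" "arrow x' y p" using Cells_arrow[OF p(2)] by blast
  obtain y' z' where q': "(y', z') \<in> E" "arrow y' z' q" using Cells_arrow[OF q(2)] by blast
  note c = cell_atom[OF xz f g]
  note eq = arrow_le_comp_eq[OF xz c(2) atom_nonzero[OF c(1)] p'(1) q'(1) p'(2) q'(2) le]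
  have xy: "(x, y) \<in> E" and yz: "(y, z) \<in> E" and ar: "arrow x y p" "arrow y z q" using p' q' eq by auto
  obtain h where h: "h \<in> G y" "cell x y f h = p" "cell y z h g = q"
    using cell_split[OF xy yz f g Cells_atom[OF p(2)] ar(1) Cells_atom[OF q(2)] ar(2) le] by blast
  have "(f, h) \<in> cells P" using cells_iff[OF xy f h(1)] h p by simp
  moreover have "(h, g) \<in> cells Q" using cells_iff[OF yz h(1) g] h q by simp
  ultimately show "(f, g) \<in> cells P O cells Q" by blast
qed

section \<open>Relation algebra structure and completeness of the algebra of relations\<close>

lemma cells_subset: "cells P \<subseteq> frame_unit F"
  by (auto simp: frame_unit_eq cells_def)

lemma Id_on_subset: "Id_on (frame_base F) \<subseteq> frame_unit F"
  unfolding Id_on_frame_base by (rule cells_subset)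

lemma cells_base: "(f, g) \<in> cells P \<Longrightarrow> f \<in> frame_base F \<and> g \<in> frame_base F"
  using E_D by (fastforce simp: frame_base_def measurable_atoms_def elim: cellsE)

lemma group_relation_algebra_unit: "ra_unit \<GG>[F] = frame_unit F"
  using Id_on_subset by (auto simp: ra_unit_def)

lemma group_relation_algebra_zero: "ra_zero \<GG>[F] = {}"
  by (simp add: ra_zero_def group_relation_algebra_unit)

lemma group_relation_algebra_le: "R \<preceq>\<^bsub>\<GG>[F]\<^esub> S \<longleftrightarrow> R \<subseteq> S"
  by (auto simp: ra_le_def)

lemma group_relation_algebra_meet:
  "R \<subseteq> frame_unit F \<Longrightarrow> S \<subseteq> frame_unit F \<Longrightarrow> R \<odot>\<^bsub>\<GG>[F]\<^esub> S = R \<inter> S"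
  by (auto simp: ra_meet_def)

lemma carrier_subset: "R \<in> carrier \<GG>[F] \<Longrightarrow> R \<subseteq> frame_unit F"
  using cells_subset by (auto simp: carrier_group_relation_algebra)

text \<open>The identities are those of binary relations; the content is closure of the universe,
  above all under composition, which rests on \<open>cells_comp\<close>.\<close>

lemma relation_algebra_group_relation_algebra: "relation_algebra \<GG>[F]"
proof -
  note simps = group_relation_algebra_unit group_relation_algebra_zero
  have un: "R \<union> S \<in> carrier \<GG>[F]" if "R \<in> carrier \<GG>[F]" "S \<in> carrier \<GG>[F]" for R S
    using that by (auto simp: carrier_group_relation_algebra cells_Un)
  have ne: "frame_unit F - R \<in> carrier \<GG>[F]" if "R \<in> carrier \<GG>[F]" for R
    using that by (auto simp: carrier_group_relation_algebra cells_compl)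
  have co: "R O S \<in> carrier \<GG>[F]" if "R \<in> carrier \<GG>[F]" "S \<in> carrier \<GG>[F]" for R S
    using that by (auto simp: carrier_group_relation_algebra cells_comp)
  have cv: "R\<inverse> \<in> carrier \<GG>[F]" if "R \<in> carrier \<GG>[F]" for R
    using that by (auto simp: carrier_group_relation_algebra cells_converse)
  have base: "f \<in> frame_base F \<and> g \<in> frame_base F" if "(f, g) \<in> R" "R \<in> carrier \<GG>[F]" for f g R
    using that cells_base by (auto simp: carrier_group_relation_algebra)
  have me: "R \<odot>\<^bsub>\<GG>[F]\<^esub> S = R \<inter> S" if "R \<in> carrier \<GG>[F]" "S \<in> carrier \<GG>[F]" for R S
    using that by (intro group_relation_algebra_meet carrier_subset)
  have top: "frame_unit F \<in> carrier \<GG>[F]"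
    by (auto simp: carrier_group_relation_algebra frame_unit_eq)
  have int: "R \<inter> S \<in> carrier \<GG>[F]" if "R \<in> carrier \<GG>[F]" "S \<in> carrier \<GG>[F]" for R S
    using that me[OF that] un ne by (metis group_relation_algebra_simps(1,2) ra_meet_def)
  show ?thesis
  proof
    fix R S T assume R: "R \<in> carrier \<GG>[F]" and S: "S \<in> carrier \<GG>[F]" and T: "T \<in> carrier \<GG>[F]"
    show "R \<oplus>\<^bsub>\<GG>[F]\<^esub> (S \<odot>\<^bsub>\<GG>[F]\<^esub> T) = (R \<oplus>\<^bsub>\<GG>[F]\<^esub> S) \<odot>\<^bsub>\<GG>[F]\<^esub> (R \<oplus>\<^bsub>\<GG>[F]\<^esub> T)"
      using R S T by (auto simp: me un)
    show "R \<odot>\<^bsub>\<GG>[F]\<^esub> (S \<oplus>\<^bsub>\<GG>[F]\<^esub> T) = (R \<odot>\<^bsub>\<GG>[F]\<^esub> S) \<oplus>\<^bsub>\<GG>[F]\<^esub> (R \<odot>\<^bsub>\<GG>[F]\<^esub> T)"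
      using R S T by (auto simp: me un)
  next
    fix R assume R: "R \<in> carrier \<GG>[F]"
    show "R \<odot>\<^bsub>\<GG>[F]\<^esub> ra_unit \<GG>[F] = R"
      using carrier_subset[OF R] by (auto simp: me[OF R top] simps)
    show "R \<oplus>\<^bsub>\<GG>[F]\<^esub> \<ominus>\<^bsub>\<GG>[F]\<^esub> R = ra_unit \<GG>[F]"
      using carrier_subset[OF R] by (auto simp: simps)
    show "R \<odot>\<^bsub>\<GG>[F]\<^esub> \<ominus>\<^bsub>\<GG>[F]\<^esub> R = ra_zero \<GG>[F]"
      by (auto simp: me[OF R ne[OF R]] simps)
    show "R \<Zsemi>\<^bsub>\<GG>[F]\<^esub> 1'\<^bsub>\<GG>[F]\<^esub> = R"
      using base[OF _ R] by auto
  next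
    fix R S assume R: "R \<in> carrier \<GG>[F]" and S: "S \<in> carrier \<GG>[F]"
    have "R\<inverse> O (frame_unit F - R O S) \<subseteq> frame_unit F"
      by (rule carrier_subset[OF co[OF cv[OF R] ne[OF co[OF R S]]]])
    thus "(R\<^sup>\<smile>\<^bsub>\<GG>[F]\<^esub> \<Zsemi>\<^bsub>\<GG>[F]\<^esub> \<ominus>\<^bsub>\<GG>[F]\<^esub> (R \<Zsemi>\<^bsub>\<GG>[F]\<^esub> S)) \<oplus>\<^bsub>\<GG>[F]\<^esub> \<ominus>\<^bsub>\<GG>[F]\<^esub> S = \<ominus>\<^bsub>\<GG>[F]\<^esub> S"
      by auto
  next
    show "1'\<^bsub>\<GG>[F]\<^esub> \<in> carrier \<GG>[F]" by (auto simp: carrier_group_relation_algebra Id_on_frame_base)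
  qed (auto simp: un ne co cv simps)
qed

lemma complete_group_relation_algebra: "ra_complete \<GG>[F]"
  unfolding ra_complete_def
proof -
  have Un: "\<Union> X \<in> carrier \<GG>[F]" if X: "X \<subseteq> carrier \<GG>[F]" for X
  proof -
    obtain \<P> where "X = cells ` \<P>" using X by (auto simp: carrier_group_relation_algebra subset_image_iff)
    thus ?thesis using cells_Union by (auto simp: carrier_group_relation_algebra)
  qed
  show "complete_lattice (ra_order \<GG>[F])"
  proof
    fix X assume X: "X \<subseteq> carrier (ra_order \<GG>[F])"
    have "least (ra_order \<GG>[F]) (\<Union> X) (Upper (ra_order \<GG>[F]) X)"
      using X Un[of X] by (auto simp: ra_order_def least_def Upper_def group_relation_algebra_le)
    thus "\<exists>s. least (ra_order \<GG>[F]) s (Upper (ra_order \<GG>[F]) X)" by blast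
    \<comment> \<open>The infimum is the union of all lower bounds: closure under unions is at hand,
      whereas the intersection of an empty family need not lie below the unit.\<close>
    let ?L = "Lower (ra_order \<GG>[F]) X"
    have "greatest (ra_order \<GG>[F]) (\<Union> ?L) ?L"
      using X Un[of ?L] by (auto simp: ra_order_def greatest_def Lower_def group_relation_algebra_le)
    thus "\<exists>i. greatest (ra_order \<GG>[F]) i ?L" by blast
  qed (auto simp: ra_order_def group_relation_algebra_le)
qed

end

section \<open>The representation of a dense extension\<close>

locale dense_extension = scaffolded_algebra A a + C: relation_algebra C
  for A :: "'a relalg" (structure) and a and C :: "'c relalg" +
  fixes e
  assumes hom: "e \<in> ra_hom A C"
    and inj: "inj_on e (carrier A)"
    and dense_image: "\<And>c. c \<in> carrier C \<Longrightarrow> c \<noteq> ra_zero C \<Longrightarrow>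
      \<exists>b\<in>carrier A. b \<noteq> ra_zero A \<and> e b \<preceq>\<^bsub>C\<^esub> c"
begin

lemma e_closed [simp]: "r \<in> carrier A \<Longrightarrow> e r \<in> carrier C"
  using hom by (auto simp: ra_hom_def)

lemma e_simps:
  "r \<in> carrier A \<Longrightarrow> s \<in> carrier A \<Longrightarrow> e (r \<oplus> s) = e r \<oplus>\<^bsub>C\<^esub> e s"
  "r \<in> carrier A \<Longrightarrow> e (\<ominus> r) = \<ominus>\<^bsub>C\<^esub> e r"
  "r \<in> carrier A \<Longrightarrow> s \<in> carrier A \<Longrightarrow> e (r \<Zsemi> s) = e r \<Zsemi>\<^bsub>C\<^esub> e s"
  "r \<in> carrier A \<Longrightarrow> e (r\<^sup>\<smile>) = (e r)\<^sup>\<smile>\<^bsub>C\<^esub>"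
  "e 1' = 1'\<^bsub>C\<^esub>"
  using hom by (auto simp: ra_hom_def)

lemma e_zero: "e (ra_zero A) = ra_zero C"
  by (simp add: ra_zero_def ra_unit_def e_simps)

lemma e_eq_iff: "r \<in> carrier A \<Longrightarrow> s \<in> carrier A \<Longrightarrow> e r = e s \<longleftrightarrow> r = s"
  using inj by (auto dest: inj_onD)

lemma e_le_iff: "r \<in> carrier A \<Longrightarrow> s \<in> carrier A \<Longrightarrow> e r \<preceq>\<^bsub>C\<^esub> e s \<longleftrightarrow> r \<preceq> s"
  by (simp add: ra_le_def e_simps(1)[symmetric] e_eq_iff)

text \<open>By density a nonzero \<open>c\<close> below \<open>e p\<close> contains some nonzero
  \<open>e b\<close>, and \<open>b\<close> can only be \<open>p\<close>.\<close>

lemma e_atom: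
  assumes p: "ra_atom A p" shows "ra_atom C (e p)"
proof -
  note [simp] = atom_closed[OF p]
  have "c = e p" if c: "c \<in> carrier C" "c \<preceq>\<^bsub>C\<^esub> e p" "c \<noteq> ra_zero C" for c
  proof -
    obtain b where b: "b \<in> carrier A" "b \<noteq> ra_zero A" "e b \<preceq>\<^bsub>C\<^esub> c" using dense_image[OF c(1,3)] by blast
    have "e b \<preceq>\<^bsub>C\<^esub> e p" by (rule C.le_trans[OF b(3) c(2)]) (simp_all add: b c)
    hence "b = p" using b by (intro atom_le_eq[OF p]) (simp_all add: e_le_iff)
    thus ?thesis using b c by (intro C.le_antisym) simp_all
  qed
  moreover have "e p \<noteq> ra_zero C" using atom_nonzero[OF p] by (simp add: e_zero[symmetric] e_eq_iff)
  ultimately show ?thesis unfolding ra_atom_def by auto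
qed

lemma Cells_closed [simp]: "p \<in> Cells \<Longrightarrow> p \<in> carrier A"
  using Cells_atom by auto

lemma e_Cells_dense:
  assumes c: "c \<in> carrier C" "c \<noteq> ra_zero C" shows "\<exists>p\<in>Cells. e p \<preceq>\<^bsub>C\<^esub> c"
proof -
  obtain b where b: "b \<in> carrier A" "b \<noteq> ra_zero A" "e b \<preceq>\<^bsub>C\<^esub> c" using dense_image[OF c] by blast
  obtain p where p: "p \<in> Cells" "p \<preceq> b" using Cells_dense[OF b(1,2)] by blast
  hence "e p \<preceq>\<^bsub>C\<^esub> e b" using b by (simp add: e_le_iff)
  hence "e p \<preceq>\<^bsub>C\<^esub> c" by (rule C.le_trans[OF _ b(3)]) (use p b c in simp_all)
  thus ?thesis using p by blast
qed

definition rep where "rep c = cells {p. e p \<preceq>\<^bsub>C\<^esub> c}"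

text \<open>The images of cells are a dense set of atoms of the extension, so a cell below a
  composite already lies below a composite of two cells, where \<open>cells_comp\<close>
  applies.\<close>

lemma rep_comp:
  assumes c: "c \<in> carrier C" and d: "d \<in> carrier C"
  shows "rep (c \<Zsemi>\<^bsub>C\<^esub> d) = rep c O rep d"
  unfolding rep_def cells_comp
proof (rule cells_eqI)
  fix x y f g assume "(x, y) \<in> E" "f \<in> G x" "g \<in> G y"
  hence p: "cell x y f g \<in> Cells" by (rule cell_in_Cells)
  let ?p = "cell x y f g"
  have "e ?p \<preceq>\<^bsub>C\<^esub> c \<Zsemi>\<^bsub>C\<^esub> d \<longleftrightarrow> (\<exists>q\<in>Cells. \<exists>q'\<in>Cells. e q \<preceq>\<^bsub>C\<^esub> c \<and> e q' \<preceq>\<^bsub>C\<^esub> d \<and> e ?p \<preceq>\<^bsub>C\<^esub> e q \<Zsemi>\<^bsub>C\<^esub> e q')"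
  proof
    assume "e ?p \<preceq>\<^bsub>C\<^esub> c \<Zsemi>\<^bsub>C\<^esub> d"
    thus "\<exists>q\<in>Cells. \<exists>q'\<in>Cells. e q \<preceq>\<^bsub>C\<^esub> c \<and> e q' \<preceq>\<^bsub>C\<^esub> d \<and> e ?p \<preceq>\<^bsub>C\<^esub> e q \<Zsemi>\<^bsub>C\<^esub> e q'"
      using C.atom_le_comp_split[of "e ` Cells" "e ?p" c d] e_Cells_dense e_atom[OF Cells_atom] p c d
      by auto
  next
    assume "\<exists>q\<in>Cells. \<exists>q'\<in>Cells. e q \<preceq>\<^bsub>C\<^esub> c \<and> e q' \<preceq>\<^bsub>C\<^esub> d \<and> e ?p \<preceq>\<^bsub>C\<^esub> e q \<Zsemi>\<^bsub>C\<^esub> e q'"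
    then obtain q q' where q: "q \<in> Cells" "q' \<in> Cells" "e q \<preceq>\<^bsub>C\<^esub> c" "e q' \<preceq>\<^bsub>C\<^esub> d"
      and le: "e ?p \<preceq>\<^bsub>C\<^esub> e q \<Zsemi>\<^bsub>C\<^esub> e q'" by blast
    have "e q \<Zsemi>\<^bsub>C\<^esub> e q' \<preceq>\<^bsub>C\<^esub> c \<Zsemi>\<^bsub>C\<^esub> d" by (rule C.comp_mono[OF q(3,4)]) (use q c d in simp_all)
    thus "e ?p \<preceq>\<^bsub>C\<^esub> c \<Zsemi>\<^bsub>C\<^esub> d" by (rule C.le_trans[OF le]) (use q c d p in simp_all)
  qed
  thus "?p \<in> {p. e p \<preceq>\<^bsub>C\<^esub> c \<Zsemi>\<^bsub>C\<^esub> d} \<longleftrightarrow>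
      ?p \<in> {r. \<exists>p\<in>{p. e p \<preceq>\<^bsub>C\<^esub> c} \<inter> Cells. \<exists>q\<in>{p. e p \<preceq>\<^bsub>C\<^esub> d} \<inter> Cells. r \<preceq> p \<Zsemi> q}"
    using p by (auto simp: e_simps(3)[symmetric] e_le_iff)
qed

lemma rep_hom: "rep \<in> ra_hom C \<GG>[F]"
  unfolding ra_hom_def
proof (intro CollectI conjI ballI)
  show "rep \<in> carrier C \<rightarrow> carrier \<GG>[F]" by (auto simp: rep_def carrier_group_relation_algebra)
  fix c assume c: "c \<in> carrier C"
  show "rep (\<ominus>\<^bsub>C\<^esub> c) = \<ominus>\<^bsub>\<GG>[F]\<^esub> rep c"
    using c e_atom[OF cell_atom(1)]
    by (auto simp: rep_def cells_compl C.atom_le_neg_iff intro!: cells_eqI)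
  show "rep (c\<^sup>\<smile>\<^bsub>C\<^esub>) = (rep c)\<^sup>\<smile>\<^bsub>\<GG>[F]\<^esub>"
    using c C.conv_le_iff[of _ "c\<^sup>\<smile>\<^bsub>C\<^esub>"]
    by (auto simp: rep_def cells_converse e_simps(4) C.conv_conv cell_closed intro!: cells_eqI)
  fix d assume d: "d \<in> carrier C"
  show "rep (c \<oplus>\<^bsub>C\<^esub> d) = rep c \<oplus>\<^bsub>\<GG>[F]\<^esub> rep d"
    using c d e_atom[OF cell_atom(1)]
    by (auto simp: rep_def cells_Un C.atom_le_add_iff intro!: cells_eqI)
  show "rep (c \<Zsemi>\<^bsub>C\<^esub> d) = rep c \<Zsemi>\<^bsub>\<GG>[F]\<^esub> rep d" using c d by (simp add: rep_comp)
next
  show "rep 1'\<^bsub>C\<^esub> = 1'\<^bsub>\<GG>[F]\<^esub>"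
    unfolding group_relation_algebra_simps Id_on_frame_base rep_def
    by (rule cells_eqI) (simp add: e_simps(5)[symmetric] e_le_iff cell_closed)
qed

lemma cells_subset_cellsD:
  assumes "cells P \<subseteq> cells Q" shows "P \<inter> Cells \<subseteq> Q"
proof
  fix p assume "p \<in> P \<inter> Cells"
  then obtain x y f g where *: "(x, y) \<in> E" "f \<in> G x" "g \<in> G y" "p = cell x y f g" "p \<in> P"
    by (auto simp: Cells_def)
  hence "(f, g) \<in> cells Q" using assms cells_iff[OF *(1-3), of P] by auto
  thus "p \<in> Q" using * by (simp add: cells_iff)
qed

text \<open>If \<open>c\<close> is not below \<open>d\<close>, a cell lies in their difference, and
  its pairs belong to \<open>rep c\<close> but not to \<open>rep d\<close>.\<close>

lemma rep_inj: "inj_on rep (carrier C)"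
proof -
  have "c \<preceq>\<^bsub>C\<^esub> d" if c: "c \<in> carrier C" and d: "d \<in> carrier C" and le: "rep c \<subseteq> rep d" for c d
  proof (rule ccontr)
    assume "\<not> c \<preceq>\<^bsub>C\<^esub> d"
    hence "c \<odot>\<^bsub>C\<^esub> \<ominus>\<^bsub>C\<^esub> d \<noteq> ra_zero C" using c d by (simp add: C.le_iff_meet_neg)
    then obtain p where p: "p \<in> Cells" "e p \<preceq>\<^bsub>C\<^esub> c \<odot>\<^bsub>C\<^esub> \<ominus>\<^bsub>C\<^esub> d"
      using e_Cells_dense[of "c \<odot>\<^bsub>C\<^esub> \<ominus>\<^bsub>C\<^esub> d"] c d by auto
    have "e p \<preceq>\<^bsub>C\<^esub> c" by (rule C.le_trans[OF p(2)]) (use p c d in simp_all)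
    moreover have "e p \<preceq>\<^bsub>C\<^esub> \<ominus>\<^bsub>C\<^esub> d" by (rule C.le_trans[OF p(2)]) (use p c d in simp_all)
    hence "\<not> e p \<preceq>\<^bsub>C\<^esub> d" using C.atom_le_neg_iff[OF e_atom[OF Cells_atom[OF p(1)]] d] by simp
    ultimately show False using cells_subset_cellsD[OF le[unfolded rep_def]] p(1) by blast
  qed
  thus ?thesis by (auto intro!: inj_onI C.le_antisym)
qed

text \<open>The preimage of \<open>cells P\<close> is the sum of the images of the cells in
  \<open>P\<close>. No further cell gets below this sum: a cell outside \<open>P\<close> is an atom
  different from all those summed, so its complement is an upper bound too.\<close>

lemma rep_surj:
  assumes "ra_complete C" shows "rep ` carrier C = carrier \<GG>[F]"
proof
  show "rep ` carrier C \<subseteq> carrier \<GG>[F]" by (auto simp: rep_def carrier_group_relation_algebra)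
  show "carrier \<GG>[F] \<subseteq> rep ` carrier C"
  proof
    fix S assume "S \<in> carrier \<GG>[F]"
    then obtain P where S: "S = cells P" by (auto simp: carrier_group_relation_algebra)
    let ?X = "e ` (P \<inter> Cells)"
    have X: "?X \<subseteq> carrier (ra_order C)" by (auto simp: ra_order_def)
    obtain s where s: "ra_is_sum C ?X s"
      using complete_lattice.sup_exists[OF assms[unfolded ra_complete_def] X] by blast
    have sc: "s \<in> carrier C" using s by (auto simp: least_def Upper_def ra_order_def)
    have ub: "e p \<preceq>\<^bsub>C\<^esub> s" if "p \<in> P" "p \<in> Cells" for p
      using s that by (auto simp: least_def Upper_def ra_order_def)
    have lub: "s \<preceq>\<^bsub>C\<^esub> u" if "u \<in> carrier C" "\<And>p. p \<in> P \<Longrightarrow> p \<in> Cells \<Longrightarrow> e p \<preceq>\<^bsub>C\<^esub> u" for u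
      using s that by (auto simp: least_def Upper_def ra_order_def)
    have iff: "e q \<preceq>\<^bsub>C\<^esub> s \<longleftrightarrow> q \<in> P" if q: "q \<in> Cells" for q
    proof
      assume le: "e q \<preceq>\<^bsub>C\<^esub> s"
      show "q \<in> P"
      proof (rule ccontr)
        assume "q \<notin> P"
        have "e p \<preceq>\<^bsub>C\<^esub> \<ominus>\<^bsub>C\<^esub> (e q)" if p: "p \<in> P" "p \<in> Cells" for p
        proof -
          have "\<not> p \<preceq> q"
            using p \<open>q \<notin> P\<close> atom_le_eq[OF Cells_atom[OF q], of p] atom_nonzero[OF Cells_atom[OF p(2)]] by auto
          thus ?thesis using p q C.atom_le_neg_iff[OF e_atom[OF Cells_atom[OF p(2)]], of "e q"]
            by (simp add: e_le_iff)
        qed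
        hence "s \<preceq>\<^bsub>C\<^esub> \<ominus>\<^bsub>C\<^esub> (e q)" using q by (intro lub) simp_all
        with le have "e q \<preceq>\<^bsub>C\<^esub> \<ominus>\<^bsub>C\<^esub> (e q)" by (rule C.le_trans) (use q sc in simp_all)
        thus False using C.atom_le_neg_iff[OF e_atom[OF Cells_atom[OF q]], of "e q"] q by simp
      qed
    qed (use ub q in blast)
    have "rep s = S" unfolding rep_def S by (rule cells_eqI) (simp add: iff cell_in_Cells)
    thus "S \<in> rep ` carrier C" using sc by blast
  qed
qed

lemma rep_isomorphic: "ra_complete C \<Longrightarrow> C \<cong>\<^sub>r \<GG>[F]"
  using rep_hom rep_inj rep_surj by (auto simp: ra_isomorphic_def bij_betw_def)

end

context scaffolded_algebra
begin

section \<open>Existence and uniqueness of the completion\<close>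

lemma dense_extension_completion:
  assumes "ra_completion A e C" shows "dense_extension A a C e"
proof -
  interpret C: relation_algebra C using assms by (simp add: ra_completion_def)
  show ?thesis by unfold_locales (use assms in \<open>auto simp: ra_completion_def\<close>)
qed

lemma group_relation_algebra_completion: "\<exists>e. ra_completion A e \<GG>[F]"
proof -
  interpret self: dense_extension A a A id
  proof
    show "id \<in> ra_hom A A" by (simp add: ra_hom_def)
    show "\<exists>b\<in>carrier A. b \<noteq> \<zero> \<and> id b \<preceq> c" if "c \<in> carrier A" "c \<noteq> \<zero>" for c
      using that by (intro bexI[of _ c]) simp_all
  qed simp
  have "\<exists>b\<in>carrier A. b \<noteq> ra_zero A \<and> self.rep b \<preceq>\<^bsub>\<GG>[F]\<^esub> S"
    if S: "S \<in> carrier \<GG>[F]" "S \<noteq> ra_zero \<GG>[F]" for S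
  proof -
    obtain P where P: "S = cells P" using S by (auto simp: carrier_group_relation_algebra)
    then obtain f g where "(f, g) \<in> cells P" using S by (auto simp: group_relation_algebra_zero)
    then obtain x y where *: "(x, y) \<in> E" "f \<in> G x" "g \<in> G y" "cell x y f g \<in> P" by (rule cellsE)
    let ?p = "cell x y f g"
    note p = cell_atom(1)[OF *(1-3)]
    \<comment> \<open>The only cell below the atom \<open>?p\<close> is \<open>?p\<close>, so its
      representation contains just the pairs with this cell; this gives density.\<close>
    have "self.rep ?p \<subseteq> cells P"
    proof clarify
      fix f' g' assume "(f', g') \<in> self.rep ?p"
      then obtain x' y' where **: "(x', y') \<in> E" "f' \<in> G x'" "g' \<in> G y'" "cell x' y' f' g' \<preceq> ?p"
        by (auto simp: self.rep_def elim: cellsE)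
      note q = cell_atom(1)[OF **(1-3)]
      have "cell x' y' f' g' = ?p" by (rule atom_le_eq[OF p **(4) atom_closed[OF q] atom_nonzero[OF q]])
      thus "(f', g') \<in> cells P" using * by (simp add: cells_iff[OF **(1-3)])
    qed
    thus ?thesis using p atom_nonzero[OF p] P by (auto simp: group_relation_algebra_le intro!: bexI[of _ ?p])
  qed
  hence "ra_completion A self.rep \<GG>[F]"
    using relation_algebra_group_relation_algebra complete_group_relation_algebra self.rep_hom self.rep_inj
    by (simp add: ra_completion_def)
  thus ?thesis by blast
qed

end

text \<open>A statement about all completions on a type \<open>'c\<close> could be vacuous, so a
  completion is also exhibited on the carrier type of \<open>\<GG>[F]\<close>. One frame serves both
  clauses.\<close>

theorem theorem7p4:
  fixes B :: "'a relalg"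
  assumes "measurable_relation_algebra B"
    and "\<exists>a. scaffold B a"
  shows "\<exists>F :: ('a, 'a) grp_pair. frame F \<and>
    (\<exists>(C :: ('a \<times> 'a) set relalg) e. ra_completion B e C \<and> C \<cong>\<^sub>r \<GG>[F]) \<and>
    (\<forall>(C :: 'c relalg) e. ra_completion B e C \<longrightarrow> C \<cong>\<^sub>r \<GG>[F])"
proof -
  obtain a where a: "scaffold B a" using assms(2) by blast
  interpret relation_algebra B using assms(1) by (simp add: measurable_relation_algebra_def)
  interpret scaffolded_algebra B a by unfold_locales (use assms(1) a in simp_all)
  \<comment> \<open>The carrier type is left generic here because the fact is used both at the type
    of relations and at \<open>'c\<close>.\<close>
  have iso: "C \<cong>\<^sub>r \<GG>[F]" if "ra_completion B e C" for C :: "'d relalg" and e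
    using dense_extension.rep_isomorphic[OF dense_extension_completion[OF that]] that
    by (simp add: ra_completion_def)
  obtain e where e: "ra_completion B e \<GG>[F]" using group_relation_algebra_completion by blast
  hence "\<exists>(C :: ('a \<times> 'a) set relalg) e. ra_completion B e C \<and> C \<cong>\<^sub>r \<GG>[F]"
    using iso by blast
  thus ?thesis using frame_scaffold_frame iso by blast
qed

end
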